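(* In the Delsarte-dual setting of the context, let $\mathbf{k}=(k_1,\dots,k_t)\in\mathbb{N}^t$ with $k=\sum_ik_i$, $\mathbf{n}=(n_1,\dots,n_t)$ with $n=\sum_in_i$, and suppose $U$ is $\mathbf{k}$-scattered with respect to the hyperplanes in $\mathbb{V}(k,q^m)$ of type $\mathbf{n}$. Then the Delsarte dual $U^d$ is $(\mathbf{n}-\mathbf{k})$-scattered with respect to the hyperplanes in $\mathbb{V}(n-k,q^m)$ of type $\mathbf{n}$, where $\mathbf{n}-\mathbf{k}=(n_1-k_1,\dots,n_t-k_t)$.
   Context: Let $q$ be a prime power, $m$ a positive integer, $1\le k<n$. Let $\mathbb{V}(n,q^m)$ be an $n$-dim $\mathbb{F}_{q^m}$-space, $W$ an $n$-dim $\mathbb{F}_q$-subspace with $\langle W\rangle_{\mathbb{F}_{q^m}}=\mathbb{V}(n,q^m)$, $\sigma'$ a non-degenerate reflexive $\mathbb{F}_q$-bilinear form on $W$, $\sigma$ its $\mathbb{F}_{q^m}$-bilinear extension, $\perp$ orthogonal complement w.r.t. $\sigma$, $\Gamma$ an $(n-k)$-dim $\mathbb{F}_{q^m}$-subspace with $\Gamma\cap W=\{0\}$; $\mathbb{V}(k,q^m)=\mathbb{V}(n,q^m)/\Gamma$, $U=(W+\Gamma)/\Gamma$, $\mathbb{V}(n-k,q^m)=\mathbb{V}(n,q^m)/\Gamma^\perp$, $U^d=(W+\Gamma^\perp)/\Gamma^\perp$ (a Delsarte dual). For an $\mathbb{F}_{q^m}$-space $V$ of dimension $K=\sum_ia_i$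 and $\mathbf{a}=(a_1,\dots,a_t)$, $\mathbf{b}=(b_1,\dots,b_t)$, $N=\sum_ib_i$: an $\mathbb{F}_q$-subspace $U'$ of $V$ with $\dim_{\mathbb{F}_q}U'=N$ is decomposable of type $(\mathbf{a},\mathbf{b})$ if $U'=U_1\oplus\dots\oplus U_t$, $\dim_{\mathbb{F}_q}U_i=b_i$, and $V=F_1\oplus\dots\oplus F_t$ with $F_i=\langle U_i\rangle_{\mathbb{F}_{q^m}}$ of dimension $a_i$ (order of components immaterial). $U'$ is $\mathbf{a}$-scattered with respect to the hyperplanes of type $\mathbf{b}$ if: (1) it is decomposable of type $(\mathbf{a},\mathbf{b})$; (2) $b_i>a_i$ and $\dim_{\mathbb{F}_q}(U_i\cap H')\le a_i-1$ for every $\mathbb{F}_{q^m}$-hyperplane $H'$ of $F_i$, for all $i$; (3) $\dim_{\mathbb{F}_q}(U'\cap H)\le K-1$ for every $\mathbb{F}_{q^m}$-hyperplane $H$ of $V$ containing none of the $F_i$. *)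

theory Defs
  imports
    "Jordan_Normal_Form.Missing_VectorSpace"
    "HOL-Algebra.AbelCoset"
    "HOL-Algebra.Subrings"
    "HOL-Computational_Algebra.Primes"
begin

text \<open>
  Vector spaces are modules with explicit carriers over a field. For a subfield \<open>F\<close> of \<open>K\<close>, a
  \<open>K\<close>-space \<open>V\<close> is regarded as an \<open>F\<close>-space by replacing the scalars \<open>K\<close> by
  \<open>K\<lparr>carrier := F\<rparr>\<close>; the module record \<open>V\<close> itself does not change.
\<close>

abbreviation sub_scalars :: "'a ring \<Rightarrow> 'a set \<Rightarrow> 'a ring"
  where "sub_scalars K F \<equiv> K\<lparr>carrier := F\<rparr>"

abbreviation sub_dim :: "'a ring \<Rightarrow> ('a, 'c) module \<Rightarrow> 'c set \<Rightarrow> nat"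
  where "sub_dim K V S \<equiv> vectorspace.dim K (V\<lparr>carrier := S\<rparr>)"

abbreviation lin_span :: "'a ring \<Rightarrow> ('a, 'c) module \<Rightarrow> 'c set \<Rightarrow> 'c set"
  where "lin_span K V S \<equiv> LinearCombinations.module.span K V S"

text \<open>
  The fields \<open>mult\<close> and \<open>one\<close> of a module record are not used by modules. Adding \<open>S\<close> in the scalar
  multiplication is needed only for the scalar \<open>0\<close>, where the elementwise multiple of a coset is
  \<open>{0}\<close> and not \<open>S\<close>.
\<close>

definition quot_space :: "('a, 'c) module \<Rightarrow> 'c set \<Rightarrow> ('a, 'c set) module"
  where "quot_space V S =
    \<lparr>carrier = a_rcosets\<^bsub>V\<^esub> S,
     monoid.mult = (\<lambda>X Y. S),
     one = S,
     zero = S,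
     add = (\<lambda>X Y. X <+>\<^bsub>V\<^esub> Y),
     smult = (\<lambda>c X. S <+>\<^bsub>V\<^esub> ((\<lambda>v. c \<odot>\<^bsub>V\<^esub> v) ` X))\<rparr>"

lemma quot_space_vectorspace:
  assumes "vectorspace K V" "VectorSpace.subspace K S V"
  shows "vectorspace K (quot_space V S)"
proof -
  interpret vectorspace K V by fact
  interpret sub: submodule K S V using assms(2) by (simp add: VectorSpace.subspace_def)
  have "subgroup S (add_monoid V)"
  proof (rule module.M.add.subgroupI)
    show "S \<subseteq> carrier V" by (rule sub.subset)
    show "S \<noteq> {}" using sub.zero_closed by blast
    fix a assume a: "a \<in> S"
    have "\<ominus>\<^bsub>K\<^esub> \<one>\<^bsub>K\<^esub> \<odot>\<^bsub>V\<^esub> a \<in> S" by (rule sub.smult_closed) (use a in auto)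
    thus "\<ominus>\<^bsub>V\<^esub> a \<in> S" using a sub.subset by (metis (no_types, lifting) module.R.one_closed module.smult_l_minus module.smult_one subsetD)
    show "\<And>b. b \<in> S \<Longrightarrow> a \<oplus>\<^bsub>V\<^esub> b \<in> S" using a by auto
  qed
  then interpret A: additive_subgroup S V by (simp add: additive_subgroup_def)
  interpret A: abelian_subgroup S V by (rule abelian_subgroupI3) (unfold_locales)
  have FG: "comm_group (V A_Mod S)" by (rule A.a_factorgroup_is_comm_group)
  have sm: "c \<odot>\<^bsub>quot_space V S\<^esub> (S +>\<^bsub>V\<^esub> v) = S +>\<^bsub>V\<^esub> (c \<odot>\<^bsub>V\<^esub> v)" if c: "c \<in> carrier K" and v: "v \<in> carrier V" for c v
  proof -
    have 1: "s \<oplus>\<^bsub>V\<^esub> c \<odot>\<^bsub>V\<^esub> (s' \<oplus>\<^bsub>V\<^esub> v) = (s \<oplus>\<^bsub>V\<^esub> c \<odot>\<^bsub>V\<^esub> s') \<oplus>\<^bsub>V\<^esub> c \<odot>\<^bsub>V\<^esub> v" if "s \<in> S" "s' \<in> S" for s s'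
      using that c v sub.subset by (auto simp: module.smult_r_distr module.M.a_assoc subset_iff)
    have 2: "x \<in> c \<odot>\<^bsub>quot_space V S\<^esub> (S +>\<^bsub>V\<^esub> v) \<longleftrightarrow> (\<exists>s\<in>S. \<exists>s'\<in>S. x = s \<oplus>\<^bsub>V\<^esub> c \<odot>\<^bsub>V\<^esub> (s' \<oplus>\<^bsub>V\<^esub> v))" for x
      by (auto simp: quot_space_def a_r_coset_def r_coset_def set_add_def set_mult_def)
    have 3: "x \<in> S +>\<^bsub>V\<^esub> (c \<odot>\<^bsub>V\<^esub> v) \<longleftrightarrow> (\<exists>s\<in>S. x = s \<oplus>\<^bsub>V\<^esub> c \<odot>\<^bsub>V\<^esub> v)" for x
      by (auto simp: a_r_coset_def r_coset_def)
    show ?thesis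
    proof (rule Set.set_eqI, unfold 2 3, rule iffI)
      fix x assume "\<exists>s\<in>S. \<exists>s'\<in>S. x = s \<oplus>\<^bsub>V\<^esub> c \<odot>\<^bsub>V\<^esub> (s' \<oplus>\<^bsub>V\<^esub> v)"
      then obtain s s' where s: "s \<in> S" "s' \<in> S" "x = (s \<oplus>\<^bsub>V\<^esub> c \<odot>\<^bsub>V\<^esub> s') \<oplus>\<^bsub>V\<^esub> c \<odot>\<^bsub>V\<^esub> v" using 1 by auto
      moreover have "s \<oplus>\<^bsub>V\<^esub> c \<odot>\<^bsub>V\<^esub> s' \<in> S" using s c by simp
      ultimately show "\<exists>s\<in>S. x = s \<oplus>\<^bsub>V\<^esub> c \<odot>\<^bsub>V\<^esub> v" by blast
    next
      fix x assume "\<exists>s\<in>S. x = s \<oplus>\<^bsub>V\<^esub> c \<odot>\<^bsub>V\<^esub> v"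
      then obtain s where s: "s \<in> S" "x = s \<oplus>\<^bsub>V\<^esub> c \<odot>\<^bsub>V\<^esub> (\<zero>\<^bsub>V\<^esub> \<oplus>\<^bsub>V\<^esub> v)" using v by auto
      thus "\<exists>s\<in>S. \<exists>s'\<in>S. x = s \<oplus>\<^bsub>V\<^esub> c \<odot>\<^bsub>V\<^esub> (s' \<oplus>\<^bsub>V\<^esub> v)" using sub.zero_closed by blast
    qed
  qed
  have rep: "\<exists>v\<in>carrier V. X = S +>\<^bsub>V\<^esub> v" if "X \<in> carrier (quot_space V S)" for X
    using that by (auto simp: quot_space_def a_r_coset_def A_RCOSETS_def RCOSETS_def)
  have mem: "S +>\<^bsub>V\<^esub> v \<in> carrier (quot_space V S)" if "v \<in> carrier V" for v
    using that by (auto simp: quot_space_def a_r_coset_def A_RCOSETS_def RCOSETS_def)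
  have ad: "(S +>\<^bsub>V\<^esub> v) \<oplus>\<^bsub>quot_space V S\<^esub> (S +>\<^bsub>V\<^esub> w) = S +>\<^bsub>V\<^esub> (v \<oplus>\<^bsub>V\<^esub> w)" if "v \<in> carrier V" "w \<in> carrier V" for v w
    using that by (simp add: quot_space_def A.a_rcos_sum)
  have ze: "\<zero>\<^bsub>quot_space V S\<^esub> = S +>\<^bsub>V\<^esub> \<zero>\<^bsub>V\<^esub>"
    using sub.subset by (simp add: quot_space_def module.M.a_coset_add_zero)
  have ab: "abelian_group (quot_space V S)"
  proof (rule abelian_groupI)
    fix x assume "x \<in> carrier (quot_space V S)"
    then obtain v where v: "v \<in> carrier V" "x = S +>\<^bsub>V\<^esub> v" using rep by blast
    have "(S +>\<^bsub>V\<^esub> \<ominus>\<^bsub>V\<^esub> v) \<oplus>\<^bsub>quot_space V S\<^esub> x = \<zero>\<^bsub>quot_space V S\<^esub>" using v by (simp add: ad ze module.M.l_neg)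
    thus "\<exists>y\<in>carrier (quot_space V S). y \<oplus>\<^bsub>quot_space V S\<^esub> x = \<zero>\<^bsub>quot_space V S\<^esub>" using mem v by blast
  qed (auto dest!: rep simp: ad ze mem module.M.a_ac)
  have "Module.module K (quot_space V S)"
    by (rule moduleI[OF module.R.is_cring ab])
      (auto dest!: rep simp: sm mem ad module.smult_l_distr module.smult_r_distr module.smult_assoc1)
  thus ?thesis by (rule vectorspace.intro) (rule field_axioms)
qed

text \<open>The image \<open>(W + S) / S\<close> of \<open>W\<close> in the quotient by \<open>S\<close>.\<close>

definition quot_image :: "('a, 'c) module \<Rightarrow> 'c set \<Rightarrow> 'c set \<Rightarrow> 'c set set"
  where "quot_image V S W = (\<lambda>v. S +>\<^bsub>V\<^esub> v) ` (W <+>\<^bsub>V\<^esub> S)"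

definition bilinear_form :: "'a ring \<Rightarrow> ('a, 'c) module \<Rightarrow> ('c \<Rightarrow> 'c \<Rightarrow> 'a) \<Rightarrow> bool"
  where "bilinear_form K V f \<longleftrightarrow>
    (\<forall>x\<in>carrier V. \<forall>y\<in>carrier V. f x y \<in> carrier K) \<and>
    (\<forall>x\<in>carrier V. \<forall>y\<in>carrier V. \<forall>z\<in>carrier V.
       f (x \<oplus>\<^bsub>V\<^esub> y) z = f x z \<oplus>\<^bsub>K\<^esub> f y z \<and>
       f z (x \<oplus>\<^bsub>V\<^esub> y) = f z x \<oplus>\<^bsub>K\<^esub> f z y) \<and>
    (\<forall>c\<in>carrier K. \<forall>x\<in>carrier V. \<forall>y\<in>carrier V.
       f (c \<odot>\<^bsub>V\<^esub> x) y = c \<otimes>\<^bsub>K\<^esub> f x y \<and>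
       f x (c \<odot>\<^bsub>V\<^esub> y) = c \<otimes>\<^bsub>K\<^esub> f x y)"

definition reflexive_form :: "'a ring \<Rightarrow> ('a, 'c) module \<Rightarrow> ('c \<Rightarrow> 'c \<Rightarrow> 'a) \<Rightarrow> bool"
  where "reflexive_form K V f \<longleftrightarrow>
    (\<forall>x\<in>carrier V. \<forall>y\<in>carrier V. f x y = \<zero>\<^bsub>K\<^esub> \<longrightarrow> f y x = \<zero>\<^bsub>K\<^esub>)"

definition nondegenerate_form :: "'a ring \<Rightarrow> ('a, 'c) module \<Rightarrow> ('c \<Rightarrow> 'c \<Rightarrow> 'a) \<Rightarrow> bool"
  where "nondegenerate_form K V f \<longleftrightarrow>
    (\<forall>x\<in>carrier V. (\<forall>y\<in>carrier V. f x y = \<zero>\<^bsub>K\<^esub>) \<longrightarrow> x = \<zero>\<^bsub>V\<^esub>)"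

definition orth_compl :: "'a ring \<Rightarrow> ('a, 'c) module \<Rightarrow> ('c \<Rightarrow> 'c \<Rightarrow> 'a) \<Rightarrow> 'c set \<Rightarrow> 'c set"
  where "orth_compl K V f S = {v \<in> carrier V. \<forall>s\<in>S. f v s = \<zero>\<^bsub>K\<^esub>}"

text \<open>
  \<open>S\<close> is the internal direct sum of \<open>N 0, \<dots>, N (t - 1)\<close>: every element of \<open>S\<close> is a sum
  \<open>x\<^sub>0 + \<dots> + x\<^sub>t\<^sub>-\<^sub>1\<close> with \<open>x\<^sub>i \<in> N i\<close> in exactly one way, and all such sums lie in \<open>S\<close>.
\<close>

definition internal_direct_sum ::
  "('a, 'c) module \<Rightarrow> nat \<Rightarrow> (nat \<Rightarrow> 'c set) \<Rightarrow> 'c set \<Rightarrow> bool"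
  where "internal_direct_sum V t N S \<longleftrightarrow>
    bij_betw (\<lambda>x. \<Oplus>\<^bsub>V\<^esub>i\<in>{..<t}. x i) (\<Pi>\<^sub>E i\<in>{..<t}. N i) S"

definition hyperplane :: "'a ring \<Rightarrow> ('a, 'c) module \<Rightarrow> 'c set \<Rightarrow> bool"
  where "hyperplane K V H \<longleftrightarrow>
    VectorSpace.subspace K H V \<and> sub_dim K V H + 1 = vectorspace.dim K V"

text \<open>
  \<open>U = U\<^sub>0 \<oplus> \<dots> \<oplus> U\<^sub>t\<^sub>-\<^sub>1\<close> is a decomposition witnessing that the \<open>F\<close>-subspace \<open>U\<close> of the \<open>K\<close>-space
  \<open>V\<close> is decomposable of type \<open>(a, b)\<close>. The tuples \<open>a\<close>, \<open>b\<close> are given by their values on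
  \<open>{..<t}\<close>. As the library dimension is meaningful only for finite-dimensional spaces, finite
  dimensionality of \<open>V\<close> is stated separately.
\<close>

definition decomposition ::
  "'a ring \<Rightarrow> 'a set \<Rightarrow> ('a, 'c) module \<Rightarrow> nat \<Rightarrow> (nat \<Rightarrow> nat) \<Rightarrow> (nat \<Rightarrow> nat) \<Rightarrow>
   'c set \<Rightarrow> (nat \<Rightarrow> 'c set) \<Rightarrow> bool"
  where "decomposition K F V t a b U Us \<longleftrightarrow>
    vectorspace K V \<and> vectorspace.fin_dim K V \<and>
    vectorspace.dim K V = (\<Sum>i<t. a i) \<and>
    VectorSpace.subspace (sub_scalars K F) U V \<and>
    sub_dim (sub_scalars K F) V U = (\<Sum>i<t. b i) \<and>
    internal_direct_sum V t Us U \<and>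
    internal_direct_sum V t (\<lambda>i. lin_span K V (Us i)) (carrier V) \<and>
    (\<forall>i<t. VectorSpace.subspace (sub_scalars K F) (Us i) V \<and>
           sub_dim (sub_scalars K F) V (Us i) = b i \<and>
           sub_dim K V (lin_span K V (Us i)) = a i)"

definition decomposable ::
  "'a ring \<Rightarrow> 'a set \<Rightarrow> ('a, 'c) module \<Rightarrow> nat \<Rightarrow> (nat \<Rightarrow> nat) \<Rightarrow> (nat \<Rightarrow> nat) \<Rightarrow> 'c set \<Rightarrow> bool"
  where "decomposable K F V t a b U \<longleftrightarrow> (\<exists>Us. decomposition K F V t a b U Us)"

text \<open>\<open>U\<close> is \<open>a\<close>-scattered with respect to the hyperplanes of \<open>V\<close>, of type \<open>b\<close>.\<close>

definition scattered ::
  "'a ring \<Rightarrow> 'a set \<Rightarrow> ('a, 'c) module \<Rightarrow> nat \<Rightarrow> (nat \<Rightarrow> nat) \<Rightarrow> (nat \<Rightarrow> nat) \<Rightarrow> 'c set \<Rightarrow> bool"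
  where "scattered K F V t a b U \<longleftrightarrow>
    (\<exists>Us. decomposition K F V t a b U Us \<and>
       (\<forall>i<t. b i > a i \<and>
          (\<forall>H. hyperplane K (V\<lparr>carrier := lin_span K V (Us i)\<rparr>) H \<longrightarrow>
               sub_dim (sub_scalars K F) V (Us i \<inter> H) + 1 \<le> a i)) \<and>
       (\<forall>H. hyperplane K V H \<and> (\<forall>i<t. \<not> lin_span K V (Us i) \<subseteq> H) \<longrightarrow>
            sub_dim (sub_scalars K F) V (U \<inter> H) + 1 \<le> (\<Sum>i<t. a i)))"

end

theory Submission
  imports Defs
begin

text \<open>
  All spaces are finite, so dimensions are compared through cardinalities. Write \<open>q = |F|\<close>. The
  decomposition of \<open>U\<close> lifts to \<open>W = W\<^sub>0 \<oplus> \<dots> \<oplus> W\<^sub>t\<^sub>-\<^sub>1\<close>; the spans of the \<open>W\<^sub>i\<close> decompose \<open>V\<close> and, by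
  counting, also \<open>\<Gamma>\<close>. A hyperplane containing \<open>\<Gamma>\<close> is \<open>{x. \<sigma> u x = 0}\<close> with \<open>u \<in> \<Gamma>\<^sup>\<bottom>\<close>, and one
  containing \<open>\<Gamma>\<^sup>\<bottom>\<close> is \<open>{x. \<sigma> x v = 0}\<close> with \<open>v \<in> \<Gamma>\<close>. Scatteredness of \<open>U\<close> and of its dual are lower
  bounds for the ranks \<open>log\<^sub>q |\<sigma> u W|\<close> and \<open>log\<^sub>q |\<sigma> W v|\<close>: if \<open>I\<close> is the set of components on which
  \<open>u\<close> (resp. \<open>v\<close>) is nonzero, the rank exceeds \<open>\<Sum>i\<in>I. n\<^sub>i - k\<^sub>i\<close> (resp. \<open>\<Sum>i\<in>I. k\<^sub>i\<close>).

  The bound for \<open>u\<close> with full support is the hypothesis. It extends to all \<open>u\<close> by adding vectors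
  of low rank supported on one missing component, scaled such that the images in \<open>K\<close> overlap. The
  bound for \<open>v\<close> is proved by induction on its support: a vector \<open>v\<close> of small rank yields, by a
  dimension count, a nonzero \<open>u \<in> \<Gamma>\<^sup>\<bottom>\<close> of small rank in the span of \<open>{x \<in> W. \<sigma> x v = 0}\<close>. If \<open>u\<close> has
  smaller support \<open>I'\<close> than \<open>v\<close>, then the ranks of \<open>u\<close> and of the \<open>I'\<close>-part of \<open>v\<close> add up to at most
  \<open>\<Sum>i\<in>I'. n\<^sub>i\<close>, contradicting the bounds for both.
\<close>

section \<open>Counting in finite vector spaces\<close>

text \<open>Condition (3) speaks only of hyperplanes that contain no component, so it bounds the
  rank of \<open>u\<close> only for full support, while the dimension count for \<open>v\<close>
  yields a \<open>u\<close> whose support cannot be prescribed. This forces bounds that depend on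
  the support. The overlap of the images makes their extension lossless: adding \<open>w\<close> of
  rank at most n_j - k_j + 1 whose image shares a nonzero element with that of \<open>u\<close>
  raises the rank by at most n_j - k_j, exactly the change of the bound. The
  \<open>W\<^sub>i\<close> need not be orthogonal to each other, so the dual is not decomposed by
  their images. Its components come from the dual decomposition of \<open>W\<close>, whose ith part
  \<open>dW {i}\<close> consists of the vectors orthogonal to all \<open>W\<^sub>j\<close> with j
  different from i. Accordingly the support of \<open>u\<close> is that of the functional \<sigma>
  u, whereas the support of \<open>v\<close> refers to its own components.\<close>

lemma card_eq_card_image_mult_fibre:
  assumes "finite A" and "\<And>a. a \<in> A \<Longrightarrow> card {x \<in> A. h x = h a} = c"
  shows "card A = card (h ` A) * c"
proof -
  have "card A = (\<Sum>x\<in>A. 1)" by simp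
  also have "\<dots> = (\<Sum>y\<in>h ` A. \<Sum>x\<in>{x \<in> A. h x = y}. 1)"
    by (rule sum.image_gen) fact
  also have "\<dots> = (\<Sum>y\<in>h ` A. c)"
    using assms(2) by (intro sum.cong) auto
  finally show ?thesis by simp
qed

section \<open>Cardinalities of images and sums of finite additive subgroups\<close>

context abelian_group
begin

lemma minus_add_cancel: "\<lbrakk>x \<in> carrier G; a \<in> carrier G\<rbrakk> \<Longrightarrow> x \<ominus> a \<oplus> a = x"
  by (simp add: minus_eq a_assoc l_neg)

lemma add_minus_cancel: "\<lbrakk>x \<in> carrier G; a \<in> carrier G\<rbrakk> \<Longrightarrow> x \<oplus> a \<ominus> a = x"
  by (simp add: minus_eq a_assoc r_neg)

lemma additive_subgroup_minus:
  assumes "additive_subgroup A G" "x \<in> A" "y \<in> A"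
  shows "x \<ominus> y \<in> A"
  using assms additive_subgroup.a_closed additive_subgroup.a_inv_closed[OF assms(1)]
  by (metis minus_eq)

lemma card_hom_image:
  assumes H: "abelian_group H" and A: "additive_subgroup A G" and fin: "finite A"
    and cl: "\<And>x. x \<in> A \<Longrightarrow> h x \<in> carrier H"
    and add: "\<And>x y. \<lbrakk>x \<in> A; y \<in> A\<rbrakk> \<Longrightarrow> h (x \<oplus> y) = h x \<oplus>\<^bsub>H\<^esub> h y"
  shows "card A = card (h ` A) * card {x \<in> A. h x = \<zero>\<^bsub>H\<^esub>}"
proof (rule card_eq_card_image_mult_fibre[OF fin])
  interpret H: abelian_group H by fact
  note sub = additive_subgroup.a_subset[OF A]
  fix a assume a: "a \<in> A"
  have ac: "a \<in> carrier G" using a sub by auto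
  have "bij_betw (\<lambda>x. x \<oplus> a) {x \<in> A. h x = \<zero>\<^bsub>H\<^esub>} {x \<in> A. h x = h a}"
  proof (rule bij_betw_byWitness[where f' = "\<lambda>x. x \<ominus> a"])
    show "\<forall>x\<in>{x \<in> A. h x = \<zero>\<^bsub>H\<^esub>}. x \<oplus> a \<ominus> a = x"
      using sub ac by (auto simp: add_minus_cancel)
    show "\<forall>x\<in>{x \<in> A. h x = h a}. x \<ominus> a \<oplus> a = x"
      using sub ac by (auto simp: minus_add_cancel)
    show "(\<lambda>x. x \<oplus> a) ` {x \<in> A. h x = \<zero>\<^bsub>H\<^esub>} \<subseteq> {x \<in> A. h x = h a}"
      using a cl add additive_subgroup.a_closed[OF A] by auto
    show "(\<lambda>x. x \<ominus> a) ` {x \<in> A. h x = h a} \<subseteq> {x \<in> A. h x = \<zero>\<^bsub>H\<^esub>}"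
    proof safe
      fix x assume x: "x \<in> A" "h x = h a"
      show m: "x \<ominus> a \<in> A" by (rule additive_subgroup_minus[OF A x(1) a])
      have "h (x \<ominus> a) \<oplus>\<^bsub>H\<^esub> h a = h a"
        using add[OF m a] x sub ac minus_add_cancel[of x a] by auto
      thus "h (x \<ominus> a) = \<zero>\<^bsub>H\<^esub>" using cl[OF m] cl[OF a] by (simp add: H.add.l_cancel_one')
    qed
  qed
  thus "card {x \<in> A. h x = h a} = card {x \<in> A. h x = \<zero>\<^bsub>H\<^esub>}"
    by (simp add: bij_betw_same_card)
qed

lemma set_add_mem: "z \<in> set_add G S T \<longleftrightarrow> (\<exists>s\<in>S. \<exists>t\<in>T. z = s \<oplus> t)"
  by (auto simp: set_add_def set_mult_def)

text \<open>Pairs are counted by their sum: those with the same sum as (s, t) are the (s + d, t - d)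
  with d in S \<inter> T, so every fibre of addition has the size of the intersection.\<close>

lemma card_set_add:
  assumes S: "additive_subgroup S G" and T: "additive_subgroup T G" and "finite S" "finite T"
  shows "card (set_add G S T) * card (S \<inter> T) = card S * card T"
proof -
  note sub = additive_subgroup.a_subset[OF S] additive_subgroup.a_subset[OF T]
  let ?h = "\<lambda>(s, t). s \<oplus> t"
  have "card (S \<times> T) = card (?h ` (S \<times> T)) * card (S \<inter> T)"
  proof (rule card_eq_card_image_mult_fibre)
    fix a assume "a \<in> S \<times> T"
    then obtain s t where a: "a = (s, t)" "s \<in> S" "t \<in> T" by auto
    have c: "s \<in> carrier G" "t \<in> carrier G" using a sub by auto
    have "bij_betw (\<lambda>d. (s \<oplus> d, t \<ominus> d)) (S \<inter> T) {x \<in> S \<times> T. ?h x = ?h a}"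
    proof (rule bij_betw_byWitness[where f' = "\<lambda>(x, y). x \<ominus> s"])
      show "\<forall>d\<in>S \<inter> T. (case (s \<oplus> d, t \<ominus> d) of (x, y) \<Rightarrow> x \<ominus> s) = d"
        using sub c by (auto simp: add_minus_cancel a_comm subset_iff)
      show "(\<lambda>d. (s \<oplus> d, t \<ominus> d)) ` (S \<inter> T) \<subseteq> {x \<in> S \<times> T. ?h x = ?h a}"
      proof safe
        fix d assume d: "d \<in> S" "d \<in> T"
        show "s \<oplus> d \<in> S" using d a additive_subgroup.a_closed[OF S] by auto
        show "t \<ominus> d \<in> T" by (rule additive_subgroup_minus[OF T a(3) d(2)])
        show "s \<oplus> d \<oplus> (t \<ominus> d) = (case a of (s, t) \<Rightarrow> s \<oplus> t)"
        proof -
          have dc: "d \<in> carrier G" using d sub by auto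
          hence "s \<oplus> d \<oplus> (t \<ominus> d) = s \<oplus> (t \<ominus> d \<oplus> d)" using c by (simp add: a_ac)
          thus ?thesis using minus_add_cancel[of t d] dc c a(1) by simp
        qed
      qed
      { fix x y assume xy: "x \<in> S" "y \<in> T" "x \<oplus> y = s \<oplus> t"
        have xyc: "x \<in> carrier G" "y \<in> carrier G" using xy sub by auto
        have e: "x \<ominus> s = t \<ominus> y"
        proof -
          have "x = x \<oplus> y \<ominus> y" using xyc by (simp add: add_minus_cancel)
          also have "\<dots> = s \<oplus> (t \<ominus> y)" using xy(3) xyc c by (simp add: minus_eq a_assoc)
          finally have "x \<ominus> s = (t \<ominus> y) \<oplus> s \<ominus> s" using c xyc by (metis a_comm minus_closed)
          thus ?thesis using c xyc by (simp add: add_minus_cancel)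
        qed
        have "x \<ominus> s \<in> S" "x \<ominus> s \<in> T"
          using additive_subgroup_minus[OF S xy(1) a(2)] additive_subgroup_minus[OF T a(3) xy(2)] e by auto
        moreover have "s \<oplus> (x \<ominus> s) = x" using c xyc minus_add_cancel[of x s] by (simp add: a_comm)
        moreover have "t \<ominus> (x \<ominus> s) = y"
          using c xyc unfolding e by (simp add: minus_eq minus_add a_assoc[symmetric] r_neg minus_minus)
        ultimately have "x \<ominus> s \<in> S \<inter> T" "s \<oplus> (x \<ominus> s) = x" "t \<ominus> (x \<ominus> s) = y" by auto }
      note * = this
      show "\<forall>x\<in>{x \<in> S \<times> T. ?h x = ?h a}. (s \<oplus> (case x of (x, y) \<Rightarrow> x \<ominus> s), t \<ominus> (case x of (x, y) \<Rightarrow> x \<ominus> s)) = x"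
        using * a by auto
      show "(\<lambda>(x, y). x \<ominus> s) ` {x \<in> S \<times> T. ?h x = ?h a} \<subseteq> S \<inter> T"
        using *(1) a by auto
    qed
    thus "card {x \<in> S \<times> T. ?h x = ?h a} = card (S \<inter> T)" by (simp add: bij_betw_same_card)
  qed (use assms in auto)
  moreover have "?h ` (S \<times> T) = set_add G S T" by (force simp: set_add_mem)
  ultimately show ?thesis by (simp add: card_cartesian_product)
qed

end

section \<open>Subspaces over a subfield of scalars\<close>

locale finite_space = vectorspace K V for K :: "'a ring" and V :: "('a, 'c) module" +
  assumes finite_K: "finite (carrier K)" and finite_V: "finite (carrier V)"
begin

text \<open>Taking the scalars as an arbitrary set \<open>C\<close> lets one theory serve the
  F-subspaces and the K-subspaces of the same record \<open>V\<close>. For a subfield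
  \<open>C\<close> this is the library notion over \<open>sub_scalars K C\<close>, see
  \<open>subspace_iff_subsp\<close>.\<close>

definition subsp :: "'a set \<Rightarrow> 'c set \<Rightarrow> bool" where
  "subsp C S \<longleftrightarrow> S \<subseteq> carrier V \<and> \<zero>\<^bsub>V\<^esub> \<in> S \<and> (\<forall>x\<in>S. \<forall>y\<in>S. x \<oplus>\<^bsub>V\<^esub> y \<in> S) \<and>
    (\<forall>c\<in>C. \<forall>x\<in>S. c \<odot>\<^bsub>V\<^esub> x \<in> S)"

lemma subspD:
  assumes "subsp C S"
  shows "S \<subseteq> carrier V" "\<zero>\<^bsub>V\<^esub> \<in> S" "\<And>x y. \<lbrakk>x \<in> S; y \<in> S\<rbrakk> \<Longrightarrow> x \<oplus>\<^bsub>V\<^esub> y \<in> S"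
    "\<And>c x. \<lbrakk>c \<in> C; x \<in> S\<rbrakk> \<Longrightarrow> c \<odot>\<^bsub>V\<^esub> x \<in> S" "finite S"
  using assms finite_subset[OF _ finite_V] by (auto simp: subsp_def)

lemma subsp_mem: "\<lbrakk>subsp C S; x \<in> S\<rbrakk> \<Longrightarrow> x \<in> carrier V"
  by (auto simp: subsp_def)

lemma subspI:
  assumes "S \<subseteq> carrier V" "\<zero>\<^bsub>V\<^esub> \<in> S" "\<And>x y. \<lbrakk>x \<in> S; y \<in> S\<rbrakk> \<Longrightarrow> x \<oplus>\<^bsub>V\<^esub> y \<in> S"
    "\<And>c x. \<lbrakk>c \<in> C; x \<in> S\<rbrakk> \<Longrightarrow> c \<odot>\<^bsub>V\<^esub> x \<in> S"
  shows "subsp C S"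
  using assms by (auto simp: subsp_def)

lemma subsp_antimono: "\<lbrakk>subsp C S; D \<subseteq> C\<rbrakk> \<Longrightarrow> subsp D S"
  by (auto simp: subsp_def)

lemma subfieldD:
  assumes "subfield C K"
  shows "C \<subseteq> carrier K" "\<zero>\<^bsub>K\<^esub> \<in> C" "\<one>\<^bsub>K\<^esub> \<in> C" "\<ominus>\<^bsub>K\<^esub> \<one>\<^bsub>K\<^esub> \<in> C" "finite C" "card C \<ge> 2"
    "\<And>x y. \<lbrakk>x \<in> C; y \<in> C\<rbrakk> \<Longrightarrow> x \<oplus>\<^bsub>K\<^esub> y \<in> C"
    "\<And>x y. \<lbrakk>x \<in> C; y \<in> C\<rbrakk> \<Longrightarrow> x \<otimes>\<^bsub>K\<^esub> y \<in> C"
    "\<And>x. x \<in> C \<Longrightarrow> \<ominus>\<^bsub>K\<^esub> x \<in> C"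
    "\<And>x. \<lbrakk>x \<in> C; x \<noteq> \<zero>\<^bsub>K\<^esub>\<rbrakk> \<Longrightarrow> inv\<^bsub>K\<^esub> x \<in> C"
proof -
  interpret C: subfield C K by fact
  have sr: "subring C K" by (rule subfieldE(1)[OF assms])
  show sub: "C \<subseteq> carrier K" by (rule subringE(1)[OF sr])
  show z: "\<zero>\<^bsub>K\<^esub> \<in> C" and o: "\<one>\<^bsub>K\<^esub> \<in> C" using subringE(2,3)[OF sr] by auto
  show "finite C" using sub finite_K finite_subset by blast
  have "{\<zero>\<^bsub>K\<^esub>, \<one>\<^bsub>K\<^esub>} \<subseteq> C" using z o by auto
  from card_mono[OF \<open>finite C\<close> this] show "card C \<ge> 2" by simp
  show m: "\<ominus>\<^bsub>K\<^esub> x \<in> C" if "x \<in> C" for x using that subringE(5)[OF sr] by auto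
  show "\<ominus>\<^bsub>K\<^esub> \<one>\<^bsub>K\<^esub> \<in> C" using m o by auto
  show "x \<oplus>\<^bsub>K\<^esub> y \<in> C" "x \<otimes>\<^bsub>K\<^esub> y \<in> C" if "x \<in> C" "y \<in> C" for x y
    using that subringE(6,7)[OF sr] by auto
  show "inv\<^bsub>K\<^esub> x \<in> C" if "x \<in> C" "x \<noteq> \<zero>\<^bsub>K\<^esub>" for x
    using subfield_m_inv(1)[OF assms, of x] that by auto
qed

lemma subfield_carrier: "subfield (carrier K) K"
  by (rule carrier_is_subfield)

lemma vectorspace_sub_scalars:
  assumes "subfield C K"
  shows "vectorspace (sub_scalars K C) V"
proof -
  note C = subfieldD[OF assms]
  have f: "field (sub_scalars K C)" using subfield_iff(2)[OF assms] .
  hence cr: "cring (sub_scalars K C)" by (simp add: field_def domain_def)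
  have "Module.module (sub_scalars K C) V"
    by (rule moduleI[OF cr M.abelian_group_axioms])
      (use C in \<open>auto simp: smult_l_distr smult_r_distr smult_assoc1 subset_iff\<close>)
  thus ?thesis using f by (rule vectorspace.intro)
qed

lemma subspace_iff_subsp:
  assumes "subfield C K"
  shows "VectorSpace.subspace (sub_scalars K C) S V \<longleftrightarrow> subsp C S"
  using vectorspace_sub_scalars[OF assms] 
  by (auto simp: VectorSpace.subspace_def LinearCombinations.submodule_def subsp_def vectorspace_def)

lemma subspace_iff_subsp_carrier: "VectorSpace.subspace K S V \<longleftrightarrow> subsp (carrier K) S"
  using subspace_iff_subsp[OF subfield_carrier] by simp

lemma subsp_carrier: "subsp (carrier K) (carrier V)"
  by (rule subspI) auto

lemma subsp_zero: "subfield C K \<Longrightarrow> subsp C {\<zero>\<^bsub>V\<^esub>}"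
  using subfieldD(1)[of C] by (intro subspI) auto

lemma zero_subset_subsp: "subsp C S \<Longrightarrow> {\<zero>\<^bsub>V\<^esub>} \<subseteq> S"
  by (simp add: subspD)

lemma subsp_Int: "\<lbrakk>subsp C S; subsp C T\<rbrakk> \<Longrightarrow> subsp C (S \<inter> T)"
  by (auto simp: subsp_def)

lemma subsp_minus:
  assumes "subfield C K" "subsp C S" "x \<in> S" shows "\<ominus>\<^bsub>V\<^esub> x \<in> S"
  using subspD(4)[OF assms(2) subfieldD(4)[OF assms(1)] assms(3)] subsp_mem[OF assms(2,3)]
  by (simp add: smult_l_minus)

lemma subsp_additive_subgroup:
  assumes "subfield C K" "subsp C S"
  shows "additive_subgroup S V"
proof -
  have "subgroup S (add_monoid V)"
    using subspD[OF assms(2)] subsp_minus[OF assms]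
    by (intro M.add.subgroupI) (auto simp: a_inv_def)
  thus ?thesis by (simp add: additive_subgroup_def)
qed

lemma subsp_set_add:
  assumes "subsp C S" "subsp C T" "C \<subseteq> carrier K"
  shows "subsp C (S <+>\<^bsub>V\<^esub> T)"
proof (rule subspI)
  note S = subspD[OF assms(1)] and T = subspD[OF assms(2)]
  show "S <+>\<^bsub>V\<^esub> T \<subseteq> carrier V" using S(1) T(1) by (auto simp: M.set_add_mem subset_iff)
  show "\<zero>\<^bsub>V\<^esub> \<in> S <+>\<^bsub>V\<^esub> T" using S(2) T(2) M.r_zero[of "\<zero>\<^bsub>V\<^esub>"] unfolding M.set_add_mem by force
  fix x y assume "x \<in> S <+>\<^bsub>V\<^esub> T" "y \<in> S <+>\<^bsub>V\<^esub> T"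
  then obtain s t s' t' where *: "s \<in> S" "t \<in> T" "s' \<in> S" "t' \<in> T" "x = s \<oplus>\<^bsub>V\<^esub> t" "y = s' \<oplus>\<^bsub>V\<^esub> t'"
    unfolding M.set_add_mem by auto
  hence "x \<oplus>\<^bsub>V\<^esub> y = (s \<oplus>\<^bsub>V\<^esub> s') \<oplus>\<^bsub>V\<^esub> (t \<oplus>\<^bsub>V\<^esub> t')"
    using S(1) T(1) by (simp add: M.a_ac subset_iff)
  thus "x \<oplus>\<^bsub>V\<^esub> y \<in> S <+>\<^bsub>V\<^esub> T" using * S(3) T(3) unfolding M.set_add_mem by blast
next
  note S = subspD[OF assms(1)] and T = subspD[OF assms(2)]
  fix c x assume c: "c \<in> C" and "x \<in> S <+>\<^bsub>V\<^esub> T"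
  then obtain s t where *: "s \<in> S" "t \<in> T" "x = s \<oplus>\<^bsub>V\<^esub> t"
    unfolding M.set_add_mem by auto
  hence "c \<odot>\<^bsub>V\<^esub> x = c \<odot>\<^bsub>V\<^esub> s \<oplus>\<^bsub>V\<^esub> c \<odot>\<^bsub>V\<^esub> t"
    using S(1) T(1) c assms(3) by (auto simp: smult_r_distr subset_iff)
  thus "c \<odot>\<^bsub>V\<^esub> x \<in> S <+>\<^bsub>V\<^esub> T" using * S(4) T(4) c unfolding M.set_add_mem by blast
qed

lemma set_add_subset:
  assumes "subsp C U" "S \<subseteq> U" "T \<subseteq> U" shows "S <+>\<^bsub>V\<^esub> T \<subseteq> U"
  using assms by (auto simp: M.set_add_mem subsp_def subset_iff)

lemma subset_set_add1: "\<lbrakk>S \<subseteq> carrier V; subsp C T\<rbrakk> \<Longrightarrow> S \<subseteq> S <+>\<^bsub>V\<^esub> T"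
  unfolding subset_iff M.set_add_mem by (metis M.r_zero subspD(2))

lemma subset_set_add2: "\<lbrakk>subsp C S; T \<subseteq> carrier V\<rbrakk> \<Longrightarrow> T \<subseteq> S <+>\<^bsub>V\<^esub> T"
  unfolding subset_iff M.set_add_mem by (metis M.l_zero subspD(2))

lemma card_subsp_add:
  assumes "subfield C K" "subsp C S" "subsp C T"
  shows "card (S <+>\<^bsub>V\<^esub> T) * card (S \<inter> T) = card S * card T"
  using assms by (intro M.card_set_add subsp_additive_subgroup subspD(5))

lemma card_subsp_hom:
  assumes "subfield C K" "subsp C S" "abelian_group H"
    and "\<And>x. x \<in> S \<Longrightarrow> h x \<in> carrier H"
    and "\<And>x y. \<lbrakk>x \<in> S; y \<in> S\<rbrakk> \<Longrightarrow> h (x \<oplus>\<^bsub>V\<^esub> y) = h x \<oplus>\<^bsub>H\<^esub> h y"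
  shows "card S = card (h ` S) * card {x \<in> S. h x = \<zero>\<^bsub>H\<^esub>}"
  using assms by (intro M.card_hom_image subsp_additive_subgroup subspD(5))

lemma card_subsp_pos: "subsp C S \<Longrightarrow> card S > 0"
  using subspD(2,5) card_gt_0_iff by blast

lemma card_eq_1_subsp: "subsp C S \<Longrightarrow> card S \<le> 1 \<Longrightarrow> S = {\<zero>\<^bsub>V\<^esub>}"
  using subspD(2,5)[of C S] by (metis One_nat_def card_le_Suc0_iff_eq is_singletonI' is_singleton_the_elem singletonD empty_iff)

definition line :: "'a set \<Rightarrow> 'c \<Rightarrow> 'c set" where
  "line C x = (\<lambda>c. c \<odot>\<^bsub>V\<^esub> x) ` C"

lemma subsp_line:
  assumes "subfield C K" "x \<in> carrier V" shows "subsp C (line C x)"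
proof (rule subspI)
  note C = subfieldD[OF assms(1)]
  show "line C x \<subseteq> carrier V" using C(1) assms by (auto simp: line_def)
  have "\<zero>\<^bsub>K\<^esub> \<odot>\<^bsub>V\<^esub> x \<in> line C x" unfolding line_def using C(2) by blast
  thus "\<zero>\<^bsub>V\<^esub> \<in> line C x" using assms by simp
  fix c y assume c: "c \<in> C" and "y \<in> line C x"
  then obtain d where d: "d \<in> C" "y = d \<odot>\<^bsub>V\<^esub> x" by (auto simp: line_def)
  hence "c \<odot>\<^bsub>V\<^esub> y = (c \<otimes>\<^bsub>K\<^esub> d) \<odot>\<^bsub>V\<^esub> x" using C(1) c assms by (auto simp: smult_assoc1 subset_iff)
  thus "c \<odot>\<^bsub>V\<^esub> y \<in> line C x" using C(8) c d by (auto simp: line_def)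
next
  note C = subfieldD[OF assms(1)]
  fix y z assume "y \<in> line C x" "z \<in> line C x"
  then obtain c d where d: "c \<in> C" "y = c \<odot>\<^bsub>V\<^esub> x" "d \<in> C" "z = d \<odot>\<^bsub>V\<^esub> x" by (auto simp: line_def)
  hence "y \<oplus>\<^bsub>V\<^esub> z = (c \<oplus>\<^bsub>K\<^esub> d) \<odot>\<^bsub>V\<^esub> x" using C(1) assms by (auto simp: smult_l_distr subset_iff)
  thus "y \<oplus>\<^bsub>V\<^esub> z \<in> line C x" using C(7) d by (auto simp: line_def)
qed

lemma mem_line: "subfield C K \<Longrightarrow> x \<in> carrier V \<Longrightarrow> x \<in> line C x"
  unfolding line_def using subfieldD(3) smult_one by (metis image_eqI)

lemma smult_mem_cancel:
  assumes "subfield C K" "subsp C S" "x \<in> carrier V" "c \<in> C" "c \<noteq> \<zero>\<^bsub>K\<^esub>" "c \<odot>\<^bsub>V\<^esub> x \<in> S"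
  shows "x \<in> S"
proof -
  note C = subfieldD[OF assms(1)]
  have ic: "inv\<^bsub>K\<^esub> c \<in> C" "c \<in> carrier K" using assms C by auto
  have "inv\<^bsub>K\<^esub> c \<otimes>\<^bsub>K\<^esub> c = \<one>\<^bsub>K\<^esub>" using assms(5) ic(2) by (simp add: field_Units)
  hence "inv\<^bsub>K\<^esub> c \<odot>\<^bsub>V\<^esub> (c \<odot>\<^bsub>V\<^esub> x) = x"
    using assms(3) ic C(1) by (metis smult_assoc1 smult_one subsetD)
  thus ?thesis using subspD(4)[OF assms(2) ic(1) assms(6)] by simp
qed

lemma smult_inj:
  assumes "x \<in> carrier V" "x \<noteq> \<zero>\<^bsub>V\<^esub>" "c \<in> carrier K" "d \<in> carrier K" "c \<odot>\<^bsub>V\<^esub> x = d \<odot>\<^bsub>V\<^esub> x"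
  shows "c = d"
proof (rule ccontr)
  assume "c \<noteq> d"
  have "(c \<ominus>\<^bsub>K\<^esub> d) \<odot>\<^bsub>V\<^esub> x = c \<odot>\<^bsub>V\<^esub> x \<ominus>\<^bsub>V\<^esub> d \<odot>\<^bsub>V\<^esub> x"
    using assms by (simp add: R.minus_eq smult_l_distr smult_l_minus M.minus_eq)
  hence "(c \<ominus>\<^bsub>K\<^esub> d) \<odot>\<^bsub>V\<^esub> x \<in> {\<zero>\<^bsub>V\<^esub>}" using assms by (simp add: M.minus_eq M.r_neg)
  moreover have "c \<ominus>\<^bsub>K\<^esub> d \<noteq> \<zero>\<^bsub>K\<^esub>" using \<open>c \<noteq> d\<close> assms by (simp add: R.r_right_minus_eq)
  ultimately have "x \<in> {\<zero>\<^bsub>V\<^esub>}"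
    using assms smult_mem_cancel[OF subfield_carrier subsp_zero[OF subfield_carrier], of x "c \<ominus>\<^bsub>K\<^esub> d"] by simp
  thus False using assms by simp
qed

lemma card_line:
  assumes "subfield C K" "x \<in> carrier V" "x \<noteq> \<zero>\<^bsub>V\<^esub>" shows "card (line C x) = card C"
  unfolding line_def
  by (rule card_image, rule inj_onI) (use assms smult_inj subfieldD(1) in blast)

lemma card_add_line:
  assumes C: "subfield C K" and S: "subsp C S" and x: "x \<in> carrier V" "x \<notin> S"
  shows "card (S <+>\<^bsub>V\<^esub> line C x) = card S * card C"
proof -
  have "S \<inter> line C x \<subseteq> {\<zero>\<^bsub>V\<^esub>}"
  proof
    fix y assume y: "y \<in> S \<inter> line C x"
    then obtain c where c: "c \<in> C" "y = c \<odot>\<^bsub>V\<^esub> x" by (auto simp: line_def)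
    have "c = \<zero>\<^bsub>K\<^esub>" using smult_mem_cancel[OF C S x(1) c(1)] y c x by auto
    thus "y \<in> {\<zero>\<^bsub>V\<^esub>}" using c x by simp
  qed
  hence "S \<inter> line C x = {\<zero>\<^bsub>V\<^esub>}" using subspD(2)[OF S] subspD(2)[OF subsp_line[OF C x(1)]] by auto
  moreover have "x \<noteq> \<zero>\<^bsub>V\<^esub>" using x(2) subspD(2)[OF S] by auto
  ultimately show ?thesis
    using card_subsp_add[OF C S subsp_line[OF C x(1)]] card_line[OF C x(1)] by simp
qed

text \<open>This takes the place of induction over a basis. By finiteness there is a maximal
  intermediate subspace with property \<open>P\<close>; a vector of \<open>T\<close> outside it
  could still be adjoined, so it is \<open>T\<close> itself.\<close>

lemma subsp_chain_induct [consumes 4, case_names base step]: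
  assumes C: "subfield C K" and S: "subsp C S" and T: "subsp C T" and ST: "S \<subseteq> T"
    and base: "P S"
    and step: "\<And>X x. \<lbrakk>subsp C X; S \<subseteq> X; X \<subseteq> T; x \<in> T; x \<notin> X; P X\<rbrakk> \<Longrightarrow> P (X <+>\<^bsub>V\<^esub> line C x)"
  shows "P T"
proof -
  let ?Q = "\<lambda>X. subsp C X \<and> S \<subseteq> X \<and> X \<subseteq> T \<and> P X"
  have "finite {X. ?Q X}" by (rule finite_subset[of _ "Pow T"]) (use subspD(5)[OF T] in auto)
  moreover have "S \<in> {X. ?Q X}" using assms by auto
  ultimately obtain X where "X \<in> {X. ?Q X}" and m: "\<forall>Y\<in>{X. ?Q X}. X \<le> Y \<longrightarrow> X = Y"
    using finite_has_maximal[of "{X. ?Q X}"] by blast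
  hence X: "?Q X" and max: "\<And>Y. ?Q Y \<Longrightarrow> X \<subseteq> Y \<Longrightarrow> X = Y" by auto
  have "X = T"
  proof (rule ccontr)
    assume "X \<noteq> T"
    then obtain x where x: "x \<in> T" "x \<notin> X" using X by auto
    have xV: "x \<in> carrier V" using x T subsp_mem by auto
    have L: "subsp C (line C x)" by (rule subsp_line[OF C xV])
    have "X \<subseteq> X <+>\<^bsub>V\<^esub> line C x" by (rule subset_set_add1[OF _ L]) (use X subspD(1) in auto)
    moreover have "line C x \<subseteq> T" unfolding line_def using subspD(4)[OF T] x by auto
    hence "?Q (X <+>\<^bsub>V\<^esub> line C x)"
      using X x step[of X x] subsp_set_add[OF _ L subfieldD(1)[OF C], of X] calculation
        set_add_subset[OF T, of X "line C x"] by blast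
    ultimately have "X = X <+>\<^bsub>V\<^esub> line C x" using max by blast
    moreover have "x \<in> X <+>\<^bsub>V\<^esub> line C x"
      using subset_set_add2[of C X "line C x"] X mem_line[OF C xV] subspD(1)[OF L] by blast
    ultimately show False using x by simp
  qed
  thus ?thesis using X by simp
qed

lemma card_subsp_power:
  assumes "subfield C K" "subsp C S" shows "\<exists>d. card S = card C ^ d"
  using assms(1) subsp_zero[OF assms(1)] assms(2) zero_subset_subsp[OF assms(2)]
proof (induction rule: subsp_chain_induct)
  case base show ?case by (rule exI[of _ 0]) simp
next
  case (step X x)
  then obtain d where "card X = card C ^ d" by auto
  hence "card (X <+>\<^bsub>V\<^esub> line C x) = card C ^ Suc d"
    using card_add_line[OF assms(1) step(1) _ step(5)] step(4) subsp_mem[OF assms(2)] by simp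
  thus ?case by blast
qed

lemma card_subfield_power_inject:
  "subfield C K \<Longrightarrow> card C ^ a = card C ^ b \<longleftrightarrow> a = b"
  using subfieldD(6) by (metis power_inject_exp Suc_1 Suc_le_lessD)

lemma card_subfield_power_le:
  "subfield C K \<Longrightarrow> card C ^ a \<le> card C ^ b \<longleftrightarrow> a \<le> b"
  using subfieldD(6) by (metis power_increasing_iff Suc_1 Suc_le_lessD)

text \<open>The complement is built along a chain from \<open>S\<close> to \<open>T\<close>: each
  vector adjoined to the intermediate space is adjoined to \<open>R\<close> as well. Directness of
  the sum is recorded as a product of cardinalities, the form in which it is used.\<close>

lemma subsp_complement:
  assumes C: "subfield C K" and "subsp C S" "subsp C T" "S \<subseteq> T"
  shows "\<exists>R. subsp C R \<and> R \<subseteq> T \<and> S <+>\<^bsub>V\<^esub> R = T \<and> card S * card R = card T"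
  using assms
proof (induction rule: subsp_chain_induct)
  case base
  have "S <+>\<^bsub>V\<^esub> {\<zero>\<^bsub>V\<^esub>} = S"
    using subspD(1)[OF assms(2)] by (auto simp: M.set_add_mem subset_iff)
  thus ?case using subsp_zero[OF C] subspD(2)[OF assms(2)] by (intro exI[of _ "{\<zero>\<^bsub>V\<^esub>}"]) simp
next
  case (step X x)
  then obtain R where R: "subsp C R" "R \<subseteq> X" "S <+>\<^bsub>V\<^esub> R = X" "card S * card R = card X" by auto
  have xV: "x \<in> carrier V" using step assms subsp_mem by auto
  have L: "subsp C (line C x)" by (rule subsp_line[OF C xV])
  have e: "S <+>\<^bsub>V\<^esub> (R <+>\<^bsub>V\<^esub> line C x) = X <+>\<^bsub>V\<^esub> line C x"
    unfolding R(3)[symmetric] using subspD(1)[OF assms(2)] subspD(1)[OF R(1)] subspD(1)[OF L]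
    by (simp add: AbelCoset.set_add_def M.add.set_mult_assoc)
  have xR: "x \<notin> R" using R step by auto
  show ?case
  proof (intro exI conjI)
    show "subsp C (R <+>\<^bsub>V\<^esub> line C x)" by (rule subsp_set_add[OF R(1) L subfieldD(1)[OF C]])
    show "R <+>\<^bsub>V\<^esub> line C x \<subseteq> X <+>\<^bsub>V\<^esub> line C x" using R(2) unfolding subset_iff M.set_add_mem by blast
    show "card S * card (R <+>\<^bsub>V\<^esub> line C x) = card (X <+>\<^bsub>V\<^esub> line C x)"
      using card_add_line[OF C R(1) xV xR] card_add_line[OF C step(1) xV step(5)] R(4) by simp
  qed fact
qed

text \<open>Along a chain from the zero space to \<open>T\<close> the cardinality grows by the
  factor \<open>card C\<close> at each step, so no power of \<open>card C\<close> up to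
  \<open>card T\<close> is skipped.\<close>

lemma subsp_of_card:
  assumes C: "subfield C K" and T: "subsp C T" and a: "card C ^ a \<le> card T"
  shows "\<exists>S. subsp C S \<and> S \<subseteq> T \<and> card S = card C ^ a"
proof -
  have "card C ^ a \<le> card T \<longrightarrow> (\<exists>S. subsp C S \<and> S \<subseteq> T \<and> card S = card C ^ a)"
    using C subsp_zero[OF C] T zero_subset_subsp[OF T]
  proof (induction rule: subsp_chain_induct)
    case base
    have "card C ^ a = 1" if "card C ^ a \<le> 1" using that subfieldD(6)[OF C] by (simp add: le_Suc_eq)
    thus ?case using subsp_zero[OF C] by force
  next
    case (step X x)
    have xV: "x \<in> carrier V" using step T subsp_mem by auto
    have L: "subsp C (line C x)" by (rule subsp_line[OF C xV])
    have sub: "X \<subseteq> X <+>\<^bsub>V\<^esub> line C x" by (rule subset_set_add1[OF subspD(1)[OF step(1)] L])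
    show ?case
    proof (cases "card C ^ a \<le> card X")
      case True thus ?thesis using step(6) sub by blast
    next
      case False
      obtain d where d: "card X = card C ^ d" using card_subsp_power[OF C step(1)] by auto
      have s: "subsp C (X <+>\<^bsub>V\<^esub> line C x)" by (rule subsp_set_add[OF step(1) L subfieldD(1)[OF C]])
      have c: "card (X <+>\<^bsub>V\<^esub> line C x) = card C ^ Suc d"
        using card_add_line[OF C step(1) xV step(5)] d by simp
      show ?thesis
      proof
        assume "card C ^ a \<le> card (X <+>\<^bsub>V\<^esub> line C x)"
        hence "a = Suc d" using False d c card_subfield_power_le[OF C] by (metis le_SucE)
        thus "\<exists>S. subsp C S \<and> S \<subseteq> X <+>\<^bsub>V\<^esub> line C x \<and> card S = card C ^ a" using s c by blast
      qed
    qed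
  qed
  thus ?thesis using a by blast
qed

section \<open>Library dimensions as exponents of cardinalities\<close>

lemma finite_carrier_fin_dim: "fin_dim"
proof -
  have "span (carrier V) = carrier V"
    using in_own_span[of "carrier V"] span_is_subset2[of "carrier V"] by auto
  thus ?thesis unfolding fin_dim_def using finite_V by blast
qed

lemma card_carrier_eq_power_dim: "card (carrier V) = card (carrier K) ^ dim"
proof -
  obtain B where B: "finite B" "basis B" using finite_basis_exists[OF finite_carrier_fin_dim] by auto
  hence BV: "B \<subseteq> carrier V" by (simp add: basis_def)
  have uniq: "\<And>v. v \<in> carrier V \<Longrightarrow> \<exists>!a. a \<in> B \<rightarrow>\<^sub>E carrier K \<and> lincomb a B = v"
    using basis_criterion[OF B(1) BV] B(2) by auto
  have "bij_betw (\<lambda>a. lincomb a B) (B \<rightarrow>\<^sub>E carrier K) (carrier V)"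
  proof (rule bij_betw_imageI)
    have cl: "lincomb a B \<in> carrier V" if "a \<in> B \<rightarrow>\<^sub>E carrier K" for a
      using that BV B(1) by (intro lincomb_closed) auto
    show "inj_on (\<lambda>a. lincomb a B) (B \<rightarrow>\<^sub>E carrier K)"
      using uniq cl by (intro inj_onI) metis
    show "(\<lambda>a. lincomb a B) ` (B \<rightarrow>\<^sub>E carrier K) = carrier V"
      using uniq cl by (auto simp: image_iff) metis
  qed
  hence "card (carrier V) = card (B \<rightarrow>\<^sub>E carrier K)" by (simp add: bij_betw_same_card)
  also have "\<dots> = card (carrier K) ^ card B" using B(1) by (simp add: card_PiE)
  finally show ?thesis using dim_basis[OF B] by simp
qed

text \<open>With its scalars cut down to \<open>C\<close>, the subspace is a finite space of its
  own, so the count for a whole carrier applies. The \<open>sub_dim\<close>s of the definitions are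
  exchanged for cardinalities through this identity.\<close>

lemma card_eq_power_sub_dim:
  assumes C: "subfield C K" and S: "subsp C S"
  shows "card S = card C ^ sub_dim (sub_scalars K C) V S"
proof -
  interpret vc: vectorspace "sub_scalars K C" V by (rule vectorspace_sub_scalars[OF C])
  interpret s: vectorspace "sub_scalars K C" "V\<lparr>carrier := S\<rparr>"
    by (rule vc.subspace_is_vs) (use S subspace_iff_subsp[OF C] in simp)
  interpret s: finite_space "sub_scalars K C" "V\<lparr>carrier := S\<rparr>"
    by unfold_locales (use subfieldD(5)[OF C] subspD(5)[OF S] in auto)
  show ?thesis using s.card_carrier_eq_power_dim by simp
qed

lemma card_eq_power_sub_dim_carrier:
  assumes S: "subsp (carrier K) S"
  shows "card S = card (carrier K) ^ sub_dim K V S"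
  using card_eq_power_sub_dim[OF subfield_carrier S] by simp

lemma sub_dim_eqI:
  assumes "subfield C K" "subsp C S" "card S = card C ^ d"
  shows "sub_dim (sub_scalars K C) V S = d"
  using card_eq_power_sub_dim[OF assms(1,2)] assms card_subfield_power_inject by metis

lemma subsp_span: "X \<subseteq> carrier V \<Longrightarrow> subsp (carrier K) (span X)"
  using span_is_subspace[of X] subspace_iff_subsp_carrier by simp

lemma span_minimal: "X \<subseteq> S \<Longrightarrow> subsp (carrier K) S \<Longrightarrow> span X \<subseteq> S"
  using span_is_subset[of X S] subspace_iff_subsp_carrier[of S] by simp

lemma card_span_le:
  assumes F: "subfield F K" and B: "subsp F B" and b: "card B = card F ^ b"
  shows "card (span B) \<le> card (carrier K) ^ b"
proof -
  \<comment> \<open>The exponent has to vary with the subspace during the induction; uniqueness of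
    exponents identifies it with \<open>b\<close> at the end.\<close>
  have "\<exists>b. card B = card F ^ b \<and> card (span B) \<le> card (carrier K) ^ b"
    using F subsp_zero[OF F] B zero_subset_subsp[OF B]
  proof (induction rule: subsp_chain_induct)
    case base
    have "span {\<zero>\<^bsub>V\<^esub>} \<subseteq> {\<zero>\<^bsub>V\<^esub>}"
      by (rule span_minimal) (use subsp_zero[OF subfield_carrier] in auto)
    hence "card (span {\<zero>\<^bsub>V\<^esub>}) \<le> 1"
      by (metis card_mono finite.emptyI finite_insert is_singletonI is_singleton_altdef)
    thus ?case by (intro exI[of _ 0]) simp
  next
    case (step X x)
    then obtain b where b: "card X = card F ^ b" "card (span X) \<le> card (carrier K) ^ b" by auto
    have xV: "x \<in> carrier V" using step B subsp_mem by auto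
    have L: "subsp (carrier K) (line (carrier K) x)" by (rule subsp_line[OF subfield_carrier xV])
    have XV: "X \<subseteq> carrier V" using step subspD(1) by auto
    have s: "subsp (carrier K) (span X <+>\<^bsub>V\<^esub> line (carrier K) x)"
      by (rule subsp_set_add[OF subsp_span[OF XV] L]) simp
    have "span (X <+>\<^bsub>V\<^esub> line F x) \<subseteq> span X <+>\<^bsub>V\<^esub> line (carrier K) x"
    proof (rule span_minimal[OF _ s])
      show "X <+>\<^bsub>V\<^esub> line F x \<subseteq> span X <+>\<^bsub>V\<^esub> line (carrier K) x"
        using in_own_span[OF XV] subfieldD(1)[OF F] unfolding subset_iff M.set_add_mem line_def by blast
    qed
    hence "card (span (X <+>\<^bsub>V\<^esub> line F x)) \<le> card (span X <+>\<^bsub>V\<^esub> line (carrier K) x)"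
      using card_mono subspD(5)[OF s] by blast
    also have "\<dots> \<le> card (span X) * card (line (carrier K) x)"
      using card_subsp_add[OF subfield_carrier subsp_span[OF XV] L]
        card_subsp_pos[OF subsp_Int[OF subsp_span[OF XV] L]]
      by (metis Suc_leI One_nat_def mult.right_neutral mult_le_mono2)
    also have "\<dots> \<le> card (carrier K) ^ b * card (carrier K)"
      using b(2) finite_K by (intro mult_le_mono) (auto simp: line_def card_image_le)
    finally show ?case
      using card_add_line[OF F step(1) xV step(5)] b(1) by (intro exI[of _ "Suc b"]) (simp add: mult.commute)
  qed
  thus ?thesis using b card_subfield_power_inject[OF F] by auto
qed

text \<open>Both subspaces and the scalars are parameters, so that one duality theory covers
  \<sigma> on \<open>W\<close> over F, \<sigma> on \<open>V\<close> over K, and restrictions to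
  subspaces.\<close>

definition pairing :: "'a set \<Rightarrow> 'c set \<Rightarrow> 'c set \<Rightarrow> ('c \<Rightarrow> 'c \<Rightarrow> 'a) \<Rightarrow> bool" where
  "pairing C X Y f \<longleftrightarrow> subsp C X \<and> subsp C Y \<and>
    (\<forall>x\<in>X. \<forall>y\<in>Y. f x y \<in> C) \<and>
    (\<forall>x\<in>X. \<forall>x'\<in>X. \<forall>y\<in>Y. f (x \<oplus>\<^bsub>V\<^esub> x') y = f x y \<oplus>\<^bsub>K\<^esub> f x' y) \<and>
    (\<forall>x\<in>X. \<forall>y\<in>Y. \<forall>y'\<in>Y. f x (y \<oplus>\<^bsub>V\<^esub> y') = f x y \<oplus>\<^bsub>K\<^esub> f x y') \<and>
    (\<forall>c\<in>C. \<forall>x\<in>X. \<forall>y\<in>Y. f (c \<odot>\<^bsub>V\<^esub> x) y = c \<otimes>\<^bsub>K\<^esub> f x y \<and> f x (c \<odot>\<^bsub>V\<^esub> y) = c \<otimes>\<^bsub>K\<^esub> f x y)"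

lemma pairingD:
  assumes "pairing C X Y f"
  shows "subsp C X" "subsp C Y" "\<And>x y. \<lbrakk>x \<in> X; y \<in> Y\<rbrakk> \<Longrightarrow> f x y \<in> C"
    "\<And>x x' y. \<lbrakk>x \<in> X; x' \<in> X; y \<in> Y\<rbrakk> \<Longrightarrow> f (x \<oplus>\<^bsub>V\<^esub> x') y = f x y \<oplus>\<^bsub>K\<^esub> f x' y"
    "\<And>x y y'. \<lbrakk>x \<in> X; y \<in> Y; y' \<in> Y\<rbrakk> \<Longrightarrow> f x (y \<oplus>\<^bsub>V\<^esub> y') = f x y \<oplus>\<^bsub>K\<^esub> f x y'"
    "\<And>c x y. \<lbrakk>c \<in> C; x \<in> X; y \<in> Y\<rbrakk> \<Longrightarrow> f (c \<odot>\<^bsub>V\<^esub> x) y = c \<otimes>\<^bsub>K\<^esub> f x y"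
    "\<And>c x y. \<lbrakk>c \<in> C; x \<in> X; y \<in> Y\<rbrakk> \<Longrightarrow> f x (c \<odot>\<^bsub>V\<^esub> y) = c \<otimes>\<^bsub>K\<^esub> f x y"
  using assms unfolding pairing_def by blast+

definition perp :: "('c \<Rightarrow> 'c \<Rightarrow> 'a) \<Rightarrow> 'c set \<Rightarrow> 'c set \<Rightarrow> 'c set" where
  "perp f X T = {x \<in> X. \<forall>y\<in>T. f x y = \<zero>\<^bsub>K\<^esub>}"

text \<open>Left and right are kept apart: \<open>perp\<close> is a left annihilator, and right
  annihilators with their properties are obtained by exchanging the arguments.\<close>

abbreviation (input) flip :: "('c \<Rightarrow> 'c \<Rightarrow> 'a) \<Rightarrow> 'c \<Rightarrow> 'c \<Rightarrow> 'a" where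
  "flip f \<equiv> \<lambda>y x. f x y"

lemma pairing_flip: "pairing C X Y f \<Longrightarrow> pairing C Y X (flip f)"
  unfolding pairing_def by (intro conjI ballI; blast)

lemma pairing_restrict:
  "\<lbrakk>pairing C X Y f; subsp C X'; X' \<subseteq> X; subsp C Y'; Y' \<subseteq> Y\<rbrakk> \<Longrightarrow> pairing C X' Y' f"
  unfolding pairing_def by (intro conjI ballI; blast)

lemma pairing_zero:
  assumes "subfield C K" "pairing C X Y f" "y \<in> Y" shows "f \<zero>\<^bsub>V\<^esub> y = \<zero>\<^bsub>K\<^esub>"
proof -
  have z: "\<zero>\<^bsub>V\<^esub> \<in> X" "\<zero>\<^bsub>V\<^esub> \<in> carrier V" using assms(2) by (auto simp: pairing_def subsp_def)
  have "f (\<zero>\<^bsub>K\<^esub> \<odot>\<^bsub>V\<^esub> \<zero>\<^bsub>V\<^esub>) y = \<zero>\<^bsub>K\<^esub> \<otimes>\<^bsub>K\<^esub> f \<zero>\<^bsub>V\<^esub> y"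
    using assms(2,3) z subfieldD(2)[OF assms(1)] unfolding pairing_def by blast
  moreover have "f \<zero>\<^bsub>V\<^esub> y \<in> carrier K"
    using assms(2,3) z subfieldD(1)[OF assms(1)] unfolding pairing_def by blast
  ultimately show ?thesis using z by simp
qed

lemma subsp_perp:
  assumes C: "subfield C K" and f: "pairing C X Y f" and T: "T \<subseteq> Y"
  shows "subsp C (perp f X T)"
proof (rule subspI)
  have X: "subsp C X" using f by (simp add: pairing_def)
  show "perp f X T \<subseteq> carrier V" using subspD(1)[OF X] by (auto simp: perp_def)
  show "\<zero>\<^bsub>V\<^esub> \<in> perp f X T" using subspD(2)[OF X] pairing_zero[OF C f] T by (auto simp: perp_def)
  show "x \<oplus>\<^bsub>V\<^esub> y \<in> perp f X T" if "x \<in> perp f X T" "y \<in> perp f X T" for x y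
    using that T subspD(3)[OF X] by (auto simp: perp_def pairingD(4)[OF f] subset_iff)
  show "c \<odot>\<^bsub>V\<^esub> x \<in> perp f X T" if "c \<in> C" "x \<in> perp f X T" for c x
    using that T subspD(4)[OF X] subfieldD(1)[OF C] by (auto simp: perp_def pairingD(6)[OF f] subset_iff)
qed

lemma card_pairing_eval:
  assumes C: "subfield C K" and f: "pairing C X Y f" and S: "subsp C S" "S \<subseteq> X" and y: "y \<in> Y"
  shows "card S = card ((\<lambda>x. f x y) ` S) * card {x \<in> S. f x y = \<zero>\<^bsub>K\<^esub>}"
proof (rule card_subsp_hom[OF C S(1)])
  show "abelian_group K" by (rule R.abelian_group_axioms)
  show "\<And>x. x \<in> S \<Longrightarrow> f x y \<in> carrier K"
    using pairingD(3)[OF f] S(2) y subfieldD(1)[OF C] by blast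
  show "\<And>x x'. \<lbrakk>x \<in> S; x' \<in> S\<rbrakk> \<Longrightarrow> f (x \<oplus>\<^bsub>V\<^esub> x') y = f x y \<oplus>\<^bsub>K\<^esub> f x' y"
    using pairingD(4)[OF f] S(2) y by blast
qed

text \<open>Adjoining one vector \<open>z\<close> to the annihilated space cuts the annihilator down
  to the kernel of evaluation at \<open>z\<close>. As the evaluation has at most
  \<open>card C\<close> values, the annihilator shrinks at most by that factor.\<close>

lemma card_perp_ge:
  assumes C: "subfield C K" and f: "pairing C X Y f" and T: "subsp C T" "T \<subseteq> Y"
  shows "card X \<le> card (perp f X T) * card T"
  using C subsp_zero[OF C] T(1) zero_subset_subsp[OF T(1)]
proof (induction rule: subsp_chain_induct)
  case base
  have "f x \<zero>\<^bsub>V\<^esub> = \<zero>\<^bsub>K\<^esub>" if "x \<in> X" for x using pairing_zero[OF C pairing_flip[OF f]] that by auto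
  hence "perp f X {\<zero>\<^bsub>V\<^esub>} = X" by (auto simp: perp_def)
  thus ?case by simp
next
  case (step Z z)
  have ZY: "Z \<subseteq> Y" "z \<in> Y" using step T by auto
  have zV: "z \<in> carrier V" using step T subsp_mem by auto
  let ?P = "perp f X Z"
  have P: "subsp C ?P" by (rule subsp_perp[OF C f ZY(1)])
  have PX: "?P \<subseteq> X" by (auto simp: perp_def)
  have sub: "{x \<in> ?P. f x z = \<zero>\<^bsub>K\<^esub>} \<subseteq> perp f X (Z <+>\<^bsub>V\<^esub> line C z)"
  proof
    fix x assume x: "x \<in> {x \<in> ?P. f x z = \<zero>\<^bsub>K\<^esub>}"
    hence xX: "x \<in> X" by (auto simp: perp_def)
    have "f x y = \<zero>\<^bsub>K\<^esub>" if y: "y \<in> Z <+>\<^bsub>V\<^esub> line C z" for y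
    proof -
      from y obtain a c where a: "a \<in> Z" "c \<in> C" "y = a \<oplus>\<^bsub>V\<^esub> c \<odot>\<^bsub>V\<^esub> z"
        by (auto simp: M.set_add_mem line_def)
      have "c \<odot>\<^bsub>V\<^esub> z \<in> Y" using ZY a subspD(4)[OF pairingD(2)[OF f]] by blast
      hence "f x y = f x a \<oplus>\<^bsub>K\<^esub> c \<otimes>\<^bsub>K\<^esub> f x z"
        using a xX ZY by (simp add: pairingD[OF f] subset_iff)
      thus ?thesis using x a subfieldD(1)[OF C] by (auto simp: perp_def)
    qed
    thus "x \<in> perp f X (Z <+>\<^bsub>V\<^esub> line C z)" using xX by (auto simp: perp_def)
  qed
  have fin: "finite (perp f X (Z <+>\<^bsub>V\<^esub> line C z))"
    by (rule finite_subset[of _ X]) (use subspD(5)[OF pairingD(1)[OF f]] in \<open>auto simp: perp_def\<close>)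
  have "card ?P = card ((\<lambda>x. f x z) ` ?P) * card {x \<in> ?P. f x z = \<zero>\<^bsub>K\<^esub>}"
    by (rule card_pairing_eval[OF C f P PX ZY(2)])
  also have "\<dots> \<le> card C * card (perp f X (Z <+>\<^bsub>V\<^esub> line C z))"
  proof (rule mult_le_mono)
    show "card ((\<lambda>x. f x z) ` ?P) \<le> card C"
      by (rule card_mono[OF subfieldD(5)[OF C]]) (use pairingD(3)[OF f] PX ZY in auto)
  qed (rule card_mono[OF fin sub])
  finally have "card ?P * card Z \<le> card C * card (perp f X (Z <+>\<^bsub>V\<^esub> line C z)) * card Z"
    by (rule mult_le_mono1)
  hence "card ?P * card Z \<le> card (perp f X (Z <+>\<^bsub>V\<^esub> line C z)) * (card Z * card C)"
    by (simp only: mult_ac)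
  thus ?case unfolding card_add_line[OF C step(1) zV step(5)] using step(6) by (rule order_trans[rotated])
qed

text \<open>The upper bound comes from a complement \<open>R\<close> of \<open>T\<close>: a vector
  annihilating both annihilates \<open>Y\<close>, hence is zero. So \<open>card_perp_ge\<close>,
  applied to the pairing of \<open>perp f X T\<close> with \<open>R\<close>, bounds the former by
  \<open>card R\<close>.\<close>

lemma card_perp_nondegenerate:
  assumes C: "subfield C K" and f: "pairing C X Y f" and eq: "card X = card Y"
    and nd: "perp f X Y = {\<zero>\<^bsub>V\<^esub>}" and T: "subsp C T" "T \<subseteq> Y"
  shows "card (perp f X T) * card T = card X"
proof (rule antisym[OF _ card_perp_ge[OF C f T]])
  have Y: "subsp C Y" using f by (simp add: pairing_def)
  obtain R where R: "subsp C R" "R \<subseteq> Y" "T <+>\<^bsub>V\<^esub> R = Y" "card T * card R = card Y"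
    using subsp_complement[OF C T(1) Y T(2)] by auto
  have P: "subsp C (perp f X T)" by (rule subsp_perp[OF C f T(2)])
  have "perp f (perp f X T) R \<subseteq> perp f X Y"
  proof
    fix x assume x: "x \<in> perp f (perp f X T) R"
    have "f x y = \<zero>\<^bsub>K\<^esub>" if "y \<in> Y" for y
    proof -
      obtain a b where "a \<in> T" "b \<in> R" "y = a \<oplus>\<^bsub>V\<^esub> b" using \<open>y \<in> Y\<close> R(3) by (auto simp: M.set_add_mem)
      thus ?thesis using x T(2) R(2) by (simp add: perp_def pairingD[OF f] subset_iff)
    qed
    thus "x \<in> perp f X Y" using x by (auto simp: perp_def)
  qed
  hence "card (perp f (perp f X T) R) \<le> 1"
    unfolding nd by (metis card_mono finite.emptyI finite_insert is_singletonI is_singleton_altdef)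
  moreover have "card (perp f X T) \<le> card (perp f (perp f X T) R) * card R"
    by (rule card_perp_ge[OF C pairing_restrict[OF f P _ R(1,2)] R(1)]) (auto simp: perp_def)
  ultimately have "card (perp f X T) \<le> card R" by (metis mult_1 mult_le_mono1 le_trans)
  thus "card (perp f X T) * card T \<le> card X" using R(4) eq by (metis mult.commute mult_le_mono2)
qed

text \<open>The right radical \<open>?T\<close> is annihilated by all of \<open>X\<close>, so the
  dimension formula for its annihilator leaves it only one element.\<close>

lemma nondegenerate_flip:
  assumes C: "subfield C K" and f: "pairing C X Y f" and eq: "card X = card Y"
    and nd: "perp f X Y = {\<zero>\<^bsub>V\<^esub>}"
  shows "perp (flip f) Y X = {\<zero>\<^bsub>V\<^esub>}"
proof -
  let ?T = "perp (flip f) Y X"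
  have X: "subsp C X" using f by (simp add: pairing_def)
  have T: "subsp C ?T" by (rule subsp_perp[OF C pairing_flip[OF f]]) simp
  have "perp f X ?T = X" by (auto simp: perp_def)
  moreover have "card (perp f X ?T) * card ?T = card X"
    by (rule card_perp_nondegenerate[OF C f eq nd T]) (auto simp: perp_def)
  ultimately have "card ?T = 1" using card_subsp_pos[OF X] by simp
  thus ?thesis using card_eq_1_subsp[OF T] by simp
qed

lemma perp_perp:
  assumes C: "subfield C K" and f: "pairing C X Y f" and eq: "card X = card Y"
    and nd: "perp f X Y = {\<zero>\<^bsub>V\<^esub>}" and T: "subsp C T" "T \<subseteq> Y"
  shows "perp (flip f) Y (perp f X T) = T"
proof -
  have P: "subsp C (perp f X T)" by (rule subsp_perp[OF C f T(2)])
  have PP: "subsp C (perp (flip f) Y (perp f X T))"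
    by (rule subsp_perp[OF C pairing_flip[OF f]]) (auto simp: perp_def)
  have "card (perp (flip f) Y (perp f X T)) * card (perp f X T) = card Y"
    by (rule card_perp_nondegenerate[OF C pairing_flip[OF f] eq[symmetric] nondegenerate_flip[OF C f eq nd] P])
      (auto simp: perp_def)
  hence "card (perp (flip f) Y (perp f X T)) = card T"
    using card_perp_nondegenerate[OF C f eq nd T] eq card_subsp_pos[OF P]
    by (metis mult.commute mult_cancel1 less_numeral_extra(3))
  moreover have "T \<subseteq> perp (flip f) Y (perp f X T)" using T by (auto simp: perp_def)
  ultimately show ?thesis using card_subset_eq[OF subspD(5)[OF PP]] by metis
qed

end

section \<open>Ranks with respect to a nondegenerate pairing\<close>

text \<open>With zero intersection the sum would be direct and too large for \<open>E\<close>. The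
  dimension counts below obtain their nonzero vectors from this.\<close>

lemma (in finite_space) exists_common_nonzero:
  assumes C: "subfield C K" and X: "subsp C X" and Y: "subsp C Y" and E: "subsp C E"
    and sub: "X \<subseteq> E" "Y \<subseteq> E" and lt: "card E < card X * card Y"
  shows "\<exists>u. u \<in> X \<and> u \<in> Y \<and> u \<noteq> \<zero>\<^bsub>V\<^esub>"
proof (rule ccontr)
  assume "\<not> ?thesis"
  hence "X \<inter> Y = {\<zero>\<^bsub>V\<^esub>}" using subspD(2)[OF X] subspD(2)[OF Y] by blast
  hence "card (X <+>\<^bsub>V\<^esub> Y) = card X * card Y" using card_subsp_add[OF C X Y] by simp
  moreover have "card (X <+>\<^bsub>V\<^esub> Y) \<le> card E"
    by (rule card_mono[OF subspD(5)[OF E] set_add_subset[OF E sub]])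
  ultimately show False using lt by simp
qed

lemma (in finite_space) card_subsp_add_le:
  assumes C: "subfield C K" and X: "subsp C X" and Y: "subsp C Y"
  shows "card (X <+>\<^bsub>V\<^esub> Y) \<le> card X * card Y"
proof -
  have "card (X <+>\<^bsub>V\<^esub> Y) * 1 \<le> card (X <+>\<^bsub>V\<^esub> Y) * card (X \<inter> Y)"
    using card_subsp_pos[OF subsp_Int[OF X Y]] by (intro mult_le_mono2) simp
  thus ?thesis using card_subsp_add[OF C X Y] by simp
qed

lemma (in finite_space) subsp_image:
  assumes S: "subsp C S" and cl: "\<And>x. x \<in> S \<Longrightarrow> h x \<in> carrier V"
    and add: "\<And>x y. \<lbrakk>x \<in> S; y \<in> S\<rbrakk> \<Longrightarrow> h (x \<oplus>\<^bsub>V\<^esub> y) = h x \<oplus>\<^bsub>V\<^esub> h y"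
    and smult: "\<And>c x. \<lbrakk>c \<in> C; x \<in> S\<rbrakk> \<Longrightarrow> h (c \<odot>\<^bsub>V\<^esub> x) = c \<odot>\<^bsub>V\<^esub> h x"
  shows "subsp C (h ` S)"
proof (rule subspI)
  note S' = subspD[OF S]
  show "h ` S \<subseteq> carrier V" using cl by auto
  have "h \<zero>\<^bsub>V\<^esub> \<oplus>\<^bsub>V\<^esub> h \<zero>\<^bsub>V\<^esub> = h \<zero>\<^bsub>V\<^esub>" using add[OF S'(2) S'(2)] by simp
  hence "h \<zero>\<^bsub>V\<^esub> = \<zero>\<^bsub>V\<^esub>" using cl[OF S'(2)] by (simp add: M.add.l_cancel_one')
  thus "\<zero>\<^bsub>V\<^esub> \<in> h ` S" using S'(2) by (metis image_eqI)
  show "x \<oplus>\<^bsub>V\<^esub> y \<in> h ` S" if "x \<in> h ` S" "y \<in> h ` S" for x y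
    using that S'(3) add by (metis (no_types, lifting) image_iff)
  show "c \<odot>\<^bsub>V\<^esub> x \<in> h ` S" if "c \<in> C" "x \<in> h ` S" for c x
    using that S'(4) smult by (metis (no_types, lifting) image_iff)
qed

text \<open>\<open>W\<close> is an F-form of \<open>V\<close> on which \<sigma> takes values in F.
  The assumptions are stable under exchanging the arguments of \<sigma>
  (\<open>rank_setup_flip\<close>), so every fact on left ranks has a mirror image for right
  ranks.\<close>

locale rank_setup = finite_space K V
  for K :: "'a ring" and V :: "('a, 'c) module" +
  fixes F :: "'a set" and W :: "'c set" and \<sigma> :: "'c \<Rightarrow> 'c \<Rightarrow> 'a" and n :: nat
  assumes F: "subfield F K" and W: "subsp F W" and card_W: "card W = card F ^ n"
    and card_V: "card (carrier V) = card (carrier K) ^ n"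
    and span_W: "span W = carrier V"
    and pairing_V: "pairing (carrier K) (carrier V) (carrier V) \<sigma>"
    and pairing_W: "pairing F W W \<sigma>"
    and nondegenerate_W: "perp \<sigma> W W = {\<zero>\<^bsub>V\<^esub>}"
begin

abbreviation (input) q where "q \<equiv> card F"
abbreviation (input) Q where "Q \<equiv> card (carrier K)"
text \<open>This is q to the power of the rank weight of \<open>u\<close>: in the basis of
  \<open>V\<close> dual to an F-basis of \<open>W\<close>, the coordinates of \<open>u\<close>
  generate its image over F. With cardinalities instead of exponents, sums of ranks become
  products.\<close>

abbreviation (input) lrank where "lrank u \<equiv> card (\<sigma> u ` W)"
abbreviation (input) rrank where "rrank v \<equiv> card ((\<lambda>x. \<sigma> x v) ` W)"

lemmas form_closed [simp] = pairingD(3)[OF pairing_V]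
lemmas form_add_l [simp] = pairingD(4)[OF pairing_V]
lemmas form_add_r [simp] = pairingD(5)[OF pairing_V]
lemmas form_smult_l [simp] = pairingD(6)[OF pairing_V]
lemmas form_smult_r [simp] = pairingD(7)[OF pairing_V]
lemmas form_zero_l [simp] = pairing_zero[OF subfield_carrier pairing_V]
lemmas form_zero_r [simp] = pairing_zero[OF subfield_carrier pairing_flip[OF pairing_V]]

lemmas W_mem [simp] = subsp_mem[OF W]

lemma q_gt_1: "1 < q" using subfieldD(6)[OF F] by simp
lemma Q_gt_1: "1 < Q" using subfieldD(6)[OF subfield_carrier] by simp

lemma rank_setup_flip: "rank_setup K V F W (flip \<sigma>) n"
  by (rule rank_setup.intro[OF finite_space_axioms], rule rank_setup_axioms.intro
      [OF F W card_W card_V span_W pairing_flip[OF pairing_V] pairing_flip[OF pairing_W]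
        nondegenerate_flip[OF F pairing_W refl nondegenerate_W]])

lemma subsp_perp_V: "T \<subseteq> carrier V \<Longrightarrow> subsp (carrier K) (perp \<sigma> (carrier V) T)"
  by (rule subsp_perp[OF subfield_carrier pairing_V])

lemma subsp_rperp_V: "T \<subseteq> carrier V \<Longrightarrow> subsp (carrier K) (perp (flip \<sigma>) (carrier V) T)"
  by (rule subsp_perp[OF subfield_carrier pairing_flip[OF pairing_V]])

lemma subsp_perp_W: "T \<subseteq> W \<Longrightarrow> subsp F (perp \<sigma> W T)"
  by (rule subsp_perp[OF F pairing_W])

lemma subsp_rperp_W: "T \<subseteq> W \<Longrightarrow> subsp F (perp (flip \<sigma>) W T)"
  by (rule subsp_perp[OF F pairing_flip[OF pairing_W]])

lemma nondegenerate_V: "perp \<sigma> (carrier V) (carrier V) = {\<zero>\<^bsub>V\<^esub>}"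
proof -
  \<comment> \<open>The other occurrence of \<open>W\<close> is named \<open>Y\<close> so that the
    induction, which replaces \<open>W\<close> by growing subspaces, acts on \<open>span W\<close>
    only.\<close>
  have "\<forall>x\<in>span W. (\<forall>y\<in>Y. \<sigma> x y = \<zero>\<^bsub>K\<^esub>) \<longrightarrow> x = \<zero>\<^bsub>V\<^esub>" if Y: "Y = W" for Y
    using F subsp_zero[OF F] W zero_subset_subsp[OF W]
  proof (induction rule: subsp_chain_induct)
    case base
    have "span {\<zero>\<^bsub>V\<^esub>} \<subseteq> {\<zero>\<^bsub>V\<^esub>}"
      by (rule span_minimal) (use subsp_zero[OF subfield_carrier] in auto)
    thus ?case by auto
  next
    case (step S b)
    have bV: "b \<in> carrier V" using step by simp
    have SV: "S \<subseteq> carrier V" using step subspD(1) by auto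
    have L: "subsp (carrier K) (line (carrier K) b)" by (rule subsp_line[OF subfield_carrier bV])
    show ?case
    proof (intro ballI impI)
      fix x assume x: "x \<in> span (S <+>\<^bsub>V\<^esub> line F b)" and x0: "\<forall>y\<in>Y. \<sigma> x y = \<zero>\<^bsub>K\<^esub>"
      have "span (S <+>\<^bsub>V\<^esub> line F b) \<subseteq> span S <+>\<^bsub>V\<^esub> line (carrier K) b"
      proof (rule span_minimal)
        show "S <+>\<^bsub>V\<^esub> line F b \<subseteq> span S <+>\<^bsub>V\<^esub> line (carrier K) b"
          using in_own_span[OF SV] subfieldD(1)[OF F] unfolding subset_iff M.set_add_mem line_def by blast
        show "subsp (carrier K) (span S <+>\<^bsub>V\<^esub> line (carrier K) b)"
          by (rule subsp_set_add[OF subsp_span[OF SV] L]) simp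
      qed
      then obtain s c where s: "s \<in> span S" "c \<in> carrier K" "x = s \<oplus>\<^bsub>V\<^esub> c \<odot>\<^bsub>V\<^esub> b"
        using x unfolding line_def subset_iff M.set_add_mem by blast
      have sV: "s \<in> carrier V" using s subsp_span[OF SV] subsp_mem by blast
      let ?Y = "perp (flip \<sigma>) W S"
      \<comment> \<open>By duality over F some \<open>y\<close> in \<open>W\<close> is killed by
        \<open>S\<close> but not by \<open>b\<close>. It is then killed by \<open>span S\<close> as
        well, so evaluating \<sigma> x at \<open>y\<close> isolates the coefficient
        \<open>c\<close>.\<close>
      have "perp \<sigma> W ?Y = S"
        by (rule perp_perp[OF F pairing_flip[OF pairing_W] refl
              nondegenerate_flip[OF F pairing_W refl nondegenerate_W] step(1,3)])
      then obtain y where y: "y \<in> ?Y" "\<sigma> b y \<noteq> \<zero>\<^bsub>K\<^esub>" using step(4,5) by (auto simp: perp_def)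
      hence yW: "y \<in> W" by (auto simp: perp_def)
      have "span S \<subseteq> perp \<sigma> (carrier V) {y}"
        by (rule span_minimal[OF _ subsp_perp_V]) (use y yW SV in \<open>auto simp: perp_def\<close>)
      hence "\<sigma> s y = \<zero>\<^bsub>K\<^esub>" using s by (auto simp: perp_def)
      hence "c \<otimes>\<^bsub>K\<^esub> \<sigma> b y = \<zero>\<^bsub>K\<^esub>" using x0 yW s sV bV Y by force
      hence "c = \<zero>\<^bsub>K\<^esub>" using y s bV yW by (simp add: integral_iff)
      hence "x = s" using s sV bV by simp
      hence "x \<in> span S" using s(1) by simp
      from bspec[OF step(6) this] x0 show "x = \<zero>\<^bsub>V\<^esub>" by (rule mp)
    qed
  qed
  hence "perp \<sigma> (carrier V) (carrier V) \<subseteq> {\<zero>\<^bsub>V\<^esub>}" unfolding span_W perp_def using W_mem by blast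
  moreover have "\<zero>\<^bsub>V\<^esub> \<in> perp \<sigma> (carrier V) (carrier V)" by (simp add: perp_def)
  ultimately show ?thesis by blast
qed

lemma form_nondegenerate:
  assumes "u \<in> carrier V" "\<And>y. y \<in> carrier V \<Longrightarrow> \<sigma> u y = \<zero>\<^bsub>K\<^esub>"
  shows "u = \<zero>\<^bsub>V\<^esub>"
proof -
  have "u \<in> perp \<sigma> (carrier V) (carrier V)" using assms by (simp add: perp_def)
  thus ?thesis unfolding nondegenerate_V by simp
qed

lemma card_perp_V:
  "subsp (carrier K) T \<Longrightarrow> card (perp \<sigma> (carrier V) T) * card T = Q ^ n"
  using card_perp_nondegenerate[OF subfield_carrier pairing_V refl nondegenerate_V, of T] card_V
  by (simp add: subspD(1))

lemma card_perp_W: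
  "subsp F T \<Longrightarrow> T \<subseteq> W \<Longrightarrow> card (perp \<sigma> W T) * card T = q ^ n"
  using card_perp_nondegenerate[OF F pairing_W refl nondegenerate_W, of T] card_W by simp

text \<open>The spans of \<open>B\<close> and of a complement \<open>R\<close> together fill
  \<open>V\<close>, while their dimensions over K are at most b and r with b + r = n; so neither
  bound is strict. In other words, vectors of \<open>W\<close> independent over F stay independent
  over K.\<close>

lemma card_span:
  assumes B: "subsp F B" "B \<subseteq> W" "card B = q ^ b"
  shows "card (span B) = Q ^ b"
proof (rule antisym[OF card_span_le[OF F B(1,3)]])
  obtain R where R: "subsp F R" "R \<subseteq> W" "B <+>\<^bsub>V\<^esub> R = W" "card B * card R = card W"
    using subsp_complement[OF F B(1) W B(2)] by auto
  obtain r where r: "card R = q ^ r" using card_subsp_power[OF F R(1)] by auto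
  have br: "b + r = n" using R(4) r B(3) card_W card_subfield_power_inject[OF F] by (metis power_add)
  have s: "subsp (carrier K) (span B)" "subsp (carrier K) (span R)"
    by (rule subsp_span[OF subspD(1)], fact)+
  have "span W \<subseteq> span B <+>\<^bsub>V\<^esub> span R"
  proof (rule span_minimal)
    show "W \<subseteq> span B <+>\<^bsub>V\<^esub> span R"
      using in_own_span[OF subspD(1)[OF B(1)]] in_own_span[OF subspD(1)[OF R(1)]]
      unfolding R(3)[symmetric] subset_iff M.set_add_mem by blast
  qed (rule subsp_set_add[OF s], simp)
  hence "Q ^ n \<le> card (span B <+>\<^bsub>V\<^esub> span R)"
    using card_mono[OF subspD(5)[OF subsp_set_add[OF s subset_refl]]] card_V span_W by metis
  also have "\<dots> \<le> card (span B) * card (span R)" by (rule card_subsp_add_le[OF subfield_carrier s])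
  also have "\<dots> \<le> card (span B) * Q ^ r" using card_span_le[OF F R(1) r] by simp
  finally have "Q ^ b * Q ^ r \<le> card (span B) * Q ^ r" by (simp only: br[symmetric] power_add)
  moreover have "0 < Q ^ r" using Q_gt_1 by simp
  ultimately show "Q ^ b \<le> card (span B)" by (simp only: mult_le_cancel2)
qed

lemma lrank_mult_kernel:
  assumes "u \<in> carrier V" "subsp F S" "S \<subseteq> carrier V"
  shows "card S = card (\<sigma> u ` S) * card {x \<in> S. \<sigma> u x = \<zero>\<^bsub>K\<^esub>}"
  by (rule card_subsp_hom[OF F assms(2) R.abelian_group_axioms])
    (use assms in \<open>auto simp: subset_iff\<close>)

lemma subsp_kernel:
  assumes "u \<in> carrier V" "subsp F S"
  shows "subsp F {x \<in> S. \<sigma> u x = \<zero>\<^bsub>K\<^esub>}"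
  by (rule subspI) (use assms subspD[OF assms(2)] subfieldD(1)[OF F] in \<open>auto simp: subset_iff\<close>)

lemma lrank_power:
  assumes "u \<in> carrier V" shows "\<exists>r. lrank u = q ^ r"
proof -
  obtain d where d: "card {x \<in> W. \<sigma> u x = \<zero>\<^bsub>K\<^esub>} = q ^ d"
    using card_subsp_power[OF F subsp_kernel[OF assms W]] by auto
  have e: "q ^ n = lrank u * q ^ d" using lrank_mult_kernel[OF assms W subspD(1)[OF W]] d card_W by simp
  have "lrank u \<ge> 1" using subspD(2,5)[OF W] card_gt_0_iff[of "\<sigma> u ` W"] by fastforce
  hence "q ^ d \<le> q ^ n" using e by (metis mult_le_mono1 mult_1)
  hence "d \<le> n" using card_subfield_power_le[OF F] by simp
  hence "lrank u * q ^ d = q ^ (n - d) * q ^ d" using e by (simp add: power_add[symmetric])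
  hence "lrank u = q ^ (n - d)" using q_gt_1 by simp
  thus ?thesis by blast
qed

text \<open>Ranks are integers, which turns a failed lower bound into a nonstrict upper
  bound.\<close>

lemma lrank_le_iff: "u \<in> carrier V \<Longrightarrow> lrank u < q ^ Suc s \<longleftrightarrow> lrank u \<le> q ^ s"
proof -
  assume "u \<in> carrier V"
  then obtain r where r: "lrank u = q ^ r" using lrank_power by blast
  show ?thesis unfolding r power_strict_increasing_iff[OF q_gt_1] power_increasing_iff[OF q_gt_1] by auto
qed

text \<open>The right annihilator of \<open>A\<close> in \<open>W\<close> has the F-dimension of
  \<open>A\<close> as its codimension, and \<sigma> u vanishes on it because \<open>u\<close> is a
  K-combination of elements of \<open>A\<close>.\<close>

lemma lrank_le_card:
  assumes A: "subsp F A" "A \<subseteq> W" and u: "u \<in> span A"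
  shows "lrank u \<le> card A"
proof -
  have uV: "u \<in> carrier V" using u subsp_span[OF subspD(1)[OF A(1)]] subsp_mem by blast
  let ?P = "perp (flip \<sigma>) W A"
  have "card ?P * card A = card W"
    by (rule card_perp_nondegenerate[OF F pairing_flip[OF pairing_W] refl
              nondegenerate_flip[OF F pairing_W refl nondegenerate_W] A])
  moreover have "?P \<subseteq> {x \<in> W. \<sigma> u x = \<zero>\<^bsub>K\<^esub>}"
  proof
    fix y assume y: "y \<in> ?P"
    hence yW: "y \<in> W" by (auto simp: perp_def)
    have "span A \<subseteq> perp \<sigma> (carrier V) {y}"
      by (rule span_minimal[OF _ subsp_perp_V]) (use y yW A in \<open>auto simp: perp_def\<close>)
    thus "y \<in> {x \<in> W. \<sigma> u x = \<zero>\<^bsub>K\<^esub>}" using u yW by (auto simp: perp_def)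
  qed
  hence "card ?P \<le> card {x \<in> W. \<sigma> u x = \<zero>\<^bsub>K\<^esub>}"
    by (rule card_mono[rotated]) (use subspD(5)[OF W] in auto)
  hence "lrank u * card ?P \<le> card W"
    using lrank_mult_kernel[OF uV W subspD(1)[OF W]] by simp
  ultimately have "lrank u * card ?P \<le> card A * card ?P" by (simp add: mult.commute)
  thus ?thesis using card_subsp_pos[OF subsp_rperp_W[OF A(2)]] by simp
qed

lemma rrank_le_card:
  assumes "subsp F B" "B \<subseteq> W" "v \<in> span B"
  shows "rrank v \<le> card B"
proof -
  interpret fl: rank_setup K V F W "flip \<sigma>" n by (rule rank_setup_flip)
  show ?thesis by (rule fl.lrank_le_card[OF assms])
qed

text \<open>This is the converse of \<open>rrank_le_card\<close>, as \<open>?B\<close> has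
  cardinality \<open>rrank v\<close> by rank-nullity. The span of \<open>?B\<close> lies in the
  right annihilator of \<open>span ?A\<close> and has the same K-dimension, so it is that
  annihilator, to which \<open>v\<close> belongs.\<close>

lemma mem_span_rperp_kernel:
  assumes v: "v \<in> carrier V"
  shows "v \<in> span (perp (flip \<sigma>) W {x \<in> W. \<sigma> x v = \<zero>\<^bsub>K\<^esub>})"
proof -
  interpret fl: rank_setup K V F W "flip \<sigma>" n by (rule rank_setup_flip)
  let ?A = "{x \<in> W. \<sigma> x v = \<zero>\<^bsub>K\<^esub>}"
  let ?B = "perp (flip \<sigma>) W ?A"
  have A: "subsp F ?A" by (rule fl.subsp_kernel[OF v W])
  have B: "subsp F ?B" by (rule subsp_rperp_W) auto
  obtain a where a: "card ?A = q ^ a" using card_subsp_power[OF F A] by auto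
  obtain b where b: "card ?B = q ^ b" using card_subsp_power[OF F B] by auto
  have "q ^ (a + b) = q ^ n" using fl.card_perp_W[OF A] a b by (auto simp: power_add mult.commute)
  hence ab: "a + b = n" using card_subfield_power_inject[OF F] by simp
  have sA: "subsp (carrier K) (span ?A)" by (rule subsp_span[OF subspD(1)[OF A]])
  let ?P = "perp (flip \<sigma>) (carrier V) (span ?A)"
  have P: "subsp (carrier K) ?P" by (rule subsp_rperp_V[OF subspD(1)[OF sA]])
  have "card ?P * Q ^ a = Q ^ b * Q ^ a"
    using fl.card_perp_V[OF sA] card_span[OF A _ a] ab by (auto simp: power_add[symmetric] add.commute)
  hence eq: "card (span ?B) = card ?P" using card_span[OF B _ b] Q_gt_1 by (auto simp: perp_def)
  have sub: "span ?B \<subseteq> ?P"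
  proof (rule span_minimal[OF _ P])
    show "?B \<subseteq> ?P"
    proof
      fix y assume y: "y \<in> ?B"
      hence yW: "y \<in> W" by (auto simp: perp_def)
      have "span ?A \<subseteq> perp \<sigma> (carrier V) {y}"
        by (rule span_minimal[OF _ subsp_perp_V]) (use y yW in \<open>auto simp: perp_def\<close>)
      thus "y \<in> ?P" using yW by (auto simp: perp_def)
    qed
  qed
  have "span ?B = ?P" by (rule card_subset_eq[OF subspD(5)[OF P] sub eq])
  moreover have "span ?A \<subseteq> perp \<sigma> (carrier V) {v}"
    by (rule span_minimal[OF _ subsp_perp_V]) (use v in \<open>auto simp: perp_def\<close>)
  hence "v \<in> ?P" using v by (auto simp: perp_def)
  ultimately show ?thesis by simp
qed

end

section \<open>Rank bounds for scattered decompositions\<close>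

text \<open>\<open>P I\<close> stands for the projection of \<open>V\<close> onto the components
  indexed by \<open>I\<close> along the others; its invariance properties say that \<open>W\<close>
  and \<Gamma> split accordingly. \<open>scattered_full\<close> is condition (3): if H is the kernel
  of \<sigma> u, then dimension at most k - 1 for the intersection of \<open>W\<close> with H means
  rank at least n - k + 1, and H contains no component when \<sigma> u is nonzero on each of
  them.\<close>

locale scattered_decomposition = rank_setup K V F W \<sigma> n
  for K :: "'a ring" and V :: "('a, 'c) module" and F W \<sigma> n +
  fixes t :: nat and P :: "nat set \<Rightarrow> 'c \<Rightarrow> 'c" and \<Gamma> :: "'c set" and nv kv :: "nat \<Rightarrow> nat"
  assumes \<Gamma>: "subsp (carrier K) \<Gamma>"
    and n_sum: "n = (\<Sum>i<t. nv i)"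
    and kv_pos: "\<And>i. i < t \<Longrightarrow> 0 < kv i" and kv_less: "\<And>i. i < t \<Longrightarrow> kv i < nv i"
    and P_closed [simp]: "\<And>I x. x \<in> carrier V \<Longrightarrow> P I x \<in> carrier V"
    and P_add [simp]: "\<And>I x y. \<lbrakk>x \<in> carrier V; y \<in> carrier V\<rbrakk> \<Longrightarrow> P I (x \<oplus>\<^bsub>V\<^esub> y) = P I x \<oplus>\<^bsub>V\<^esub> P I y"
    and P_smult [simp]: "\<And>I c x. \<lbrakk>c \<in> carrier K; x \<in> carrier V\<rbrakk> \<Longrightarrow> P I (c \<odot>\<^bsub>V\<^esub> x) = c \<odot>\<^bsub>V\<^esub> P I x"
    and P_Int: "\<And>I J x. \<lbrakk>I \<subseteq> {..<t}; J \<subseteq> {..<t}; x \<in> carrier V\<rbrakk> \<Longrightarrow> P I (P J x) = P (I \<inter> J) x"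
    and P_Un: "\<And>I J x. \<lbrakk>I \<subseteq> {..<t}; J \<subseteq> {..<t}; I \<inter> J = {}; x \<in> carrier V\<rbrakk> \<Longrightarrow> P (I \<union> J) x = P I x \<oplus>\<^bsub>V\<^esub> P J x"
    and P_all [simp]: "\<And>x. x \<in> carrier V \<Longrightarrow> P {..<t} x = x"
    and P_W [simp]: "\<And>I x. x \<in> W \<Longrightarrow> P I x \<in> W"
    and P_\<Gamma> [simp]: "\<And>I x. x \<in> \<Gamma> \<Longrightarrow> P I x \<in> \<Gamma>"
    and card_P_W1: "\<And>i. i < t \<Longrightarrow> card (P {i} ` W) = card F ^ nv i"
    and card_P_\<Gamma>1: "\<And>i. i < t \<Longrightarrow> card (P {i} ` \<Gamma>) = card (carrier K) ^ (nv i - kv i)"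
    and scattered_full: "\<And>u. \<lbrakk>u \<in> perp \<sigma> (carrier V) \<Gamma>; \<And>i. i < t \<Longrightarrow> \<exists>y\<in>W. \<sigma> u (P {i} y) \<noteq> \<zero>\<^bsub>K\<^esub>\<rbrakk>
      \<Longrightarrow> card F ^ (\<Sum>i<t. nv i - kv i) < card (\<sigma> u ` W)"
begin

lemma \<Gamma>_mem: "x \<in> \<Gamma> \<Longrightarrow> x \<in> carrier V"
  using subsp_mem[OF \<Gamma>] .

lemma P_empty [simp]: "x \<in> carrier V \<Longrightarrow> P {} x = \<zero>\<^bsub>V\<^esub>"
  using P_Un[of "{}" "{}" x] by (simp add: M.add.l_cancel_one')

lemma subsp_P: "subsp C X \<Longrightarrow> C \<subseteq> carrier K \<Longrightarrow> subsp C (P I ` X)"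
  by (rule subsp_image) (auto simp: subsp_mem subset_iff)

lemma subsp_P_V: "subsp (carrier K) (P I ` carrier V)"
  by (rule subsp_P[OF subsp_carrier]) simp

lemma subsp_P_W: "subsp F (P I ` W)"
  by (rule subsp_P[OF W]) (rule subfieldD(1)[OF F])

lemma subsp_P_\<Gamma>: "subsp (carrier K) (P I ` \<Gamma>)"
  by (rule subsp_P[OF \<Gamma>]) simp

lemma P_split: "\<lbrakk>I \<subseteq> {..<t}; x \<in> carrier V\<rbrakk> \<Longrightarrow> x = P I x \<oplus>\<^bsub>V\<^esub> P ({..<t} - I) x"
  using P_Un[of I "{..<t} - I" x] P_all[of x] by (simp add: Un_absorb1)

lemma card_P_power:
  assumes C: "subfield C K" and X: "subsp C X" and inv: "\<And>I x. x \<in> X \<Longrightarrow> P I x \<in> X"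
    and c1: "\<And>i. i < t \<Longrightarrow> card (P {i} ` X) = c ^ d i" and I: "I \<subseteq> {..<t}"
  shows "card (P I ` X) = c ^ (\<Sum>i\<in>I. d i)"
proof -
  have "finite I" using I finite_subset by blast
  thus ?thesis using I
  proof (induction rule: finite_induct)
    case empty
    have "P {} ` X = {\<zero>\<^bsub>V\<^esub>}" using subsp_mem[OF X] subspD(2)[OF X] by force
    thus ?case by simp
  next
    case (insert i I)
    have i: "i < t" "{i} \<subseteq> {..<t}" and I: "I \<subseteq> {..<t}" using insert by auto
    note C' = subfieldD(1)[OF C]
    have "P (insert i I) ` X = P {i} ` X <+>\<^bsub>V\<^esub> P I ` X"
    proof
      show "P (insert i I) ` X \<subseteq> P {i} ` X <+>\<^bsub>V\<^esub> P I ` X"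
      proof
        fix z assume "z \<in> P (insert i I) ` X"
        then obtain x where x: "x \<in> X" "z = P (insert i I) x" by auto
        hence "z = P {i} x \<oplus>\<^bsub>V\<^esub> P I x"
          using P_Un[OF i(2) I, of x] insert(2) subsp_mem[OF X] by auto
        thus "z \<in> P {i} ` X <+>\<^bsub>V\<^esub> P I ` X" using x(1) unfolding M.set_add_mem by blast
      qed
      show "P {i} ` X <+>\<^bsub>V\<^esub> P I ` X \<subseteq> P (insert i I) ` X"
      proof
        fix z assume "z \<in> P {i} ` X <+>\<^bsub>V\<^esub> P I ` X"
        then obtain x y where x: "x \<in> X" "y \<in> X" "z = P {i} x \<oplus>\<^bsub>V\<^esub> P I y"
          unfolding M.set_add_mem by blast
        have V: "x \<in> carrier V" "y \<in> carrier V" using x subsp_mem[OF X] by auto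
        have "P (insert i I) z = P (insert i I \<inter> {i}) x \<oplus>\<^bsub>V\<^esub> P (insert i I \<inter> I) y"
          unfolding x(3) using V insert(4) i I by (simp add: P_Int)
        also have "\<dots> = z" unfolding x(3) by (simp add: Int_absorb1 subset_insertI)
        finally have "z = P (insert i I) z" by simp
        moreover have "z \<in> X" unfolding x(3) using subspD(3)[OF X] inv x by blast
        ultimately show "z \<in> P (insert i I) ` X" by (metis imageI)
      qed
    qed
    moreover have "P {i} ` X \<inter> P I ` X = {\<zero>\<^bsub>V\<^esub>}"
    proof -
      have "z = \<zero>\<^bsub>V\<^esub>" if z: "z \<in> P {i} ` X" "z \<in> P I ` X" for z
      proof -
        obtain x y where x: "x \<in> X" "z = P {i} x" and y: "y \<in> X" "z = P I y" using z by blast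
        have V: "x \<in> carrier V" "y \<in> carrier V" using x y subsp_mem[OF X] by auto
        have "z = P {i} z" unfolding x(2) using P_Int[OF i(2) i(2) V(1)] by simp
        also have "\<dots> = P ({i} \<inter> I) y" unfolding y(2) by (rule P_Int[OF i(2) I V(2)])
        also have "{i} \<inter> I = {}" using insert(2) by simp
        finally show ?thesis using V by simp
      qed
      thus ?thesis using subspD(2)[OF subsp_P[OF X C']] by blast
    qed
    ultimately have "card (P (insert i I) ` X) = card (P {i} ` X) * card (P I ` X)"
      using card_subsp_add[OF C subsp_P[OF X C'] subsp_P[OF X C'], of "{i}" I] by simp
    thus ?case using c1[OF i(1)] insert.IH[OF I] insert(1,2) by (simp add: power_add)
  qed
qed

lemma P_W_subset: "P I ` W \<subseteq> W" by auto

lemma card_P_W: "I \<subseteq> {..<t} \<Longrightarrow> card (P I ` W) = q ^ (\<Sum>i\<in>I. nv i)"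
  by (rule card_P_power[OF F W P_W card_P_W1])

lemma card_P_\<Gamma>: "I \<subseteq> {..<t} \<Longrightarrow> card (P I ` \<Gamma>) = Q ^ (\<Sum>i\<in>I. nv i - kv i)"
  by (rule card_P_power[OF subfield_carrier \<Gamma> P_\<Gamma> card_P_\<Gamma>1])

lemma image_P_span:
  assumes B: "subsp F B"
  shows "P I ` span B = span (P I ` B)"
proof
  have BV: "B \<subseteq> carrier V" using subspD(1)[OF B] .
  have PB: "P I ` B \<subseteq> carrier V" using BV by auto
  note s = subspD[OF subsp_span[OF PB]]
  have "subsp (carrier K) {x \<in> carrier V. P I x \<in> span (P I ` B)}"
  proof (rule subspI)
    have "P I \<zero>\<^bsub>V\<^esub> = \<zero>\<^bsub>V\<^esub>" using P_smult[of "\<zero>\<^bsub>K\<^esub>" "\<zero>\<^bsub>V\<^esub>" I] by simp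
    thus "\<zero>\<^bsub>V\<^esub> \<in> {x \<in> carrier V. P I x \<in> span (P I ` B)}" using s(2) by simp
  qed (use s in auto)
  hence "span B \<subseteq> {x \<in> carrier V. P I x \<in> span (P I ` B)}"
    by (rule span_minimal[rotated]) (use BV in_own_span[OF PB] in auto)
  thus "P I ` span B \<subseteq> span (P I ` B)" by auto
  show "span (P I ` B) \<subseteq> P I ` span B"
    by (rule span_minimal) (use in_own_span[OF BV] subsp_P[OF subsp_span[OF BV]] in auto)
qed

lemma card_P_V: "I \<subseteq> {..<t} \<Longrightarrow> card (P I ` carrier V) = Q ^ (\<Sum>i\<in>I. nv i)"
  using image_P_span[OF W, of I] card_span[OF subsp_P_W P_W_subset card_P_W, of I] span_W by simp

lemma sum_split:
  assumes "I \<subseteq> {..<t}"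
  shows "n = (\<Sum>i\<in>I. nv i) + (\<Sum>i\<in>{..<t} - I. nv i)"
    "(\<Sum>i\<in>I. nv i) = (\<Sum>i\<in>I. kv i) + (\<Sum>i\<in>I. nv i - kv i)"
proof -
  show "n = (\<Sum>i\<in>I. nv i) + (\<Sum>i\<in>{..<t} - I. nv i)"
    unfolding n_sum using sum.subset_diff[OF assms, of nv] by simp
  have "kv i + (nv i - kv i) = nv i" if "i \<in> I" for i using kv_less[of i] that assms by auto
  thus "(\<Sum>i\<in>I. nv i) = (\<Sum>i\<in>I. kv i) + (\<Sum>i\<in>I. nv i - kv i)"
    by (simp add: sum.distrib[symmetric])
qed

section \<open>Supports of functionals and of vectors\<close>

definition lsupp :: "'c \<Rightarrow> nat set" where
  "lsupp u = {i. i < t \<and> (\<exists>y\<in>W. \<sigma> u (P {i} y) \<noteq> \<zero>\<^bsub>K\<^esub>)}"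

definition rsupp :: "'c \<Rightarrow> nat set" where
  "rsupp v = {i. i < t \<and> P {i} v \<noteq> \<zero>\<^bsub>V\<^esub>}"

lemma lsupp_subset: "lsupp u \<subseteq> {..<t}" by (auto simp: lsupp_def)

lemma rsupp_subset: "rsupp u \<subseteq> {..<t}" by (auto simp: rsupp_def)

lemma form_P_zero_V:
  assumes u: "u \<in> carrier V" and 0: "\<And>y. y \<in> W \<Longrightarrow> \<sigma> u (P I y) = \<zero>\<^bsub>K\<^esub>" and y: "y \<in> carrier V"
  shows "\<sigma> u (P I y) = \<zero>\<^bsub>K\<^esub>"
proof -
  have "subsp (carrier K) {y \<in> carrier V. \<sigma> u (P I y) = \<zero>\<^bsub>K\<^esub>}"
  proof (rule subspI)
    have "P I \<zero>\<^bsub>V\<^esub> = \<zero>\<^bsub>V\<^esub>" using P_smult[of "\<zero>\<^bsub>K\<^esub>" "\<zero>\<^bsub>V\<^esub>" I] by simp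
    thus "\<zero>\<^bsub>V\<^esub> \<in> {y \<in> carrier V. \<sigma> u (P I y) = \<zero>\<^bsub>K\<^esub>}" using u by simp
  qed (use u in auto)
  hence "span W \<subseteq> {y \<in> carrier V. \<sigma> u (P I y) = \<zero>\<^bsub>K\<^esub>}"
    by (rule span_minimal[rotated]) (use 0 in auto)
  thus ?thesis using y span_W by auto
qed

lemma form_P_zero_lsupp:
  assumes u: "u \<in> carrier V" and I: "I \<subseteq> {..<t}" "I \<inter> lsupp u = {}" and y: "y \<in> carrier V"
  shows "\<sigma> u (P I y) = \<zero>\<^bsub>K\<^esub>"
proof (rule form_P_zero_V[OF u _ y])
  fix y assume y: "y \<in> W"
  have "finite I" using I finite_subset by blast
  thus "\<sigma> u (P I y) = \<zero>\<^bsub>K\<^esub>" using I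
  proof (induction rule: finite_induct)
    case empty thus ?case using u y by simp
  next
    case (insert i I)
    have "\<sigma> u (P {i} y) = \<zero>\<^bsub>K\<^esub>" using insert y by (auto simp: lsupp_def)
    moreover have "P ({i} \<union> I) y = P {i} y \<oplus>\<^bsub>V\<^esub> P I y"
      using insert y by (intro P_Un) auto
    ultimately show ?case using insert u y by simp
  qed
qed

lemma form_P_lsupp:
  assumes u: "u \<in> carrier V" and I: "I \<subseteq> {..<t}" "lsupp u \<subseteq> I" and y: "y \<in> carrier V"
  shows "\<sigma> u (P I y) = \<sigma> u y"
proof -
  have "\<sigma> u y = \<sigma> u (P I y) \<oplus>\<^bsub>K\<^esub> \<sigma> u (P ({..<t} - I) y)"
    by (subst P_split[OF I(1) y], rule form_add_r) (use u y in auto)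
  moreover have "\<sigma> u (P ({..<t} - I) y) = \<zero>\<^bsub>K\<^esub>"
    by (rule form_P_zero_lsupp[OF u _ _ y]) (use I in auto)
  ultimately show ?thesis using u y by simp
qed

lemma lsupp_empty: "u \<in> carrier V \<Longrightarrow> lsupp u = {} \<Longrightarrow> u = \<zero>\<^bsub>V\<^esub>"
  using form_P_zero_lsupp[of u "{..<t}"] by (intro form_nondegenerate) auto

lemma P_zero_rsupp:
  assumes v: "v \<in> carrier V" and I: "I \<subseteq> {..<t}" "I \<inter> rsupp v = {}"
  shows "P I v = \<zero>\<^bsub>V\<^esub>"
proof -
  have "finite I" using I finite_subset by blast
  thus ?thesis using I
  proof (induction rule: finite_induct)
    case empty thus ?case using v by simp
  next
    case (insert i I)
    have "P {i} v = \<zero>\<^bsub>V\<^esub>" using insert by (auto simp: rsupp_def)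
    moreover have "P ({i} \<union> I) v = P {i} v \<oplus>\<^bsub>V\<^esub> P I v"
      using insert v by (intro P_Un) auto
    ultimately show ?case using insert by simp
  qed
qed

lemma P_rsupp:
  assumes v: "v \<in> carrier V" and I: "I \<subseteq> {..<t}" "rsupp v \<subseteq> I"
  shows "P I v = v"
proof -
  have "P ({..<t} - I) v = \<zero>\<^bsub>V\<^esub>" by (rule P_zero_rsupp[OF v]) (use I in auto)
  thus ?thesis using P_split[OF I(1) v] v by simp
qed

lemma rsupp_empty: "v \<in> carrier V \<Longrightarrow> rsupp v = {} \<Longrightarrow> v = \<zero>\<^bsub>V\<^esub>"
  using P_zero_rsupp[of v "{..<t}"] by auto

lemma rsupp_P:
  assumes v: "v \<in> carrier V" and I: "I \<subseteq> {..<t}"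
  shows "rsupp (P I v) = I \<inter> rsupp v"
proof -
  have "P {i} (P I v) = (if i \<in> I then P {i} v else \<zero>\<^bsub>V\<^esub>)" if "i < t" for i
    using P_Int[of "{i}" I v] that v I by auto
  thus ?thesis using I by (auto simp: rsupp_def split: if_splits)
qed

text \<open>These are the vectors of \<open>W\<close> with left support in \<open>I\<close>. For
  singletons they form the decomposition of \<open>W\<close> dual to the one given by
  \<open>P\<close>, and their images become the components of the Delsarte dual.\<close>

definition dW :: "nat set \<Rightarrow> 'c set" where
  "dW I = perp \<sigma> W (P ({..<t} - I) ` W)"

lemma subsp_dW: "subsp F (dW I)"
  unfolding dW_def by (rule subsp_perp_W) auto

lemma dW_subset: "dW I \<subseteq> W" by (auto simp: dW_def perp_def)

lemma card_dW:
  assumes I: "I \<subseteq> {..<t}" shows "card (dW I) = q ^ (\<Sum>i\<in>I. nv i)"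
proof -
  have "card (dW I) * q ^ (\<Sum>i\<in>{..<t} - I. nv i) = q ^ n"
    unfolding dW_def using card_perp_W[OF subsp_P_W P_W_subset, of "{..<t} - I"] card_P_W[of "{..<t} - I"] by auto
  also have "\<dots> = q ^ (\<Sum>i\<in>I. nv i) * q ^ (\<Sum>i\<in>{..<t} - I. nv i)"
    unfolding sum_split(1)[OF I] power_add ..
  finally show ?thesis using q_gt_1 by simp
qed

lemma dW_form_zero:
  assumes x: "x \<in> dW I" and y: "y \<in> carrier V"
  shows "\<sigma> x (P ({..<t} - I) y) = \<zero>\<^bsub>K\<^esub>"
  by (rule form_P_zero_V[OF _ _ y]) (use x in \<open>auto simp: dW_def perp_def\<close>)

definition dV :: "nat set \<Rightarrow> 'c set" where
  "dV I = perp \<sigma> (carrier V) (P ({..<t} - I) ` carrier V)"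

lemma subsp_dV: "subsp (carrier K) (dV I)"
  unfolding dV_def by (rule subsp_perp_V) auto

lemma dW_subset_dV: "dW I \<subseteq> dV I"
  using dW_form_zero dW_subset[of I] by (auto simp: dV_def perp_def subset_iff)

lemma card_dV:
  assumes I: "I \<subseteq> {..<t}" shows "card (dV I) = Q ^ (\<Sum>i\<in>I. nv i)"
proof -
  have "card (dV I) * Q ^ (\<Sum>i\<in>{..<t} - I. nv i) = Q ^ n"
    unfolding dV_def using card_perp_V[OF subsp_P_V, of "{..<t} - I"] card_P_V[of "{..<t} - I"] by auto
  also have "\<dots> = Q ^ (\<Sum>i\<in>I. nv i) * Q ^ (\<Sum>i\<in>{..<t} - I. nv i)"
    unfolding sum_split(1)[OF I] power_add ..
  finally show ?thesis using Q_gt_1 by simp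
qed

definition d\<Gamma> :: "nat set \<Rightarrow> 'c set" where
  "d\<Gamma> I = perp \<sigma> (carrier V) \<Gamma> \<inter> dV I"

lemma subsp_d\<Gamma>: "subsp (carrier K) (d\<Gamma> I)"
  unfolding d\<Gamma>_def by (rule subsp_Int[OF subsp_perp_V subsp_dV]) (rule subspD(1)[OF \<Gamma>])

text \<open>A vector annihilating \<open>?T\<close> lies in \<open>d\<Gamma> I\<close>, since
  \<Gamma> is contained in \<open>?T\<close>. Of each component i in \<open>I\<close>,
  \<open>?T\<close> retains only the n_i - k_i dimensions of \<Gamma>, which leaves k_i dimensions
  for the annihilator.\<close>

lemma card_d\<Gamma>:
  assumes I: "I \<subseteq> {..<t}" shows "Q ^ (\<Sum>i\<in>I. kv i) \<le> card (d\<Gamma> I)"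
proof -
  let ?J = "{..<t} - I"
  let ?T = "P I ` \<Gamma> <+>\<^bsub>V\<^esub> P ?J ` carrier V"
  have T: "subsp (carrier K) ?T" by (rule subsp_set_add[OF subsp_P_\<Gamma> subsp_P_V]) simp
  have "card ?T \<le> Q ^ (\<Sum>i\<in>I. nv i - kv i) * Q ^ (\<Sum>i\<in>?J. nv i)"
    using card_subsp_add_le[OF subfield_carrier subsp_P_\<Gamma> subsp_P_V, of I ?J]
    unfolding card_P_\<Gamma>[OF I] card_P_V[OF Diff_subset] .
  hence "Q ^ n \<le> card (perp \<sigma> (carrier V) ?T) * (Q ^ (\<Sum>i\<in>I. nv i - kv i) * Q ^ (\<Sum>i\<in>?J. nv i))"
    unfolding card_perp_V[OF T, symmetric] by (rule mult_le_mono2)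
  also have "Q ^ n = Q ^ (\<Sum>i\<in>I. kv i) * (Q ^ (\<Sum>i\<in>I. nv i - kv i) * Q ^ (\<Sum>i\<in>?J. nv i))"
    unfolding sum_split(1)[OF I] sum_split(2)[OF I] by (simp add: power_add)
  finally have "Q ^ (\<Sum>i\<in>I. kv i) \<le> card (perp \<sigma> (carrier V) ?T)"
    unfolding mult_le_cancel2 using Q_gt_1 by simp
  also have "\<dots> \<le> card (d\<Gamma> I)"
  proof (rule card_mono[OF subspD(5)[OF subsp_d\<Gamma>]], rule subsetI)
    fix x assume x: "x \<in> perp \<sigma> (carrier V) ?T"
    have xV: "x \<in> carrier V" using x by (auto simp: perp_def)
    have x0: "\<sigma> x y = \<zero>\<^bsub>K\<^esub>" if "y \<in> ?T" for y using x that by (auto simp: perp_def)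
    have J: "\<sigma> x (P ?J y) = \<zero>\<^bsub>K\<^esub>" if "y \<in> carrier V" for y
    proof (rule x0)
      have "P ?J ` carrier V \<subseteq> ?T" by (rule subset_set_add2[OF subsp_P_\<Gamma> subspD(1)[OF subsp_P_V]])
      thus "P ?J y \<in> ?T" using that by auto
    qed
    have "\<sigma> x g = \<zero>\<^bsub>K\<^esub>" if g: "g \<in> \<Gamma>" for g
    proof (rule x0)
      have "g = P I g \<oplus>\<^bsub>V\<^esub> P ?J g" by (rule P_split[OF I \<Gamma>_mem[OF g]])
      thus "g \<in> ?T" unfolding M.set_add_mem using g \<Gamma>_mem[OF g] by blast
    qed
    thus "x \<in> d\<Gamma> I" using xV J by (auto simp: d\<Gamma>_def dV_def perp_def)
  qed
  finally show ?thesis .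
qed

lemma lsupp_dV:
  assumes "u \<in> dV I" "I \<subseteq> {..<t}" shows "lsupp u \<subseteq> I"
proof
  fix i assume i: "i \<in> lsupp u"
  then obtain y where y: "i < t" "y \<in> W" "\<sigma> u (P {i} y) \<noteq> \<zero>\<^bsub>K\<^esub>" by (auto simp: lsupp_def)
  show "i \<in> I"
  proof (rule ccontr)
    assume "i \<notin> I"
    hence "({..<t} - I) \<inter> {i} = {i}" using y by auto
    hence "P {i} y = P ({..<t} - I) (P {i} y)" using P_Int[of "{..<t} - I" "{i}" y] y by simp
    moreover have "\<sigma> u (P ({..<t} - I) (P {i} y)) = \<zero>\<^bsub>K\<^esub>"
      using assms(1) y by (auto simp: dV_def perp_def)
    ultimately show False using y by simp
  qed
qed

section \<open>Lower bounds for left ranks\<close>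

lemma additive_subgroup_form_image:
  assumes u: "u \<in> carrier V" shows "additive_subgroup (\<sigma> u ` W) K"
proof -
  have "subgroup (\<sigma> u ` W) (add_monoid K)"
  proof (rule R.add.subgroupI)
    show "\<sigma> u ` W \<subseteq> carrier K" using u by auto
    show "\<sigma> u ` W \<noteq> {}" using subspD(2)[OF W] by auto
    fix a assume "a \<in> \<sigma> u ` W"
    then obtain x where x: "x \<in> W" "a = \<sigma> u x" by auto
    have "\<sigma> u (\<ominus>\<^bsub>K\<^esub> \<one>\<^bsub>K\<^esub> \<odot>\<^bsub>V\<^esub> x) = \<ominus>\<^bsub>K\<^esub> \<one>\<^bsub>K\<^esub> \<otimes>\<^bsub>K\<^esub> a" using x u by simp
    moreover have "\<dots> = \<ominus>\<^bsub>K\<^esub> a" using x u by (simp add: R.l_minus)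
    moreover have "\<ominus>\<^bsub>K\<^esub> \<one>\<^bsub>K\<^esub> \<odot>\<^bsub>V\<^esub> x \<in> W" using subspD(4)[OF W subfieldD(4)[OF F] x(1)] .
    ultimately show "\<ominus>\<^bsub>K\<^esub> a \<in> \<sigma> u ` W" by (metis imageI)
    fix b assume "b \<in> \<sigma> u ` W"
    then obtain y where y: "y \<in> W" "b = \<sigma> u y" by auto
    have "\<sigma> u (x \<oplus>\<^bsub>V\<^esub> y) = a \<oplus>\<^bsub>K\<^esub> b" using x y u by simp
    thus "a \<oplus>\<^bsub>K\<^esub> b \<in> \<sigma> u ` W" using subspD(3)[OF W x(1) y(1)] by (metis imageI)
  qed
  thus ?thesis by (simp add: additive_subgroup_def)
qed

text \<open>The image of the sum lies in the sum of the two images. These share the F-line through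
  \<open>a\<close>, and the formula for the size of a sum turns the common line into the factor
  q.\<close>

lemma lrank_add_le:
  assumes u: "u \<in> carrier V" and w: "w \<in> carrier V"
    and com: "a \<in> \<sigma> u ` W" "a \<in> \<sigma> w ` W" "a \<noteq> \<zero>\<^bsub>K\<^esub>"
  shows "lrank (u \<oplus>\<^bsub>V\<^esub> w) * q \<le> lrank u * lrank w"
proof -
  let ?S = "\<sigma> u ` W" and ?T = "\<sigma> w ` W"
  have fin: "finite ?S" "finite ?T" using subspD(5)[OF W] by auto
  have aK: "a \<in> carrier K" using com(1) u by auto
  have mult: "c \<otimes>\<^bsub>K\<^esub> a \<in> \<sigma> z ` W" if "z \<in> carrier V" "a \<in> \<sigma> z ` W" "c \<in> F" for c z
  proof -
    obtain y where y: "y \<in> W" "a = \<sigma> z y" using \<open>a \<in> \<sigma> z ` W\<close> by auto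
    have "\<sigma> z (c \<odot>\<^bsub>V\<^esub> y) = c \<otimes>\<^bsub>K\<^esub> a" using y that subfieldD(1)[OF F] by auto
    thus ?thesis using subspD(4)[OF W that(3) y(1)] by (metis imageI)
  qed
  have "q = card ((\<lambda>c. c \<otimes>\<^bsub>K\<^esub> a) ` F)"
  proof (rule card_image[symmetric], rule inj_onI)
    fix c d assume "c \<in> F" "d \<in> F" "c \<otimes>\<^bsub>K\<^esub> a = d \<otimes>\<^bsub>K\<^esub> a"
    thus "c = d" using m_rcancel[OF com(3) aK] subfieldD(1)[OF F] by blast
  qed
  also have "\<dots> \<le> card (?S \<inter> ?T)"
    by (rule card_mono) (use fin mult[OF u com(1)] mult[OF w com(2)] in auto)
  finally have "card (set_add K ?S ?T) * q \<le> card (set_add K ?S ?T) * card (?S \<inter> ?T)" by simp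
  also have "\<dots> = lrank u * lrank w"
    by (rule R.card_set_add[OF additive_subgroup_form_image[OF u] additive_subgroup_form_image[OF w] fin])
  finally have "card (set_add K ?S ?T) * q \<le> lrank u * lrank w" .
  moreover have "lrank (u \<oplus>\<^bsub>V\<^esub> w) \<le> card (set_add K ?S ?T)"
  proof (rule card_mono)
    show "finite (set_add K ?S ?T)"
      by (rule finite_subset[OF _ finite_K]) (use u w in \<open>auto simp: R.set_add_mem\<close>)
    show "\<sigma> (u \<oplus>\<^bsub>V\<^esub> w) ` W \<subseteq> set_add K ?S ?T"
    proof
      fix z assume "z \<in> \<sigma> (u \<oplus>\<^bsub>V\<^esub> w) ` W"
      then obtain y where "y \<in> W" "z = \<sigma> u y \<oplus>\<^bsub>K\<^esub> \<sigma> w y" using u w by auto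
      thus "z \<in> set_add K ?S ?T" unfolding R.set_add_mem by blast
    qed
  qed
  ultimately show ?thesis by (meson le_trans mult_le_mono1)
qed

text \<open>In \<open>dV {j}\<close>, of dimension n_j, the space \<open>d\<Gamma> {j}\<close> of
  dimension at least k_j meets the span of every F-subspace of \<open>dW {j}\<close> of dimension
  n_j - k_j + 1; such subspaces exist because k_j > 0. By \<open>lrank_le_card\<close> the common
  vector has rank at most n_j - k_j + 1.\<close>

lemma exists_low_rank_single:
  assumes j: "j < t"
  shows "\<exists>A w. subsp F A \<and> A \<subseteq> W \<and> card A = q ^ Suc (nv j - kv j) \<and> w \<in> span A \<and> w \<in> d\<Gamma> {j} \<and> w \<noteq> \<zero>\<^bsub>V\<^esub>"
proof -
  have J: "{j} \<subseteq> {..<t}" using j by auto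
  have le: "Suc (nv j - kv j) \<le> nv j" using kv_pos[OF j] kv_less[OF j] by simp
  have "q ^ Suc (nv j - kv j) \<le> card (dW {j})"
    unfolding card_dW[OF J] card_subfield_power_le[OF F] using le by simp
  then obtain A where A: "subsp F A" "A \<subseteq> dW {j}" "card A = q ^ Suc (nv j - kv j)"
    using subsp_of_card[OF F subsp_dW] by blast
  have AW: "A \<subseteq> W" using A dW_subset by blast
  have AV: "A \<subseteq> carrier V" using subspD(1)[OF A(1)] .
  have "card (dV {j}) = Q ^ nv j" using card_dV[OF J] by simp
  also have "\<dots> < Q ^ Suc (nv j - kv j) * Q ^ kv j"
    unfolding power_add[symmetric] power_strict_increasing_iff[OF Q_gt_1] using kv_less[OF j] by simp
  also have "\<dots> \<le> card (span A) * card (d\<Gamma> {j})"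
    unfolding card_span[OF A(1) AW A(3)] using card_d\<Gamma>[OF J] by simp
  finally have "card (dV {j}) < card (span A) * card (d\<Gamma> {j})" .
  moreover have "span A \<subseteq> dV {j}" by (rule span_minimal[OF _ subsp_dV]) (use A dW_subset_dV in blast)
  moreover have "d\<Gamma> {j} \<subseteq> dV {j}" by (auto simp: d\<Gamma>_def)
  ultimately obtain w where "w \<in> span A" "w \<in> d\<Gamma> {j}" "w \<noteq> \<zero>\<^bsub>V\<^esub>"
    using exists_common_nonzero[OF subfield_carrier subsp_span[OF AV] subsp_d\<Gamma> subsp_dV] by blast
  thus ?thesis using A AW by blast
qed

text \<open>Full support is \<open>scattered_full\<close>; the induction runs over the number of
  missing components. For \<open>w\<close> supported on a missing j, rank (u + w) + 1 \<le> rank u +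
  (n_j - k_j + 1), so the bound for the support enlarged by j implies the one for
  \<open>u\<close>.\<close>

theorem lrank_lower_bound:
  assumes "u \<in> perp \<sigma> (carrier V) \<Gamma>" "u \<noteq> \<zero>\<^bsub>V\<^esub>"
  shows "q ^ Suc (\<Sum>i\<in>lsupp u. nv i - kv i) \<le> lrank u"
  using assms
proof (induction "card ({..<t} - lsupp u)" arbitrary: u rule: less_induct)
  case less
  have u: "u \<in> carrier V" using less by (auto simp: perp_def)
  let ?s = "\<Sum>i\<in>lsupp u. nv i - kv i"
  show ?case
  proof (cases "lsupp u = {..<t}")
    case True
    have "q ^ ?s < lrank u"
      unfolding True by (rule scattered_full[OF less(2)]) (use True in \<open>auto simp: lsupp_def\<close>)
    thus ?thesis using lrank_le_iff[OF u, of ?s] by simp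
  next
    case False
    then obtain j where j: "j < t" "j \<notin> lsupp u" using lsupp_subset[of u] by auto
    obtain A w0 where A: "subsp F A" "A \<subseteq> W" "card A = q ^ Suc (nv j - kv j)" and
      w0: "w0 \<in> span A" "w0 \<in> d\<Gamma> {j}" "w0 \<noteq> \<zero>\<^bsub>V\<^esub>" using exists_low_rank_single[OF j(1)] by blast
    have sA: "subsp (carrier K) (span A)" by (rule subsp_span[OF subspD(1)[OF A(1)]])
    have w0V: "w0 \<in> carrier V" using w0 subsp_mem[OF sA] by blast
    have l0: "lsupp w0 \<subseteq> {j}" by (rule lsupp_dV) (use w0 j in \<open>auto simp: d\<Gamma>_def\<close>)
    obtain i y where y: "y \<in> W" "\<sigma> u (P {i} y) \<noteq> \<zero>\<^bsub>K\<^esub>" using lsupp_empty[OF u] less(3) by (auto simp: lsupp_def)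
    obtain y0 where y0: "y0 \<in> W" "\<sigma> w0 (P {j} y0) \<noteq> \<zero>\<^bsub>K\<^esub>"
      using lsupp_empty[OF w0V] w0(3) l0 unfolding lsupp_def by blast
    define a where "a = \<sigma> u (P {i} y)"
    define b where "b = \<sigma> w0 (P {j} y0)"
    have ab: "a \<in> carrier K" "b \<in> carrier K" "a \<noteq> \<zero>\<^bsub>K\<^esub>" "b \<noteq> \<zero>\<^bsub>K\<^esub>"
      unfolding a_def b_def using u w0V y y0 by auto
    have ib: "inv\<^bsub>K\<^esub> b \<in> carrier K" "inv\<^bsub>K\<^esub> b \<otimes>\<^bsub>K\<^esub> b = \<one>\<^bsub>K\<^esub>" using ab by (auto simp: field_Units)
    \<comment> \<open>\<open>a\<close> and \<open>b\<close> are nonzero values of \<sigma> u and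
      \<sigma> w0 on \<open>W\<close>. After scaling by a / b the second functional takes the value
      \<open>a\<close> too. The rank bound survives because \<open>span A\<close> is closed under
      scalars from K.\<close>
    define c where "c = a \<otimes>\<^bsub>K\<^esub> inv\<^bsub>K\<^esub> b"
    have c: "c \<in> carrier K" "c \<otimes>\<^bsub>K\<^esub> b = a" using ab ib by (auto simp: c_def m_assoc)
    define w where "w = c \<odot>\<^bsub>V\<^esub> w0"
    have wA: "w \<in> span A" unfolding w_def by (rule subspD(4)[OF sA c(1) w0(1)])
    have wd: "w \<in> d\<Gamma> {j}" unfolding w_def by (rule subspD(4)[OF subsp_d\<Gamma> c(1) w0(2)])
    have w: "w \<in> carrier V" using c w0V by (simp add: w_def)
    have wa: "\<sigma> w (P {j} y0) = a" using c w0V y0 by (simp add: w_def b_def[symmetric])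
    have lw: "lsupp w = {j}"
    proof
      show "lsupp w \<subseteq> {j}" by (rule lsupp_dV) (use wd j in \<open>auto simp: d\<Gamma>_def\<close>)
      show "{j} \<subseteq> lsupp w" using wa ab y0 j by (auto simp: lsupp_def)
    qed
    let ?u = "u \<oplus>\<^bsub>V\<^esub> w"
    have u': "?u \<in> carrier V" using u w by simp
    have p: "?u \<in> perp \<sigma> (carrier V) \<Gamma>"
      using subspD(3)[OF subsp_perp_V[OF subspD(1)[OF \<Gamma>]]] less(2) wd by (auto simp: d\<Gamma>_def)
    have l: "lsupp ?u = insert j (lsupp u)"
    proof -
      have "\<sigma> ?u (P {i} y) = (if i = j then \<sigma> w (P {i} y) else \<sigma> u (P {i} y))" if "i < t" "y \<in> W" for i y
      proof (cases "i = j")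
        case True
        hence "\<sigma> u (P {i} y) = \<zero>\<^bsub>K\<^esub>" using j that by (auto simp: lsupp_def)
        thus ?thesis using True u w that by simp
      next
        case False
        hence "i \<notin> lsupp w" using lw by simp
        hence "\<sigma> w (P {i} y) = \<zero>\<^bsub>K\<^esub>" using that by (auto simp: lsupp_def)
        thus ?thesis using False u w that by simp
      qed
      hence "i \<in> lsupp ?u \<longleftrightarrow> (if i = j then i \<in> lsupp w else i \<in> lsupp u)" for i
        unfolding lsupp_def by (cases "i < t") auto
      thus ?thesis using lw j by (auto split: if_splits)
    qed
    have nz: "?u \<noteq> \<zero>\<^bsub>V\<^esub>"
    proof
      assume "?u = \<zero>\<^bsub>V\<^esub>"
      hence "lsupp ?u = {}" by (auto simp: lsupp_def)
      thus False using l by simp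
    qed
    have "card ({..<t} - lsupp ?u) < card ({..<t} - lsupp u)"
      unfolding l by (rule psubset_card_mono) (use j in auto)
    hence IH: "q ^ Suc (\<Sum>i\<in>lsupp ?u. nv i - kv i) \<le> lrank ?u" by (rule less(1)[OF _ p nz])
    have "(\<Sum>i\<in>lsupp ?u. nv i - kv i) = (nv j - kv j) + ?s"
      unfolding l using j finite_subset[OF lsupp_subset] by simp
    hence "q ^ Suc (nv j - kv j + ?s) * q \<le> lrank ?u * q" using IH by simp
    also have "\<dots> \<le> lrank u * lrank w"
    proof (rule lrank_add_le[OF u w _ _ ab(3)])
      show "a \<in> \<sigma> u ` W" unfolding a_def using y by auto
      show "a \<in> \<sigma> w ` W" unfolding wa[symmetric] using y0 by auto
    qed
    also have "\<dots> \<le> lrank u * q ^ Suc (nv j - kv j)"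
      using lrank_le_card[OF A(1,2) wA] A(3) by simp
    finally have "q ^ Suc ?s * q ^ Suc (nv j - kv j) \<le> lrank u * q ^ Suc (nv j - kv j)"
      by (simp add: power_add mult_ac)
    thus ?thesis using q_gt_1 by (simp only: mult_le_cancel2) simp
  qed
qed

theorem rrank_lower_bound:
  assumes "v \<in> \<Gamma>" "v \<noteq> \<zero>\<^bsub>V\<^esub>"
  shows "q ^ Suc (\<Sum>i\<in>rsupp v. kv i) \<le> rrank v"
  using assms
proof (induction "card (rsupp v)" arbitrary: v rule: less_induct)
  case less
  interpret fl: rank_setup K V F W "flip \<sigma>" n by (rule rank_setup_flip)
  have v: "v \<in> carrier V" using less \<Gamma>_mem by auto
  define I where "I = rsupp v"
  have I: "I \<subseteq> {..<t}" unfolding I_def by (rule rsupp_subset)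
  let ?J = "{..<t} - I"
  let ?s = "\<Sum>i\<in>I. kv i" and ?d = "\<Sum>i\<in>I. nv i - kv i"
  show ?case unfolding I_def[symmetric]
  proof (rule ccontr)
    assume "\<not> q ^ Suc ?s \<le> rrank v"
    hence low: "rrank v \<le> q ^ ?s" using fl.lrank_le_iff[OF v, of ?s] by (simp only: not_le)
    \<comment> \<open>Rank-nullity on \<open>dW I\<close>, of dimension \<open>?s + ?d\<close>: a
      rank of at most \<open>?s\<close> leaves a kernel of dimension at least
      \<open>?d\<close>.\<close>
    let ?A = "{x \<in> dW I. \<sigma> x v = \<zero>\<^bsub>K\<^esub>}"
    have As: "subsp F ?A" by (rule fl.subsp_kernel[OF v subsp_dW])
    have "q ^ ?s * q ^ ?d = card (dW I)" unfolding card_dW[OF I] sum_split(2)[OF I] power_add ..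
    also have "\<dots> = card ((\<lambda>x. \<sigma> x v) ` dW I) * card ?A"
      by (rule fl.lrank_mult_kernel[OF v subsp_dW subspD(1)[OF subsp_dW]])
    also have "\<dots> \<le> q ^ ?s * card ?A"
    proof (rule mult_le_mono1)
      have "card ((\<lambda>x. \<sigma> x v) ` dW I) \<le> rrank v"
        by (rule card_mono) (use dW_subset subspD(5)[OF W] in auto)
      thus "card ((\<lambda>x. \<sigma> x v) ` dW I) \<le> q ^ ?s" using low by simp
    qed
    finally have "q ^ ?d \<le> card ?A" using q_gt_1 by simp
    then obtain A where A: "subsp F A" "A \<subseteq> ?A" "card A = q ^ ?d" using subsp_of_card[OF F As] by blast
    have AW: "A \<subseteq> W" using A dW_subset by blast
    have AV: "A \<subseteq> carrier V" using subspD(1)[OF A(1)] .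
    have sA: "subsp (carrier K) (span A)" by (rule subsp_span[OF AV])
    \<comment> \<open>\<open>?E\<close> consists of the vectors of \<open>dV I\<close> orthogonal to
      \<open>v\<close>. As \<open>v\<close> is outside the sum of the components not in
      \<open>I\<close>, it has one dimension less than \<open>dV I\<close>. The dimensions of
      \<open>span A\<close> and \<open>d\<Gamma> I\<close> add up to at least that of
      \<open>dV I\<close>, so this single dimension makes them intersect.\<close>
    let ?T = "P ?J ` carrier V <+>\<^bsub>V\<^esub> line (carrier K) v"
    let ?E = "perp \<sigma> (carrier V) ?T"
    have L: "subsp (carrier K) (line (carrier K) v)" by (rule subsp_line[OF subfield_carrier v])
    have T: "subsp (carrier K) ?T" by (rule subsp_set_add[OF subsp_P_V L]) simp
    have E: "subsp (carrier K) ?E" by (rule subsp_perp_V[OF subspD(1)[OF T]])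
    have vJ: "v \<notin> P ?J ` carrier V"
    proof
      assume "v \<in> P ?J ` carrier V"
      then obtain x where x: "x \<in> carrier V" "v = P ?J x" by auto
      have "v = P I v" using P_rsupp[OF v I] I_def by simp
      also have "\<dots> = P (I \<inter> ?J) x" unfolding x(2) by (rule P_Int[OF I _ x(1)]) auto
      also have "I \<inter> ?J = {}" by auto
      finally show False using less(3) x by simp
    qed
    have "card ?E * (Q ^ (\<Sum>i\<in>?J. nv i) * Q) = Q ^ n"
      using card_perp_V[OF T] card_add_line[OF subfield_carrier subsp_P_V v vJ] card_P_V[of ?J] by auto
    also have "\<dots> = Q ^ (\<Sum>i\<in>I. nv i) * Q ^ (\<Sum>i\<in>?J. nv i)"
      unfolding sum_split(1)[OF I] power_add ..
    finally have "card ?E * Q = Q ^ (\<Sum>i\<in>I. nv i)" using Q_gt_1 by (simp add: mult_ac)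
    moreover have "0 < card ?E" by (rule card_subsp_pos[OF E])
    hence "card ?E < card ?E * Q" using Q_gt_1 by simp
    ultimately have "card ?E < Q ^ (\<Sum>i\<in>I. nv i)" by (simp only:)
    also have "\<dots> = Q ^ ?d * Q ^ ?s" unfolding sum_split(2)[OF I] power_add by simp
    also have "\<dots> \<le> card (span A) * card (d\<Gamma> I)"
      unfolding card_span[OF A(1) AW A(3)] using card_d\<Gamma>[OF I] by simp
    finally have "card ?E < card (span A) * card (d\<Gamma> I)" .
    moreover have inE: "x \<in> ?E" if x: "x \<in> dV I" "\<sigma> x v = \<zero>\<^bsub>K\<^esub>" for x
    proof -
      have xV: "x \<in> carrier V" using x by (auto simp: dV_def perp_def)
      have "\<sigma> x y = \<zero>\<^bsub>K\<^esub>" if y: "y \<in> ?T" for y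
      proof -
        obtain z c where z: "z \<in> carrier V" "c \<in> carrier K" "y = P ?J z \<oplus>\<^bsub>V\<^esub> c \<odot>\<^bsub>V\<^esub> v"
          using y unfolding line_def M.set_add_mem by blast
        have "\<sigma> x (P ?J z) = \<zero>\<^bsub>K\<^esub>" using x(1) z by (auto simp: dV_def perp_def)
        thus ?thesis using z xV v x(2) by simp
      qed
      thus ?thesis using xV by (simp add: perp_def)
    qed
    have "span A \<subseteq> ?E"
      by (rule span_minimal[OF _ E]) (use A(2) inE dW_subset_dV in blast)
    moreover have "d\<Gamma> I \<subseteq> ?E" using inE less(2) by (auto simp: d\<Gamma>_def perp_def)
    ultimately obtain u where u: "u \<in> span A" "u \<in> d\<Gamma> I" "u \<noteq> \<zero>\<^bsub>V\<^esub>"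
      using exists_common_nonzero[OF subfield_carrier sA subsp_d\<Gamma> E] by blast
    have uV: "u \<in> carrier V" using u subsp_mem[OF sA] by blast
    have up: "u \<in> perp \<sigma> (carrier V) \<Gamma>" using u by (auto simp: d\<Gamma>_def)
    define I' where "I' = lsupp u"
    have I't: "I' \<subseteq> {..<t}" unfolding I'_def by (rule lsupp_subset)
    have I'I: "I' \<subseteq> I" unfolding I'_def by (rule lsupp_dV[OF _ I]) (use u in \<open>auto simp: d\<Gamma>_def\<close>)
    have ru: "q ^ Suc (\<Sum>i\<in>I'. nv i - kv i) \<le> lrank u"
      unfolding I'_def by (rule lrank_lower_bound[OF up u(3)])
    \<comment> \<open>With support \<open>I\<close> the rank of \<open>u\<close> would be at least
      \<open>?d + 1\<close>, but \<open>u\<close> lies in the span of \<open>A\<close>, of dimension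
      \<open>?d\<close> over F.\<close>
    have ne: "I' \<noteq> I"
    proof
      assume "I' = I"
      hence "q ^ Suc ?d \<le> q ^ ?d" using order_trans[OF ru lrank_le_card[OF A(1) AW u(1)]] A(3) by (simp only:)
      thus False unfolding power_increasing_iff[OF q_gt_1] by simp
    qed
    \<comment> \<open>Cutting \<open>v\<close> down to the support of \<open>u\<close> keeps it in
      \<Gamma> and makes its support equal to \<open>I'\<close>, a proper subset of
      \<open>I\<close>, so that the induction hypothesis applies.\<close>
    let ?v = "P I' v"
    have v': "?v \<in> \<Gamma>" "?v \<in> carrier V" using less(2) v by auto
    have rs: "rsupp ?v = I'" using rsupp_P[OF v I't] I'I I_def by auto
    have nz: "?v \<noteq> \<zero>\<^bsub>V\<^esub>"
    proof
      assume "?v = \<zero>\<^bsub>V\<^esub>"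
      moreover have "P {i} \<zero>\<^bsub>V\<^esub> = \<zero>\<^bsub>V\<^esub>" for i using P_smult[of "\<zero>\<^bsub>K\<^esub>" "\<zero>\<^bsub>V\<^esub>" "{i}"] by simp
      ultimately have "rsupp ?v = {}" by (simp add: rsupp_def)
      thus False using rs lsupp_empty[OF uV] u(3) I'_def by simp
    qed
    have "card (rsupp ?v) < card (rsupp v)"
      unfolding rs I_def[symmetric] by (rule psubset_card_mono) (use I I'I ne finite_subset in auto)
    hence IH: "q ^ Suc (\<Sum>i\<in>I'. kv i) \<le> rrank ?v" using less(1)[OF _ v'(1) nz] rs by simp
    \<comment> \<open>\<open>v\<close> lies in the span of \<open>?B\<close>, and \<sigma> u
      vanishes on \<open>?B\<close> because \<open>u\<close> is a combination of vectors of
      \<open>W\<close> orthogonal to \<open>v\<close>. As \<sigma> u sees only the components in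
      \<open>I'\<close>, it also vanishes on the projection of \<open>?B\<close> by
      \<open>P I'\<close>, whose size bounds \<open>rrank ?v\<close>.\<close>
    let ?B = "perp (flip \<sigma>) W {x \<in> W. \<sigma> x v = \<zero>\<^bsub>K\<^esub>}"
    have B: "subsp F ?B" by (rule subsp_rperp_W) auto
    have uB: "\<sigma> u b = \<zero>\<^bsub>K\<^esub>" if b: "b \<in> ?B" for b
    proof -
      have bV: "b \<in> carrier V" using b by (auto simp: perp_def)
      have "span A \<subseteq> perp \<sigma> (carrier V) {b}"
        by (rule span_minimal[OF _ subsp_perp_V]) (use A(2) AW bV b in \<open>auto simp: perp_def\<close>)
      thus ?thesis using u(1) by (auto simp: perp_def)
    qed
    have "?v \<in> P I' ` span ?B" using mem_span_rperp_kernel[OF v] by (rule imageI)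
    hence "?v \<in> span (P I' ` ?B)" unfolding image_P_span[OF B] .
    moreover have "P I' ` ?B \<subseteq> W" by (auto simp: perp_def)
    ultimately have "rrank ?v \<le> card (P I' ` ?B)"
      by (intro rrank_le_card[OF subsp_P[OF B subfieldD(1)[OF F]]])
    also have "\<dots> \<le> card {y \<in> P I' ` W. \<sigma> u y = \<zero>\<^bsub>K\<^esub>}"
    proof (rule card_mono)
      show "finite {y \<in> P I' ` W. \<sigma> u y = \<zero>\<^bsub>K\<^esub>}" using subspD(5)[OF W] by simp
      show "P I' ` ?B \<subseteq> {y \<in> P I' ` W. \<sigma> u y = \<zero>\<^bsub>K\<^esub>}"
      proof
        fix z assume "z \<in> P I' ` ?B"
        then obtain b where b: "b \<in> ?B" "z = P I' b" by auto
        have bW: "b \<in> W" using b by (auto simp: perp_def)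
        have "\<sigma> u z = \<sigma> u b" unfolding b(2) by (rule form_P_lsupp[OF uV I't]) (use bW I'_def in auto)
        thus "z \<in> {y \<in> P I' ` W. \<sigma> u y = \<zero>\<^bsub>K\<^esub>}" using uB[OF b(1)] bW b(2) by auto
      qed
    qed
    finally have rv: "rrank ?v \<le> card {y \<in> P I' ` W. \<sigma> u y = \<zero>\<^bsub>K\<^esub>}" .
    have "\<sigma> u (P I' y) = \<sigma> u y" if "y \<in> W" for y
      by (rule form_P_lsupp[OF uV I't]) (use that I'_def in auto)
    hence im: "\<sigma> u ` P I' ` W = \<sigma> u ` W" by (simp add: image_image)
    \<comment> \<open>Rank plus nullity of \<sigma> u on the \<open>I'\<close>-part of
      \<open>W\<close> is the sum of the n_i over \<open>I'\<close>; the two lower bounds add up to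
      two more than that.\<close>
    have "q ^ Suc (\<Sum>i\<in>I'. nv i - kv i) * q ^ Suc (\<Sum>i\<in>I'. kv i) \<le> lrank u * rrank ?v"
      by (rule mult_le_mono[OF ru IH])
    also have "\<dots> \<le> lrank u * card {y \<in> P I' ` W. \<sigma> u y = \<zero>\<^bsub>K\<^esub>}" using rv by simp
    also have "\<dots> = card (P I' ` W)"
      using lrank_mult_kernel[OF uV subsp_P_W subspD(1)[OF subsp_P_W], of I'] im by simp
    also have "\<dots> = q ^ ((\<Sum>i\<in>I'. kv i) + (\<Sum>i\<in>I'. nv i - kv i))"
      unfolding card_P_W[OF I't] sum_split(2)[OF I't] ..
    finally have "q ^ (Suc (\<Sum>i\<in>I'. nv i - kv i) + Suc (\<Sum>i\<in>I'. kv i)) \<le> q ^ ((\<Sum>i\<in>I'. kv i) + (\<Sum>i\<in>I'. nv i - kv i))"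
      by (simp only: power_add)
    thus False unfolding power_increasing_iff[OF q_gt_1] by simp
  qed
qed

text \<open>For \<open>w\<close> in \<open>W\<close> the image of \<sigma> w lies in F, so its rank
  is at most 1, whereas for nonzero \<open>w\<close> the lower bound is at least 2 because n_i >
  k_i. Hence \<open>W\<close> embeds into the quotient by \<open>\<Gamma>\<^sup>\<bottom>\<close>,
  and the dual has F-dimension n.\<close>

lemma W_Int_perp_\<Gamma>: "W \<inter> perp \<sigma> (carrier V) \<Gamma> = {\<zero>\<^bsub>V\<^esub>}"
proof -
  have "w = \<zero>\<^bsub>V\<^esub>" if w: "w \<in> W" "w \<in> perp \<sigma> (carrier V) \<Gamma>" for w
  proof (rule ccontr)
    assume nz: "w \<noteq> \<zero>\<^bsub>V\<^esub>"
    then obtain i where i: "i \<in> lsupp w" using lsupp_empty[of w] w by auto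
    have fin: "finite (lsupp w)" using finite_subset[OF lsupp_subset] by simp
    have "0 < nv i - kv i" using i kv_less[of i] by (auto simp: lsupp_def)
    also have "\<dots> \<le> (\<Sum>i\<in>lsupp w. nv i - kv i)" by (rule member_le_sum[OF i _ fin]) simp
    finally have "q ^ 1 < q ^ Suc (\<Sum>i\<in>lsupp w. nv i - kv i)"
      unfolding power_strict_increasing_iff[OF q_gt_1] by simp
    also have "\<dots> \<le> lrank w" by (rule lrank_lower_bound[OF w(2) nz])
    also have "\<dots> \<le> q"
      by (rule card_mono[OF subfieldD(5)[OF F]]) (use pairingD(3)[OF pairing_W w(1)] in auto)
    finally show False by simp
  qed
  moreover have "\<zero>\<^bsub>V\<^esub> \<in> perp \<sigma> (carrier V) \<Gamma>" using \<Gamma>_mem by (simp add: perp_def)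
  ultimately show ?thesis using subspD(2)[OF W] by blast
qed

end

section \<open>Quotients and direct sums\<close>

context finite_space
begin

lemma finsum_mem:
  assumes "subsp C S" "\<And>i. i \<in> A \<Longrightarrow> f i \<in> S" "finite A"
  shows "(\<Oplus>\<^bsub>V\<^esub>i\<in>A. f i) \<in> S"
  using assms(3,2)
proof (induction rule: finite_induct)
  case empty show ?case using subspD(2)[OF assms(1)] by simp
next
  case (insert i A)
  have "f i \<in> carrier V" "f \<in> A \<rightarrow> carrier V" using insert subsp_mem[OF assms(1)] by auto
  thus ?case using insert subspD(3)[OF assms(1)] by (simp add: M.finsum_insert)
qed

lemma finsum_hom:
  assumes H: "abelian_group H" and A: "finite A" and f: "\<And>i. i \<in> A \<Longrightarrow> f i \<in> carrier V"
    and cl: "\<And>x. x \<in> carrier V \<Longrightarrow> h x \<in> carrier H"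
    and add: "\<And>x y. \<lbrakk>x \<in> carrier V; y \<in> carrier V\<rbrakk> \<Longrightarrow> h (x \<oplus>\<^bsub>V\<^esub> y) = h x \<oplus>\<^bsub>H\<^esub> h y"
  shows "h (\<Oplus>\<^bsub>V\<^esub>i\<in>A. f i) = (\<Oplus>\<^bsub>H\<^esub>i\<in>A. h (f i))"
proof -
  interpret H: abelian_group H by fact
  show ?thesis using A f
  proof (induction rule: finite_induct)
    case empty
    have "h \<zero>\<^bsub>V\<^esub> \<oplus>\<^bsub>H\<^esub> h \<zero>\<^bsub>V\<^esub> = h \<zero>\<^bsub>V\<^esub>" using add[of "\<zero>\<^bsub>V\<^esub>" "\<zero>\<^bsub>V\<^esub>"] by simp
    thus ?case using cl[of "\<zero>\<^bsub>V\<^esub>"] by (simp add: H.add.l_cancel_one')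
  next
    case (insert i A)
    have f: "f i \<in> carrier V" "f \<in> A \<rightarrow> carrier V" using insert by auto
    moreover have "(\<lambda>i. h (f i)) \<in> A \<rightarrow> carrier H" using f cl by auto
    moreover have "(\<Oplus>\<^bsub>V\<^esub>i\<in>A. f i) \<in> carrier V" using f by simp
    ultimately show ?case using insert cl add by (simp add: M.finsum_insert H.finsum_insert)
  qed
qed

lemma subsp_sums:
  fixes t :: nat
  assumes C: "C \<subseteq> carrier K" and N: "\<And>i. i < t \<Longrightarrow> subsp C (N i)"
  shows "subsp C ((\<lambda>x. \<Oplus>\<^bsub>V\<^esub>i\<in>{..<t}. x i) ` (\<Pi>\<^sub>E i\<in>{..<t}. N i))" (is "subsp C ?S")
proof -
  have NV: "x i \<in> carrier V" if "x \<in> (\<Pi>\<^sub>E i\<in>{..<t}. N i)" "i < t" for x i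
    using that subsp_mem[OF N] by auto
  have memI: "(\<Oplus>\<^bsub>V\<^esub>i\<in>{..<t}. x i) \<in> ?S" if "\<And>i. i < t \<Longrightarrow> x i \<in> N i" for x
  proof (rule image_eqI)
    show "(\<Oplus>\<^bsub>V\<^esub>i\<in>{..<t}. x i) = (\<Oplus>\<^bsub>V\<^esub>i\<in>{..<t}. restrict x {..<t} i)"
      by (rule M.finsum_cong') (use that subsp_mem[OF N] in auto)
  qed (use that in \<open>auto split: if_splits\<close>)
  show ?thesis
  proof (rule subspI)
    show "?S \<subseteq> carrier V" using NV by (auto intro!: M.finsum_closed)
    have "(\<Oplus>\<^bsub>V\<^esub>i\<in>{..<t}. \<zero>\<^bsub>V\<^esub>) \<in> ?S" by (rule memI) (use subspD(2)[OF N] in auto)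
    thus "\<zero>\<^bsub>V\<^esub> \<in> ?S" by simp
  next
    fix a b assume "a \<in> ?S" "b \<in> ?S"
    then obtain x y where x: "x \<in> (\<Pi>\<^sub>E i\<in>{..<t}. N i)" "a = (\<Oplus>\<^bsub>V\<^esub>i\<in>{..<t}. x i)"
      and y: "y \<in> (\<Pi>\<^sub>E i\<in>{..<t}. N i)" "b = (\<Oplus>\<^bsub>V\<^esub>i\<in>{..<t}. y i)" by auto
    have "a \<oplus>\<^bsub>V\<^esub> b = (\<Oplus>\<^bsub>V\<^esub>i\<in>{..<t}. x i \<oplus>\<^bsub>V\<^esub> y i)"
      unfolding x(2) y(2) by (rule M.finsum_addf[symmetric]) (use NV x y in auto)
    also have "\<dots> \<in> ?S" 
      by (rule memI, rule subspD(3)[OF N PiE_mem[OF x(1)] PiE_mem[OF y(1)]]) auto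
    finally show "a \<oplus>\<^bsub>V\<^esub> b \<in> ?S" .
  next
    fix c a assume c: "c \<in> C" and "a \<in> ?S"
    then obtain x where x: "x \<in> (\<Pi>\<^sub>E i\<in>{..<t}. N i)" "a = (\<Oplus>\<^bsub>V\<^esub>i\<in>{..<t}. x i)" by auto
    have "c \<odot>\<^bsub>V\<^esub> a = (\<Oplus>\<^bsub>V\<^esub>i\<in>{..<t}. c \<odot>\<^bsub>V\<^esub> x i)"
      unfolding x(2) by (rule finsum_hom[OF M.abelian_group_axioms])
        (use NV x c C in \<open>auto simp: smult_r_distr subset_iff\<close>)
    also have "\<dots> \<in> ?S" 
      by (rule memI, rule subspD(4)[OF N c PiE_mem[OF x(1)]]) auto
    finally show "c \<odot>\<^bsub>V\<^esub> a \<in> ?S" .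
  qed
qed

lemma finsum_single:
  fixes t :: nat
  assumes "i < t" "x \<in> carrier V"
  shows "(\<Oplus>\<^bsub>V\<^esub>j\<in>{..<t}. if j = i then x else \<zero>\<^bsub>V\<^esub>) = x"
proof -
  have "(\<Oplus>\<^bsub>V\<^esub>j\<in>{..<t}. if i = j then (\<lambda>_. x) j else \<zero>\<^bsub>V\<^esub>) = (\<lambda>_. x) i"
    by (rule M.add.finprod_singleton) (use assms in auto)
  thus ?thesis by (simp add: eq_commute)
qed

lemma single_mem_sums:
  fixes t :: nat
  assumes N: "\<And>i. i < t \<Longrightarrow> subsp C (N i)" and i: "i < t" and x: "x \<in> N i"
  shows "x \<in> (\<lambda>x. \<Oplus>\<^bsub>V\<^esub>i\<in>{..<t}. x i) ` (\<Pi>\<^sub>E i\<in>{..<t}. N i)"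
proof (rule image_eqI)
  have xV: "x \<in> carrier V" using subsp_mem[OF N[OF i] x] .
  have "x = (\<Oplus>\<^bsub>V\<^esub>j\<in>{..<t}. if j = i then x else \<zero>\<^bsub>V\<^esub>)" using finsum_single[OF i xV] by simp
  also have "\<dots> = (\<Oplus>\<^bsub>V\<^esub>j\<in>{..<t}. restrict (\<lambda>j. if j = i then x else \<zero>\<^bsub>V\<^esub>) {..<t} j)"
    by (rule M.finsum_cong') (use xV in auto)
  finally show "x = (\<Oplus>\<^bsub>V\<^esub>j\<in>{..<t}. restrict (\<lambda>j. if j = i then x else \<zero>\<^bsub>V\<^esub>) {..<t} j)" .
  show "restrict (\<lambda>j. if j = i then x else \<zero>\<^bsub>V\<^esub>) {..<t} \<in> (\<Pi>\<^sub>E i\<in>{..<t}. N i)"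
    using x subspD(2)[OF N] by auto
qed

lemma card_PiE_power:
  fixes N :: "nat \<Rightarrow> 'b set"
  assumes "\<And>i. i < t \<Longrightarrow> card (N i) = c ^ d i"
  shows "card (\<Pi>\<^sub>E i\<in>{..<t}. N i) = c ^ (\<Sum>i<t. d i)"
  using assms by (simp add: card_PiE power_sum)

text \<open>A map from a finite set onto a set of the same size is injective; every direct sum below
  is established by such a count.\<close>

lemma internal_direct_sumI:
  assumes fin: "\<And>i. i < t \<Longrightarrow> finite (N i)"
    and im: "(\<lambda>x. \<Oplus>\<^bsub>V\<^esub>i\<in>{..<t}. x i) ` (\<Pi>\<^sub>E i\<in>{..<t}. N i) = S"
    and card: "card (\<Pi>\<^sub>E i\<in>{..<t}. N i) = card S"
  shows "internal_direct_sum V t N S"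
proof -
  have "finite (\<Pi>\<^sub>E i\<in>{..<t}. N i)" using fin by (auto intro: finite_PiE)
  hence "inj_on (\<lambda>x. \<Oplus>\<^bsub>V\<^esub>i\<in>{..<t}. x i) (\<Pi>\<^sub>E i\<in>{..<t}. N i)"
    by (rule eq_card_imp_inj_on) (use im card in simp)
  thus ?thesis unfolding internal_direct_sum_def bij_betw_def using im by simp
qed

end

section \<open>The projection onto a quotient space\<close>

locale quotient_space = finite_space K V for K :: "'a ring" and V :: "('a, 'c) module" +
  fixes S :: "'c set"
  assumes S: "subsp (carrier K) S"
begin

abbreviation (input) "VS \<equiv> quot_space V S"

definition proj :: "'c \<Rightarrow> 'c set" where "proj x = S +>\<^bsub>V\<^esub> x"

lemma abelian_subgroup_S: "abelian_subgroup S V"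
  by (rule abelian_subgroupI3[OF subsp_additive_subgroup[OF subfield_carrier S] M.abelian_group_axioms])

lemma mem_proj: "y \<in> proj x \<longleftrightarrow> (\<exists>s\<in>S. y = s \<oplus>\<^bsub>V\<^esub> x)"
  by (auto simp: proj_def a_r_coset_def r_coset_def)

lemma carrier_VS: "carrier VS = proj ` carrier V"
  by (auto simp: proj_def quot_space_def a_r_coset_def A_RCOSETS_def RCOSETS_def)

lemma zero_VS: "\<zero>\<^bsub>VS\<^esub> = S" by (simp add: quot_space_def)

lemma proj_add:
  "\<lbrakk>x \<in> carrier V; y \<in> carrier V\<rbrakk> \<Longrightarrow> proj (x \<oplus>\<^bsub>V\<^esub> y) = proj x \<oplus>\<^bsub>VS\<^esub> proj y"
  by (simp add: proj_def quot_space_def abelian_subgroup.a_rcos_sum[OF abelian_subgroup_S])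

lemma proj_smult:
  assumes c: "c \<in> carrier K" and x: "x \<in> carrier V"
  shows "proj (c \<odot>\<^bsub>V\<^esub> x) = c \<odot>\<^bsub>VS\<^esub> proj x"
proof -
  have e: "s \<oplus>\<^bsub>V\<^esub> c \<odot>\<^bsub>V\<^esub> (s' \<oplus>\<^bsub>V\<^esub> x) = (s \<oplus>\<^bsub>V\<^esub> c \<odot>\<^bsub>V\<^esub> s') \<oplus>\<^bsub>V\<^esub> c \<odot>\<^bsub>V\<^esub> x"
    if "s \<in> S" "s' \<in> S" for s s'
    using that c x subsp_mem[OF S] by (simp add: smult_r_distr M.a_assoc)
  have m: "y \<in> c \<odot>\<^bsub>VS\<^esub> proj x \<longleftrightarrow> (\<exists>s\<in>S. \<exists>s'\<in>S. y = s \<oplus>\<^bsub>V\<^esub> c \<odot>\<^bsub>V\<^esub> (s' \<oplus>\<^bsub>V\<^esub> x))" for y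
  proof -
    have "y \<in> c \<odot>\<^bsub>VS\<^esub> proj x \<longleftrightarrow> (\<exists>s\<in>S. \<exists>z\<in>proj x. y = s \<oplus>\<^bsub>V\<^esub> c \<odot>\<^bsub>V\<^esub> z)"
      by (auto simp: quot_space_def M.set_add_mem)
    also have "\<dots> \<longleftrightarrow> (\<exists>s\<in>S. \<exists>s'\<in>S. y = s \<oplus>\<^bsub>V\<^esub> c \<odot>\<^bsub>V\<^esub> (s' \<oplus>\<^bsub>V\<^esub> x))"
      unfolding Bex_def mem_proj by blast
    finally show ?thesis .
  qed
  have "y \<in> c \<odot>\<^bsub>VS\<^esub> proj x \<longleftrightarrow> (\<exists>s\<in>S. y = s \<oplus>\<^bsub>V\<^esub> c \<odot>\<^bsub>V\<^esub> x)" for y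
  proof
    assume "y \<in> c \<odot>\<^bsub>VS\<^esub> proj x"
    then obtain s s' where s: "s \<in> S" "s' \<in> S" "y = (s \<oplus>\<^bsub>V\<^esub> c \<odot>\<^bsub>V\<^esub> s') \<oplus>\<^bsub>V\<^esub> c \<odot>\<^bsub>V\<^esub> x"
      unfolding m using e by blast
    thus "\<exists>s\<in>S. y = s \<oplus>\<^bsub>V\<^esub> c \<odot>\<^bsub>V\<^esub> x" using subspD(3,4)[OF S] c by blast
  next
    assume "\<exists>s\<in>S. y = s \<oplus>\<^bsub>V\<^esub> c \<odot>\<^bsub>V\<^esub> x"
    then obtain s where s: "s \<in> S" "y = s \<oplus>\<^bsub>V\<^esub> c \<odot>\<^bsub>V\<^esub> (\<zero>\<^bsub>V\<^esub> \<oplus>\<^bsub>V\<^esub> x)" using x by auto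
    thus "y \<in> c \<odot>\<^bsub>VS\<^esub> proj x" unfolding m using subspD(2)[OF S] by blast
  qed
  thus ?thesis by (intro Set.set_eqI) (simp only: mem_proj)
qed

lemma proj_eq_zero_iff: "x \<in> carrier V \<Longrightarrow> proj x = \<zero>\<^bsub>VS\<^esub> \<longleftrightarrow> x \<in> S"
proof
  assume x: "x \<in> carrier V"
  { assume "proj x = \<zero>\<^bsub>VS\<^esub>"
    moreover have "x \<in> proj x" unfolding mem_proj using subspD(2)[OF S] x by (metis M.l_zero)
    ultimately show "x \<in> S" by (simp add: zero_VS) }
  { assume "x \<in> S"
    thus "proj x = \<zero>\<^bsub>VS\<^esub>" unfolding zero_VS proj_def
      by (intro M.a_coset_join2[OF x]) (rule additive_subgroup.a_subgroup[OF subsp_additive_subgroup[OF subfield_carrier S]]) }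
qed

lemma finite_space_VS: "finite_space K VS"
proof -
  interpret VS: vectorspace K VS
    by (rule quot_space_vectorspace[OF vectorspace_axioms]) (use S subspace_iff_subsp_carrier in simp)
  show ?thesis
    by unfold_locales (use finite_K finite_V carrier_VS in auto)
qed

sublocale VS: finite_space K "quot_space V S"
  by (rule finite_space_VS)

lemma proj_closed [simp]: "x \<in> carrier V \<Longrightarrow> proj x \<in> carrier VS"
  by (simp add: carrier_VS)

lemma proj_eq_iff:
  assumes "x \<in> carrier V" "y \<in> carrier V"
  shows "proj x = proj y \<longleftrightarrow> x \<ominus>\<^bsub>V\<^esub> y \<in> S"
proof -
  have "proj x = proj (x \<ominus>\<^bsub>V\<^esub> y) \<oplus>\<^bsub>VS\<^esub> proj y"
    using proj_add[of "x \<ominus>\<^bsub>V\<^esub> y" y] M.minus_add_cancel[of x y] assms by simp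
  hence "proj x = proj y \<longleftrightarrow> proj (x \<ominus>\<^bsub>V\<^esub> y) = \<zero>\<^bsub>VS\<^esub>"
    using assms VS.M.add.r_cancel_one[of "proj y" "proj (x \<ominus>\<^bsub>V\<^esub> y)"] by simp
  thus ?thesis using proj_eq_zero_iff[of "x \<ominus>\<^bsub>V\<^esub> y"] assms by simp
qed

lemma quot_image_eq: "X \<subseteq> carrier V \<Longrightarrow> quot_image V S X = proj ` X"
proof
  assume X: "X \<subseteq> carrier V"
  show "proj ` X \<subseteq> quot_image V S X"
    unfolding quot_image_def proj_def using subset_set_add1[OF X S] by auto
  show "quot_image V S X \<subseteq> proj ` X"
  proof
    fix z assume "z \<in> quot_image V S X"
    then obtain y where "y \<in> X <+>\<^bsub>V\<^esub> S" "z = proj y" unfolding quot_image_def proj_def by blast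
    then obtain x s where x: "x \<in> X" "s \<in> S" "z = proj (x \<oplus>\<^bsub>V\<^esub> s)"
      unfolding M.set_add_mem by blast
    have "x \<in> carrier V" "s \<in> carrier V" using x X subsp_mem[OF S] by auto
    hence "z = proj x" using x proj_add[of x s] proj_eq_zero_iff[of s] by simp
    thus "z \<in> proj ` X" using x by simp
  qed
qed

lemma subsp_proj:
  assumes X: "subsp C X" and C: "C \<subseteq> carrier K"
  shows "VS.subsp C (proj ` X)"
proof (rule VS.subspI)
  show "proj ` X \<subseteq> carrier VS" using subsp_mem[OF X] by auto
  have "proj \<zero>\<^bsub>V\<^esub> = \<zero>\<^bsub>VS\<^esub>" using proj_eq_zero_iff subspD(2)[OF S] by simp
  thus "\<zero>\<^bsub>VS\<^esub> \<in> proj ` X" using subspD(2)[OF X] by (metis imageI)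
  show "x \<oplus>\<^bsub>VS\<^esub> y \<in> proj ` X" if xy: "x \<in> proj ` X" "y \<in> proj ` X" for x y
  proof -
    obtain a b where "a \<in> X" "b \<in> X" "x = proj a" "y = proj b" using xy by auto
    thus ?thesis using proj_add[of a b] subspD(3)[OF X] subsp_mem[OF X] by (metis imageI)
  qed
  show "c \<odot>\<^bsub>VS\<^esub> x \<in> proj ` X" if cx: "c \<in> C" "x \<in> proj ` X" for c x
  proof -
    obtain a where "a \<in> X" "x = proj a" using cx by auto
    thus ?thesis using proj_smult[of c a] subspD(4)[OF X] subsp_mem[OF X] C cx by (metis imageI subsetD)
  qed
qed

lemma card_proj:
  assumes C: "subfield C K" and X: "subsp C X"
  shows "card X = card (proj ` X) * card (X \<inter> S)"
proof -
  have "card X = card (proj ` X) * card {x \<in> X. proj x = \<zero>\<^bsub>VS\<^esub>}"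
    by (rule card_subsp_hom[OF C X VS.M.abelian_group_axioms]) (use subsp_mem[OF X] proj_add in auto)
  moreover have "{x \<in> X. proj x = \<zero>\<^bsub>VS\<^esub>} = X \<inter> S" using proj_eq_zero_iff subsp_mem[OF X] by auto
  ultimately show ?thesis by simp
qed

lemma proj_inj_on:
  assumes C: "subfield C K" and X: "subsp C X" and 0: "X \<inter> S = {\<zero>\<^bsub>V\<^esub>}"
  shows "inj_on proj X"
  by (rule eq_card_imp_inj_on[OF subspD(5)[OF X]]) (use card_proj[OF C X] 0 in simp)

definition preim :: "'c set set \<Rightarrow> 'c set" where
  "preim H = {x \<in> carrier V. proj x \<in> H}"

lemma subsp_preim:
  assumes H: "VS.subsp C H" and C: "C \<subseteq> carrier K"
  shows "subsp C (preim H)"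
proof (rule subspI)
  have "proj \<zero>\<^bsub>V\<^esub> = \<zero>\<^bsub>VS\<^esub>" using proj_eq_zero_iff subspD(2)[OF S] by simp
  thus "\<zero>\<^bsub>V\<^esub> \<in> preim H" using VS.subspD(2)[OF H] by (simp add: preim_def)
  show "x \<oplus>\<^bsub>V\<^esub> y \<in> preim H" if "x \<in> preim H" "y \<in> preim H" for x y
    using that VS.subspD(3)[OF H] by (simp add: preim_def proj_add)
  show "c \<odot>\<^bsub>V\<^esub> x \<in> preim H" if "c \<in> C" "x \<in> preim H" for c x
    using that VS.subspD(4)[OF H] C by (auto simp: preim_def proj_smult subset_iff)
qed (auto simp: preim_def)

lemma proj_preim: "H \<subseteq> carrier VS \<Longrightarrow> proj ` preim H = H"
  unfolding carrier_VS preim_def by auto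

lemma S_subset_preim: "VS.subsp C H \<Longrightarrow> S \<subseteq> preim H"
proof
  assume H: "VS.subsp C H"
  fix x assume x: "x \<in> S"
  hence "x \<in> carrier V" "proj x = \<zero>\<^bsub>VS\<^esub>" using proj_eq_zero_iff subsp_mem[OF S] by auto
  thus "x \<in> preim H" using VS.subspD(2)[OF H] by (simp add: preim_def)
qed

lemma card_preim:
  assumes "VS.subsp (carrier K) H"
  shows "card (preim H) = card H * card S"
  using card_proj[OF subfield_carrier subsp_preim[OF assms subset_refl]] proj_preim[OF VS.subspD(1)[OF assms]]
    S_subset_preim[OF assms] by (simp add: Int_absorb1)

lemma card_VS: "card (carrier V) = card (carrier VS) * card S"
  using card_proj[OF subfield_carrier subsp_carrier] subspD(1)[OF S] by (simp add: carrier_VS Int_absorb1)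

lemma span_proj:
  assumes X: "X \<subseteq> carrier V"
  shows "VS.span (proj ` X) = proj ` span X"
proof
  have pX: "proj ` X \<subseteq> carrier VS" using X by auto
  have "span X \<subseteq> preim (VS.span (proj ` X))"
    by (rule span_minimal[OF _ subsp_preim[OF VS.subsp_span[OF pX] subset_refl]])
      (use X VS.in_own_span[OF pX] in \<open>auto simp: preim_def\<close>)
  thus "proj ` span X \<subseteq> VS.span (proj ` X)" by (auto simp: preim_def)
  show "VS.span (proj ` X) \<subseteq> proj ` span X"
    by (rule VS.span_minimal[OF _ subsp_proj[OF subsp_span[OF X] subset_refl]]) (use in_own_span[OF X] in auto)
qed

lemma proj_finsum:
  assumes "finite A" "\<And>i. i \<in> A \<Longrightarrow> f i \<in> carrier V"
  shows "proj (\<Oplus>\<^bsub>V\<^esub>i\<in>A. f i) = (\<Oplus>\<^bsub>VS\<^esub>i\<in>A. proj (f i))"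
  by (rule finsum_hom[OF VS.M.abelian_group_axioms assms]) (auto simp: proj_add)

end

section \<open>Coordinates and projections of a direct sum\<close>

locale direct_sum_space = finite_space K V for K :: "'a ring" and V :: "('a, 'c) module" +
  fixes t :: nat and N :: "nat \<Rightarrow> 'c set"
  assumes N: "\<And>i. i < t \<Longrightarrow> subsp (carrier K) (N i)"
    and direct: "internal_direct_sum V t N (carrier V)"
begin

definition coord :: "'c \<Rightarrow> nat \<Rightarrow> 'c" where
  "coord = the_inv_into (\<Pi>\<^sub>E i\<in>{..<t}. N i) (\<lambda>x. \<Oplus>\<^bsub>V\<^esub>i\<in>{..<t}. x i)"

definition cproj :: "nat set \<Rightarrow> 'c \<Rightarrow> 'c" where
  "cproj I x = (\<Oplus>\<^bsub>V\<^esub>i\<in>{..<t}. if i \<in> I then coord x i else \<zero>\<^bsub>V\<^esub>)"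

lemma coord_mem: "x \<in> carrier V \<Longrightarrow> coord x \<in> (\<Pi>\<^sub>E i\<in>{..<t}. N i)"
  unfolding coord_def using direct unfolding internal_direct_sum_def bij_betw_def
  by (metis (no_types, lifting) subset_refl the_inv_into_into)

lemma coord_N: "\<lbrakk>x \<in> carrier V; i < t\<rbrakk> \<Longrightarrow> coord x i \<in> N i"
  using coord_mem by auto

lemma coord_closed [simp]: "\<lbrakk>x \<in> carrier V; i < t\<rbrakk> \<Longrightarrow> coord x i \<in> carrier V"
  using coord_N subsp_mem[OF N] by blast

lemma sum_coord: "x \<in> carrier V \<Longrightarrow> (\<Oplus>\<^bsub>V\<^esub>i\<in>{..<t}. coord x i) = x"
  unfolding coord_def using direct unfolding internal_direct_sum_def bij_betw_def
  using f_the_inv_into_f[of "\<lambda>x. \<Oplus>\<^bsub>V\<^esub>i\<in>{..<t}. x i" "\<Pi>\<^sub>E i\<in>{..<t}. N i" x] by simp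

lemma coord_unique:
  assumes z: "\<And>i. i < t \<Longrightarrow> z i \<in> N i" and x: "(\<Oplus>\<^bsub>V\<^esub>i\<in>{..<t}. z i) = x" and i: "i < t"
  shows "coord x i = z i"
proof -
  have "(\<Oplus>\<^bsub>V\<^esub>i\<in>{..<t}. restrict z {..<t} i) = (\<Oplus>\<^bsub>V\<^esub>i\<in>{..<t}. z i)"
    by (rule M.finsum_cong') (use z subsp_mem[OF N] in auto)
  hence "coord x = restrict z {..<t}"
    unfolding coord_def using direct unfolding internal_direct_sum_def bij_betw_def
    by (intro the_inv_into_f_eq) (use x z in \<open>auto simp del: restrict_apply\<close>)
  thus ?thesis using i by simp
qed

lemma coord_add:
  assumes "x \<in> carrier V" "y \<in> carrier V" "i < t"
  shows "coord (x \<oplus>\<^bsub>V\<^esub> y) i = coord x i \<oplus>\<^bsub>V\<^esub> coord y i"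
proof (rule coord_unique[OF _ _ assms(3)])
  show "(\<Oplus>\<^bsub>V\<^esub>i\<in>{..<t}. coord x i \<oplus>\<^bsub>V\<^esub> coord y i) = x \<oplus>\<^bsub>V\<^esub> y"
    using assms sum_coord by (subst M.finsum_addf) auto
qed (use assms coord_N subspD(3)[OF N] in auto)

lemma coord_smult:
  assumes "c \<in> carrier K" "x \<in> carrier V" "i < t"
  shows "coord (c \<odot>\<^bsub>V\<^esub> x) i = c \<odot>\<^bsub>V\<^esub> coord x i"
proof (rule coord_unique[OF _ _ assms(3)])
  have "c \<odot>\<^bsub>V\<^esub> (\<Oplus>\<^bsub>V\<^esub>i\<in>{..<t}. coord x i) = (\<Oplus>\<^bsub>V\<^esub>i\<in>{..<t}. c \<odot>\<^bsub>V\<^esub> coord x i)"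
    by (rule finsum_hom[OF M.abelian_group_axioms]) (use assms in \<open>auto simp: smult_r_distr\<close>)
  thus "(\<Oplus>\<^bsub>V\<^esub>i\<in>{..<t}. c \<odot>\<^bsub>V\<^esub> coord x i) = c \<odot>\<^bsub>V\<^esub> x" using sum_coord assms by simp
qed (use assms coord_N subspD(4)[OF N] in auto)

lemma cproj_closed [simp]: "x \<in> carrier V \<Longrightarrow> cproj I x \<in> carrier V"
  unfolding cproj_def by (rule M.finsum_closed) auto

lemma coord_cproj: "\<lbrakk>x \<in> carrier V; i < t\<rbrakk> \<Longrightarrow> coord (cproj I x) i = (if i \<in> I then coord x i else \<zero>\<^bsub>V\<^esub>)"
  by (rule coord_unique) (auto simp: cproj_def coord_N subspD(2)[OF N])

lemma cproj_add:
  assumes "x \<in> carrier V" "y \<in> carrier V"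
  shows "cproj I (x \<oplus>\<^bsub>V\<^esub> y) = cproj I x \<oplus>\<^bsub>V\<^esub> cproj I y"
proof -
  have "cproj I x \<oplus>\<^bsub>V\<^esub> cproj I y = (\<Oplus>\<^bsub>V\<^esub>i\<in>{..<t}. (if i \<in> I then coord x i else \<zero>\<^bsub>V\<^esub>) \<oplus>\<^bsub>V\<^esub> (if i \<in> I then coord y i else \<zero>\<^bsub>V\<^esub>))"
    unfolding cproj_def by (rule M.finsum_addf[symmetric]) (use assms in auto)
  also have "\<dots> = cproj I (x \<oplus>\<^bsub>V\<^esub> y)" unfolding cproj_def
    by (rule M.finsum_cong') (use assms in \<open>auto simp: coord_add\<close>)
  finally show ?thesis by simp
qed

lemma cproj_smult:
  assumes "c \<in> carrier K" "x \<in> carrier V"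
  shows "cproj I (c \<odot>\<^bsub>V\<^esub> x) = c \<odot>\<^bsub>V\<^esub> cproj I x"
proof -
  have "c \<odot>\<^bsub>V\<^esub> cproj I x = (\<Oplus>\<^bsub>V\<^esub>i\<in>{..<t}. c \<odot>\<^bsub>V\<^esub> (if i \<in> I then coord x i else \<zero>\<^bsub>V\<^esub>))"
    unfolding cproj_def
    by (rule finsum_hom[OF M.abelian_group_axioms]) (use assms in \<open>auto simp: smult_r_distr\<close>)
  also have "\<dots> = cproj I (c \<odot>\<^bsub>V\<^esub> x)" unfolding cproj_def
    by (rule M.finsum_cong') (use assms in \<open>auto simp: coord_smult\<close>)
  finally show ?thesis by simp
qed

lemma cproj_Int:
  assumes "x \<in> carrier V"
  shows "cproj I (cproj J x) = cproj (I \<inter> J) x"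
  unfolding cproj_def[of I] cproj_def[of "I \<inter> J"]
  by (rule M.finsum_cong') (use assms in \<open>auto simp: coord_cproj\<close>)

lemma cproj_Un:
  assumes "I \<inter> J = {}" "x \<in> carrier V"
  shows "cproj (I \<union> J) x = cproj I x \<oplus>\<^bsub>V\<^esub> cproj J x"
proof -
  have "cproj I x \<oplus>\<^bsub>V\<^esub> cproj J x = (\<Oplus>\<^bsub>V\<^esub>i\<in>{..<t}. (if i \<in> I then coord x i else \<zero>\<^bsub>V\<^esub>) \<oplus>\<^bsub>V\<^esub> (if i \<in> J then coord x i else \<zero>\<^bsub>V\<^esub>))"
    unfolding cproj_def by (rule M.finsum_addf[symmetric]) (use assms in auto)
  also have "\<dots> = cproj (I \<union> J) x" unfolding cproj_def
    by (rule M.finsum_cong') (use assms in auto)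
  finally show ?thesis by simp
qed

lemma cproj_all: "x \<in> carrier V \<Longrightarrow> cproj {..<t} x = x"
proof -
  assume x: "x \<in> carrier V"
  have "cproj {..<t} x = (\<Oplus>\<^bsub>V\<^esub>i\<in>{..<t}. coord x i)"
    unfolding cproj_def by (rule M.finsum_cong') (use x in auto)
  thus ?thesis using sum_coord[OF x] by simp
qed

lemma cproj_single: "\<lbrakk>x \<in> carrier V; i < t\<rbrakk> \<Longrightarrow> cproj {i} x = coord x i"
proof -
  assume x: "x \<in> carrier V" "i < t"
  have "cproj {i} x = (\<Oplus>\<^bsub>V\<^esub>j\<in>{..<t}. if j = i then coord x i else \<zero>\<^bsub>V\<^esub>)"
    unfolding cproj_def by (rule M.finsum_cong') (use x in auto)
  thus ?thesis using finsum_single[of i t "coord x i"] x by simp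
qed

context
  fixes C X Xs
  assumes X: "subsp C X" and Xs: "\<And>i. i < t \<Longrightarrow> Xs i \<subseteq> X \<inter> N i"
    and sum: "X \<subseteq> (\<lambda>x. \<Oplus>\<^bsub>V\<^esub>i\<in>{..<t}. x i) ` (\<Pi>\<^sub>E i\<in>{..<t}. Xs i)"
begin

text \<open>A decomposition of an element of \<open>X\<close> along \<open>Xs\<close> is also one
  along \<open>N\<close>, hence the one given by its coordinates. Applied to \<open>W\<close> and to
  \<Gamma>, this yields the invariance properties demanded of the projections
  \<open>P\<close>.\<close>

lemma coord_component: "\<lbrakk>x \<in> X; i < t\<rbrakk> \<Longrightarrow> coord x i \<in> Xs i"
proof -
  assume x: "x \<in> X" "i < t"
  obtain z where z: "z \<in> (\<Pi>\<^sub>E i\<in>{..<t}. Xs i)" "x = (\<Oplus>\<^bsub>V\<^esub>i\<in>{..<t}. z i)" using sum x(1) by auto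
  have "z i \<in> N i" if "i < t" for i using z(1) Xs[OF that] that by auto
  hence "coord x i = z i" by (rule coord_unique) (use z x in auto)
  thus ?thesis using z x by auto
qed

lemma cproj_invariant: "x \<in> X \<Longrightarrow> cproj I x \<in> X"
  unfolding cproj_def by (rule finsum_mem[OF X]) (use coord_component Xs subspD(2)[OF X] in auto)

lemma cproj_single_image:
  assumes i: "i < t" shows "cproj {i} ` X = Xs i"
proof
  show "cproj {i} ` X \<subseteq> Xs i" using coord_component cproj_single subsp_mem[OF X] i by auto
  show "Xs i \<subseteq> cproj {i} ` X"
  proof
    fix x assume x: "x \<in> Xs i"
    hence xX: "x \<in> X" "x \<in> N i" "x \<in> carrier V" using Xs[OF i] subsp_mem[OF X] by auto
    have "coord x i = (if i = i then x else \<zero>\<^bsub>V\<^esub>)"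
      by (rule coord_unique[where z = "\<lambda>j. if j = i then x else \<zero>\<^bsub>V\<^esub>", OF _ finsum_single i])
        (use xX i subspD(2)[OF N] in auto)
    hence "cproj {i} x = x" using cproj_single xX i by simp
    thus "x \<in> cproj {i} ` X" using xX by (metis imageI)
  qed
qed

end

end

section \<open>From scattered subspaces to rank bounds\<close>

lemma (in finite_space) hyperplane_iff:
  "hyperplane K V H \<longleftrightarrow> subsp (carrier K) H \<and> card H * card (carrier K) = card (carrier V)"
proof -
  have "sub_dim K V H + 1 = dim \<longleftrightarrow> card H * card (carrier K) = card (carrier V)"
    if "subsp (carrier K) H"
    unfolding card_eq_power_sub_dim_carrier[OF that] card_carrier_eq_power_dim
    using card_subfield_power_inject[OF subfield_carrier, of "sub_dim K V H + 1" dim] by (simp add: mult.commute)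
  thus ?thesis unfolding hyperplane_def subspace_iff_subsp_carrier by blast
qed

text \<open>The projections are those of the direct sum of the spans \<open>N i\<close> of the
  lifted components of the image of \<open>W\<close>; the rank bound for full support is the third
  scatteredness condition applied to the image of the kernel of \<sigma> u.\<close>

lemma (in rank_setup) scattered_decomposition_exists:
  assumes \<Gamma>: "subsp (carrier K) \<Gamma>" and \<Gamma>W: "W \<inter> \<Gamma> = {\<zero>\<^bsub>V\<^esub>}"
    and t: "0 < t" and n_sum: "n = (\<Sum>i<t. nv i)" and card_\<Gamma>: "card \<Gamma> = Q ^ (n - (\<Sum>i<t. kv i))"
    and scat: "scattered K F (quot_space V \<Gamma>) t kv nv (quot_image V \<Gamma> W)"
  shows "\<exists>P. scattered_decomposition K V F W \<sigma> n t P \<Gamma> nv kv"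
proof -
  interpret quotient_space K V \<Gamma> by unfold_locales (rule \<Gamma>)
  have FK: "F \<subseteq> carrier K" by (rule subfieldD(1)[OF F])
  have WV: "W \<subseteq> carrier V" by (rule subspD(1)[OF W])
  have U: "quot_image V \<Gamma> W = proj ` W" by (rule quot_image_eq[OF WV])
  obtain Us where dec: "decomposition K F VS t kv nv (proj ` W) Us"
    and comp: "\<And>i. i < t \<Longrightarrow> kv i < nv i"
    and hyp: "\<And>H. \<lbrakk>hyperplane K VS H; \<And>i. i < t \<Longrightarrow> \<not> VS.span (Us i) \<subseteq> H\<rbrakk> \<Longrightarrow>
      sub_dim (sub_scalars K F) VS (proj ` W \<inter> H) + 1 \<le> (\<Sum>i<t. kv i)"
    using scat unfolding scattered_def U by blast
  have ids: "internal_direct_sum VS t Us (proj ` W)"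
    using dec by (simp add: decomposition_def)
  have Us: "VS.subsp F (Us i)" if "i < t" for i
    using dec that VS.subspace_iff_subsp[OF F] by (simp add: decomposition_def)
  have card_Us: "card (Us i) = q ^ nv i" if "i < t" for i
    using dec that VS.card_eq_power_sub_dim[OF F Us[OF that]] by (simp add: decomposition_def)
  have card_span_Us: "card (VS.span (Us i)) = Q ^ kv i" if "i < t" for i
    using dec that VS.card_eq_power_sub_dim_carrier[OF VS.subsp_span[OF VS.subspD(1)[OF Us[OF that]]]]
    by (simp add: decomposition_def)
  have inj: "inj_on proj W" by (rule proj_inj_on[OF F W \<Gamma>W])
  have sums: "(\<lambda>x. \<Oplus>\<^bsub>VS\<^esub>i\<in>{..<t}. x i) ` (\<Pi>\<^sub>E i\<in>{..<t}. Us i) = proj ` W"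
    using ids by (simp add: internal_direct_sum_def bij_betw_def)
  have UsU: "Us i \<subseteq> proj ` W" if "i < t" for i
  proof
    fix x assume "x \<in> Us i"
    from VS.single_mem_sums[where N = Us and C = F, OF Us that this] show "x \<in> proj ` W" unfolding sums by blast
  qed

  \<comment> \<open>\<open>proj\<close> is injective on \<open>W\<close>, so each
    \<open>Us i\<close> has a unique lift inside \<open>W\<close>.\<close>
  define Wi where "Wi i = W \<inter> preim (Us i)" for i
  have Wi: "subsp F (Wi i)" if "i < t" for i
    unfolding Wi_def by (rule subsp_Int[OF W subsp_preim[OF Us[OF that] FK]])
  have WiW: "Wi i \<subseteq> W" for i by (auto simp: Wi_def)
  have proj_Wi: "proj ` Wi i = Us i" if i: "i < t" for i
  proof
    show "proj ` Wi i \<subseteq> Us i" by (auto simp: Wi_def preim_def)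
    show "Us i \<subseteq> proj ` Wi i"
    proof
      fix z assume z: "z \<in> Us i"
      then obtain w where "w \<in> W" "z = proj w" using UsU[OF i] by blast
      thus "z \<in> proj ` Wi i" using z WV by (auto simp: Wi_def preim_def)
    qed
  qed
  have card_Wi: "card (Wi i) = q ^ nv i" if "i < t" for i
    using card_image[OF inj_on_subset[OF inj WiW]] proj_Wi[OF that] card_Us[OF that] by metis
  define N where "N i = span (Wi i)" for i
  have WiV: "Wi i \<subseteq> carrier V" if "i < t" for i using subspD(1)[OF Wi[OF that]] .
  have N: "subsp (carrier K) (N i)" if "i < t" for i
    unfolding N_def by (rule subsp_span[OF WiV[OF that]])
  have WiN: "Wi i \<subseteq> N i" if "i < t" for i unfolding N_def by (rule in_own_span[OF WiV[OF that]])
  have card_N: "card (N i) = Q ^ nv i" if "i < t" for i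
    unfolding N_def by (rule card_span[OF Wi[OF that] WiW card_Wi[OF that]])
  have W_sums: "W \<subseteq> (\<lambda>x. \<Oplus>\<^bsub>V\<^esub>i\<in>{..<t}. x i) ` (\<Pi>\<^sub>E i\<in>{..<t}. Wi i)"
  proof
    fix w assume w: "w \<in> W"
    then obtain z where z: "z \<in> (\<Pi>\<^sub>E i\<in>{..<t}. Us i)" "proj w = (\<Oplus>\<^bsub>VS\<^esub>i\<in>{..<t}. z i)"
      using sums by (metis (no_types, lifting) imageE imageI)
    have "\<exists>x. x \<in> Wi i \<and> proj x = z i" if "i < t" for i
    proof -
      have "z i \<in> proj ` Wi i" unfolding proj_Wi[OF that] using z(1) that by auto
      thus ?thesis by auto
    qed
    then obtain x where x: "\<And>i. i < t \<Longrightarrow> x i \<in> Wi i \<and> proj (x i) = z i" by metis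
    define y where "y = restrict x {..<t}"
    have y: "y \<in> (\<Pi>\<^sub>E i\<in>{..<t}. Wi i)" using x by (auto simp: y_def split: if_splits)
    have yW: "y i \<in> W" if "i < t" for i using PiE_mem[OF y, of i] that WiW by auto
    have "proj (\<Oplus>\<^bsub>V\<^esub>i\<in>{..<t}. y i) = (\<Oplus>\<^bsub>VS\<^esub>i\<in>{..<t}. proj (y i))"
      by (rule proj_finsum) (use yW in auto)
    also have "\<dots> = (\<Oplus>\<^bsub>VS\<^esub>i\<in>{..<t}. z i)"
    proof (rule VS.M.finsum_cong')
      show "z \<in> {..<t} \<rightarrow> carrier VS"
        using VS.subsp_mem[OF Us PiE_mem[OF z(1)]] by auto
    qed (use x in \<open>auto simp: y_def\<close>)
    finally have "proj (\<Oplus>\<^bsub>V\<^esub>i\<in>{..<t}. y i) = proj w" using z(2) by simp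
    moreover have "(\<Oplus>\<^bsub>V\<^esub>i\<in>{..<t}. y i) \<in> W" by (rule finsum_mem[OF W]) (use yW in auto)
    ultimately have "w = (\<Oplus>\<^bsub>V\<^esub>i\<in>{..<t}. y i)" using inj w by (metis inj_onD)
    thus "w \<in> (\<lambda>x. \<Oplus>\<^bsub>V\<^esub>i\<in>{..<t}. x i) ` (\<Pi>\<^sub>E i\<in>{..<t}. Wi i)" using y by blast
  qed
  \<comment> \<open>The \<open>N i\<close> generate \<open>V\<close> because \<open>W\<close> does,
    and their dimensions n_i add up to n.\<close>
  have direct: "internal_direct_sum V t N (carrier V)"
  proof (rule internal_direct_sumI)
    show "finite (N i)" if "i < t" for i using subspD(5)[OF N[OF that]] .
    let ?S = "(\<lambda>x. \<Oplus>\<^bsub>V\<^esub>i\<in>{..<t}. x i) ` (\<Pi>\<^sub>E i\<in>{..<t}. N i)"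
    have S: "subsp (carrier K) ?S" by (rule subsp_sums[where N = N, OF subset_refl N])
    have "(\<Pi>\<^sub>E i\<in>{..<t}. Wi i) \<subseteq> (\<Pi>\<^sub>E i\<in>{..<t}. N i)" by (rule PiE_mono) (use WiN in auto)
    hence "W \<subseteq> ?S" using W_sums by blast
    hence "carrier V \<subseteq> ?S" unfolding span_W[symmetric] by (rule span_minimal[OF _ S])
    thus "?S = carrier V" using subspD(1)[OF S] by blast
    show "card (\<Pi>\<^sub>E i\<in>{..<t}. N i) = card (carrier V)"
      unfolding card_V n_sum by (rule card_PiE_power[where N = N, OF card_N])
  qed
  interpret D: direct_sum_space K V t N by unfold_locales (use N direct in auto)

  have span_Us: "VS.span (Us i) = proj ` N i" if "i < t" for i
    unfolding N_def proj_Wi[OF that, symmetric] by (rule span_proj[OF WiV[OF that]])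
  \<comment> \<open>The projection maps \<open>N i\<close>, of dimension n_i, onto the
    k_i-dimensional span of \<open>Us i\<close>, and the intersection is its kernel.\<close>
  have card_\<Gamma>i: "card (\<Gamma> \<inter> N i) = Q ^ (nv i - kv i)" if "i < t" for i
  proof -
    have "Q ^ nv i = Q ^ kv i * card (N i \<inter> \<Gamma>)"
      using card_proj[OF subfield_carrier N[OF that]] card_N[OF that] card_span_Us[OF that] span_Us[OF that] by simp
    moreover have "Q ^ nv i = Q ^ kv i * Q ^ (nv i - kv i)"
      using comp[OF that] by (simp add: power_add[symmetric])
    ultimately show ?thesis using Q_gt_1 by (simp add: Int_commute)
  qed
  have sum_diff: "n - (\<Sum>i<t. kv i) = (\<Sum>i<t. nv i - kv i)"
    unfolding n_sum by (rule sum_subtractf_nat[symmetric]) (use comp in \<open>auto intro: less_imp_le\<close>)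
  \<comment> \<open>The intersections form a direct sum inside \<Gamma> that already has its full
    dimension n - k.\<close>
  have \<Gamma>_sums: "\<Gamma> \<subseteq> (\<lambda>x. \<Oplus>\<^bsub>V\<^esub>i\<in>{..<t}. x i) ` (\<Pi>\<^sub>E i\<in>{..<t}. \<Gamma> \<inter> N i)"
  proof -
    let ?f = "\<lambda>x. \<Oplus>\<^bsub>V\<^esub>i\<in>{..<t}. x i" and ?A = "\<Pi>\<^sub>E i\<in>{..<t}. \<Gamma> \<inter> N i"
    have "?A \<subseteq> (\<Pi>\<^sub>E i\<in>{..<t}. N i)" by (rule PiE_mono) auto
    hence "inj_on ?f ?A" using direct inj_on_subset unfolding internal_direct_sum_def bij_betw_def by blast
    hence "card (?f ` ?A) = card \<Gamma>"
      unfolding card_\<Gamma> sum_diff by (simp only: card_image card_PiE_power[where N = "\<lambda>i. \<Gamma> \<inter> N i" and d = "\<lambda>i. nv i - kv i", OF card_\<Gamma>i])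
    moreover have "?f ` ?A \<subseteq> \<Gamma>" by (auto intro!: finsum_mem[OF \<Gamma>])
    ultimately have "?f ` ?A = \<Gamma>" by (intro card_subset_eq[OF subspD(5)[OF \<Gamma>]]) auto
    thus ?thesis by simp
  qed
  have Wi_sub: "Wi i \<subseteq> W \<inter> N i" if "i < t" for i using WiW WiN[OF that] by blast
  have \<Gamma>i_sub: "\<Gamma> \<inter> N i \<subseteq> \<Gamma> \<inter> N i" for i by simp
  note proj_W = D.cproj_invariant[where Xs = Wi, OF W Wi_sub W_sums] D.cproj_single_image[where Xs = Wi, OF W Wi_sub W_sums]
  note proj_\<Gamma> = D.cproj_invariant[where Xs = "\<lambda>i. \<Gamma> \<inter> N i", OF \<Gamma> \<Gamma>i_sub \<Gamma>_sums] D.cproj_single_image[where Xs = "\<lambda>i. \<Gamma> \<inter> N i", OF \<Gamma> \<Gamma>i_sub \<Gamma>_sums]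

  have "scattered_decomposition K V F W \<sigma> n t D.cproj \<Gamma> nv kv"
  proof (rule scattered_decomposition.intro[OF rank_setup_axioms], rule scattered_decomposition_axioms.intro)
    \<comment> \<open>With k_i = 0 the component would span the zero space and be zero itself,
      against n_i > 0.\<close>
    show "0 < kv i" if i: "i < t" for i
    proof (rule ccontr)
      assume "\<not> 0 < kv i"
      hence "card (VS.span (Us i)) = 1" using card_span_Us[OF i] by simp
      moreover have "Us i \<subseteq> VS.span (Us i)" by (rule VS.in_own_span[OF VS.subspD(1)[OF Us[OF i]]])
      ultimately have "card (Us i) \<le> 1"
        using card_mono[OF VS.subspD(5)[OF VS.subsp_span[OF VS.subspD(1)[OF Us[OF i]]]]] by metis
      moreover have "1 < q ^ nv i" by (rule one_less_power[OF q_gt_1]) (use comp[OF i] in simp)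
      ultimately show False using card_Us[OF i] by simp
    qed
    show "kv i < nv i" if "i < t" for i using comp[OF that] .
    show "D.cproj I x \<in> W" if "x \<in> W" for I x using proj_W(1)[OF _ that] by blast
    show "D.cproj I x \<in> \<Gamma>" if "x \<in> \<Gamma>" for I x using proj_\<Gamma>(1)[OF that] .
    show "card (D.cproj {i} ` W) = q ^ nv i" if "i < t" for i
      using proj_W(2)[OF _ that] card_Wi[OF that] by simp
    show "card (D.cproj {i} ` \<Gamma>) = Q ^ (nv i - kv i)" if "i < t" for i
      using proj_\<Gamma>(2)[OF that] card_\<Gamma>i[OF that] by simp
    fix u assume up: "u \<in> perp \<sigma> (carrier V) \<Gamma>" and full: "\<And>i. i < t \<Longrightarrow> \<exists>y\<in>W. \<sigma> u (D.cproj {i} y) \<noteq> \<zero>\<^bsub>K\<^esub>"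
    have u: "u \<in> carrier V" using up by (auto simp: perp_def)
    have nz: "u \<noteq> \<zero>\<^bsub>V\<^esub>" using full[OF t] WV by force
    interpret fl: rank_setup K V F W "flip \<sigma>" n by (rule rank_setup_flip)
    let ?Z = "{x \<in> carrier V. \<sigma> u x = \<zero>\<^bsub>K\<^esub>}"
    have L: "subsp (carrier K) (line (carrier K) u)" by (rule subsp_line[OF subfield_carrier u])
    have Z_eq: "?Z = perp (flip \<sigma>) (carrier V) (line (carrier K) u)"
    proof
      show "?Z \<subseteq> perp (flip \<sigma>) (carrier V) (line (carrier K) u)" using u by (auto simp: perp_def line_def)
      show "perp (flip \<sigma>) (carrier V) (line (carrier K) u) \<subseteq> ?Z"
        using mem_line[OF subfield_carrier u] by (auto simp: perp_def)
    qed
    have Z: "subsp (carrier K) ?Z" unfolding Z_eq by (rule subsp_rperp_V[OF subspD(1)[OF L]])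
    have \<Gamma>Z: "\<Gamma> \<subseteq> ?Z" using up subspD(1)[OF \<Gamma>] by (auto simp: perp_def)
    have card_Z: "card ?Z * Q = card (carrier V)"
      using fl.card_perp_V[OF L] unfolding Z_eq card_V card_line[OF subfield_carrier u nz] .
    \<comment> \<open>As \<Gamma> is contained in the kernel \<open>?Z\<close> of \<sigma> u,
      codimension one survives in the quotient, and membership of a coset in \<open>?H\<close> can
      be tested by applying \<sigma> u to any representative.\<close>
    let ?H = "proj ` ?Z"
    have H: "VS.subsp (carrier K) ?H" by (rule subsp_proj[OF Z subset_refl])
    have "card ?Z = card ?H * card \<Gamma>"
      using card_proj[OF subfield_carrier Z] \<Gamma>Z by (simp add: Int_absorb1)
    hence "card ?H * Q * card \<Gamma> = card (carrier VS) * card \<Gamma>"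
      using card_Z card_VS by (simp add: mult_ac)
    hence "card ?H * Q = card (carrier VS)" using card_subsp_pos[OF \<Gamma>] by simp
    hence hH: "hyperplane K VS ?H" unfolding VS.hyperplane_iff using H by blast
    have inH: "\<sigma> u x = \<zero>\<^bsub>K\<^esub>" if x: "x \<in> carrier V" "proj x \<in> ?H" for x
    proof -
      obtain z where z: "z \<in> ?Z" "proj x = proj z" using x(2) by auto
      have "x \<ominus>\<^bsub>V\<^esub> z \<in> ?Z" using z proj_eq_iff[of x z] x(1) \<Gamma>Z by auto
      hence "x \<ominus>\<^bsub>V\<^esub> z \<oplus>\<^bsub>V\<^esub> z \<in> ?Z" by (rule subspD(3)[OF Z _ z(1)])
      thus ?thesis using M.minus_add_cancel[of x z] x z by simp
    qed
    have nH: "\<not> VS.span (Us i) \<subseteq> ?H" if i: "i < t" for i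
    proof
      assume sub: "VS.span (Us i) \<subseteq> ?H"
      obtain y where y: "y \<in> W" "\<sigma> u (D.cproj {i} y) \<noteq> \<zero>\<^bsub>K\<^esub>" using full[OF i] by auto
      have "D.cproj {i} y \<in> N i" using D.cproj_single[of y i] D.coord_N[of y i] y i by simp
      hence "proj (D.cproj {i} y) \<in> ?H" using sub span_Us[OF i] by blast
      thus False using inH[of "D.cproj {i} y"] y by simp
    qed
    let ?d = "sub_dim (sub_scalars K F) VS (proj ` W \<inter> ?H)"
    have d: "?d + 1 \<le> (\<Sum>i<t. kv i)" by (rule hyp[OF hH nH])
    have UH: "proj ` W \<inter> ?H = proj ` {x \<in> W. \<sigma> u x = \<zero>\<^bsub>K\<^esub>}"
    proof
      show "proj ` W \<inter> ?H \<subseteq> proj ` {x \<in> W. \<sigma> u x = \<zero>\<^bsub>K\<^esub>}" using inH WV by blast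
      show "proj ` {x \<in> W. \<sigma> u x = \<zero>\<^bsub>K\<^esub>} \<subseteq> proj ` W \<inter> ?H" using WV by blast
    qed
    have "VS.subsp F (proj ` W \<inter> ?H)"
      by (rule VS.subsp_Int[OF subsp_proj[OF W FK] VS.subsp_antimono[OF H FK]])
    hence "card (proj ` W \<inter> ?H) = q ^ ?d" by (rule VS.card_eq_power_sub_dim[OF F])
    moreover have "card (proj ` W \<inter> ?H) = card {x \<in> W. \<sigma> u x = \<zero>\<^bsub>K\<^esub>}"
      unfolding UH by (rule card_image[OF inj_on_subset[OF inj]]) auto
    ultimately have e: "q ^ n = lrank u * q ^ ?d"
      using lrank_mult_kernel[OF u W WV] card_W by simp
    show "q ^ (\<Sum>i<t. nv i - kv i) < lrank u"
    proof (rule ccontr)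
      assume "\<not> ?thesis"
      hence "lrank u * q ^ ?d \<le> q ^ (\<Sum>i<t. nv i - kv i) * q ^ ?d" by simp
      hence "q ^ n \<le> q ^ ((\<Sum>i<t. nv i - kv i) + ?d)" unfolding e power_add .
      hence "n \<le> (\<Sum>i<t. nv i - kv i) + ?d" unfolding power_increasing_iff[OF q_gt_1] .
      moreover have "(\<Sum>i<t. kv i) \<le> n" unfolding n_sum by (rule sum_mono) (use comp less_imp_le in auto)
      ultimately show False using d unfolding sum_diff[symmetric] by linarith
    qed
  qed (use D.cproj_add D.cproj_smult D.cproj_Int D.cproj_Un D.cproj_all \<Gamma> n_sum in auto)
  thus ?thesis by blast
qed

section \<open>Scatteredness of the dual\<close>

text \<open>A strict inequality in one factor would make the product too small. This recovers
  individual dimensions from upper bounds and the total dimension.\<close>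

lemma prod_le_imp_eq:
  fixes a b :: "nat \<Rightarrow> nat"
  assumes "finite A" "\<And>i. i \<in> A \<Longrightarrow> a i \<le> b i" "\<And>i. i \<in> A \<Longrightarrow> 0 < a i" "prod b A \<le> prod a A" "i \<in> A"
  shows "a i = b i"
proof -
  have "a i * prod a (A - {i}) = prod a A" "b i * prod b (A - {i}) = prod b A"
    using assms(1,5) by (simp_all add: prod.remove)
  moreover have "prod a (A - {i}) \<le> prod b (A - {i})" by (rule prod_mono) (use assms in auto)
  ultimately have "b i * prod a (A - {i}) \<le> a i * prod a (A - {i})"
    using assms(4) by (metis le_trans mult_le_mono2)
  moreover have "0 < prod a (A - {i})" using assms(1,3) by (intro prod_pos) auto
  ultimately have "b i \<le> a i" by simp
  thus ?thesis using assms(2)[OF assms(5)] by simp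
qed

context scattered_decomposition
begin

text \<open>The cross terms vanish because \<open>x j\<close> is orthogonal to every component other
  than j, so pairing with component i extracts the ith summand.\<close>

lemma form_dW_component:
  assumes x: "\<And>i. i < t \<Longrightarrow> x i \<in> dW {i}" and i: "i < t" and y: "y \<in> carrier V"
  shows "\<sigma> (\<Oplus>\<^bsub>V\<^esub>j\<in>{..<t}. x j) (P {i} y) = \<sigma> (x i) y"
proof -
  have xV: "x j \<in> carrier V" if "j < t" for j using subsp_mem[OF subsp_dW x[OF that]] .
  have "\<sigma> (\<Oplus>\<^bsub>V\<^esub>j\<in>{..<t}. x j) (P {i} y) = (\<Oplus>\<^bsub>K\<^esub>j\<in>{..<t}. \<sigma> (x j) (P {i} y))"
    by (rule finsum_hom[OF R.abelian_group_axioms]) (use xV y in auto)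
  also have "\<dots> = (\<Oplus>\<^bsub>K\<^esub>j\<in>{..<t}. if i = j then \<sigma> (x j) (P {i} y) else \<zero>\<^bsub>K\<^esub>)"
  proof (rule R.finsum_cong')
    fix j assume j: "j \<in> {..<t}"
    show "\<sigma> (x j) (P {i} y) = (if i = j then \<sigma> (x j) (P {i} y) else \<zero>\<^bsub>K\<^esub>)"
    proof (cases "i = j")
      case False
      hence "({..<t} - {j}) \<inter> {i} = {i}" using i by auto
      hence "P {i} y = P ({..<t} - {j}) (P {i} y)" using P_Int[of "{..<t} - {j}" "{i}" y] i y by simp
      moreover have "\<sigma> (x j) (P ({..<t} - {j}) (P {i} y)) = \<zero>\<^bsub>K\<^esub>"
        by (rule dW_form_zero[OF x]) (use j y in auto)
      ultimately show ?thesis using False by simp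
    qed simp
  qed (use xV y in auto)
  also have "\<dots> = \<sigma> (x i) (P {i} y)"
    by (rule R.add.finprod_singleton) (use i xV y in auto)
  also have "\<dots> = \<sigma> (x i) y"
  proof -
    have "\<sigma> (x i) y = \<sigma> (x i) (P {i} y) \<oplus>\<^bsub>K\<^esub> \<sigma> (x i) (P ({..<t} - {i}) y)"
      by (subst P_split[of "{i}" y], use i y in simp, use y in simp, rule form_add_r) (use xV i y in auto)
    thus ?thesis using dW_form_zero[OF x[OF i] y] xV i y by simp
  qed
  finally show ?thesis .
qed

text \<open>Pairing with the components of \<open>V\<close> recovers the summands, so the sum is
  direct; it then has q ^ n elements, as many as \<open>W\<close>.\<close>

lemma dW_sums: "(\<lambda>x. \<Oplus>\<^bsub>V\<^esub>i\<in>{..<t}. x i) ` (\<Pi>\<^sub>E i\<in>{..<t}. dW {i}) = W"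
proof -
  let ?f = "\<lambda>x. \<Oplus>\<^bsub>V\<^esub>i\<in>{..<t}. x i" and ?A = "\<Pi>\<^sub>E i\<in>{..<t}. dW {i}"
  have mem: "x i \<in> dW {i}" if "x \<in> ?A" "i < t" for x i using that by auto
  have "inj_on ?f ?A"
  proof (rule inj_onI)
    fix x y assume x: "x \<in> ?A" and y: "y \<in> ?A" and e: "?f x = ?f y"
    show "x = y"
    proof (rule PiE_ext[OF x y])
      fix i assume i: "i \<in> {..<t}"
      have m: "x i \<in> dW {i}" "y i \<in> dW {i}" using mem x y i by auto
      have V: "x i \<in> carrier V" "y i \<in> carrier V" using m subsp_mem[OF subsp_dW] by auto
      have "\<sigma> (x i \<ominus>\<^bsub>V\<^esub> y i) z = \<zero>\<^bsub>K\<^esub>" if z: "z \<in> carrier V" for z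
      proof -
        have xx: "\<sigma> (x i) z = \<sigma> (y i) z"
          using form_dW_component[of x i z] form_dW_component[of y i z] mem[OF x] mem[OF y] i z e by auto
        have "\<sigma> (x i \<ominus>\<^bsub>V\<^esub> y i) z \<oplus>\<^bsub>K\<^esub> \<sigma> (y i) z = \<sigma> (x i) z"
          using form_add_l[of "x i \<ominus>\<^bsub>V\<^esub> y i" "y i" z] M.minus_add_cancel[of "x i" "y i"] V z by simp
        thus ?thesis using xx V z by (simp add: R.add.l_cancel_one')
      qed
      hence "x i \<ominus>\<^bsub>V\<^esub> y i = \<zero>\<^bsub>V\<^esub>" using V by (intro form_nondegenerate) auto
      thus "x i = y i" using V M.minus_add_cancel[of "x i" "y i"] by simp
    qed
  qed
  hence "card (?f ` ?A) = card ?A" by (rule card_image)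
  also have "\<dots> = q ^ n" unfolding n_sum
    by (rule card_PiE_power[where N = "\<lambda>i. dW {i}"]) (use card_dW in auto)
  finally have c: "card (?f ` ?A) = card W" using card_W by simp
  have "?f ` ?A \<subseteq> W"
  proof (rule image_subsetI, rule finsum_mem[OF W])
    fix x i assume "x \<in> ?A" "i \<in> {..<t}"
    thus "x i \<in> W" using mem[of x i] dW_subset by auto
  qed simp
  thus ?thesis by (rule card_subset_eq[OF subspD(5)[OF W] _ c])
qed

lemma span_dW: "I \<subseteq> {..<t} \<Longrightarrow> span (dW I) = dV I"
proof (rule card_subset_eq[OF subspD(5)[OF subsp_dV]])
  show "span (dW I) \<subseteq> dV I" by (rule span_minimal[OF dW_subset_dV subsp_dV])
  assume I: "I \<subseteq> {..<t}"
  show "card (span (dW I)) = card (dV I)"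
    unfolding card_dV[OF I] by (rule card_span[OF subsp_dW dW_subset card_dW[OF I]])
qed

lemma card_\<Gamma>: "card \<Gamma> = Q ^ (\<Sum>i<t. nv i - kv i)"
proof -
  have "P {..<t} ` \<Gamma> = \<Gamma>" using \<Gamma>_mem by (auto simp: image_iff)
  thus ?thesis using card_P_\<Gamma>[of "{..<t}"] by simp
qed

lemma n_split: "n = (\<Sum>i<t. kv i) + (\<Sum>i<t. nv i - kv i)"
  using sum_split(2)[of "{..<t}"] n_sum by simp

lemma card_perp_\<Gamma>: "card (perp \<sigma> (carrier V) \<Gamma>) = Q ^ (\<Sum>i<t. kv i)"
proof -
  have "card (perp \<sigma> (carrier V) \<Gamma>) * Q ^ (\<Sum>i<t. nv i - kv i) = Q ^ n"
    using card_perp_V[OF \<Gamma>] card_\<Gamma> by simp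
  also have "\<dots> = Q ^ (\<Sum>i<t. kv i) * Q ^ (\<Sum>i<t. nv i - kv i)" by (subst n_split) (rule power_add)
  finally show ?thesis using Q_gt_1 by simp
qed

lemma rperp_perp_\<Gamma>: "perp (flip \<sigma>) (carrier V) (perp \<sigma> (carrier V) \<Gamma>) = \<Gamma>"
  by (rule perp_perp[OF subfield_carrier pairing_V refl nondegenerate_V \<Gamma> subspD(1)[OF \<Gamma>]])

lemma form_dV:
  assumes "x \<in> dV {i}" "i < t" "v \<in> carrier V"
  shows "\<sigma> x v = \<sigma> x (P {i} v)"
proof -
  have xV: "x \<in> carrier V" using subsp_mem[OF subsp_dV assms(1)] .
  have "\<sigma> x v = \<sigma> x (P {i} v) \<oplus>\<^bsub>K\<^esub> \<sigma> x (P ({..<t} - {i}) v)"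
    using form_add_r[of x "P {i} v" "P ({..<t} - {i}) v"] P_split[of "{i}" v] xV assms by simp
  moreover have "\<sigma> x (P ({..<t} - {i}) v) = \<zero>\<^bsub>K\<^esub>" using assms by (auto simp: dV_def perp_def)
  ultimately show ?thesis using xV assms by simp
qed

theorem dual_scattered:
  "scattered K F (quot_space V (perp \<sigma> (carrier V) \<Gamma>)) t (\<lambda>i. nv i - kv i) nv
    (quot_image V (perp \<sigma> (carrier V) \<Gamma>) W)"
proof -
  let ?D = "perp \<sigma> (carrier V) \<Gamma>"
  interpret fl: rank_setup K V F W "flip \<sigma>" n by (rule rank_setup_flip)
  interpret quotient_space K V ?D by unfold_locales (rule subsp_perp_V[OF subspD(1)[OF \<Gamma>]])
  have FK: "F \<subseteq> carrier K" by (rule subfieldD(1)[OF F])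
  have WV: "W \<subseteq> carrier V" by (rule subspD(1)[OF W])
  have U: "quot_image V ?D W = proj ` W" by (rule quot_image_eq[OF WV])
  have inj: "inj_on proj W" by (rule proj_inj_on[OF F W W_Int_perp_\<Gamma>])
  have U_sub: "VS.subsp F (proj ` W)" by (rule subsp_proj[OF W FK])
  have card_U: "card (proj ` W) = q ^ n" using card_image[OF inj] card_W by simp
  have "Q ^ n = card (carrier VS) * Q ^ (\<Sum>i<t. kv i)" using card_VS card_V card_perp_\<Gamma> by simp
  moreover have "Q ^ n = Q ^ (\<Sum>i<t. nv i - kv i) * Q ^ (\<Sum>i<t. kv i)"
    by (subst n_split) (simp add: power_add)
  ultimately have card_VS': "card (carrier VS) = Q ^ (\<Sum>i<t. nv i - kv i)" using Q_gt_1 by simp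
  define Us where "Us i = proj ` dW {i}" for i
  have Us: "VS.subsp F (Us i)" for i unfolding Us_def by (rule subsp_proj[OF subsp_dW FK])
  have card_Us: "card (Us i) = q ^ nv i" if "i < t" for i
    unfolding Us_def using card_image[OF inj_on_subset[OF inj dW_subset]] card_dW[of "{i}"] that by simp
  have span_Us: "VS.span (Us i) = proj ` dV {i}" if "i < t" for i
    unfolding Us_def using span_proj[OF subspD(1)[OF subsp_dW]] span_dW[of "{i}"] that by simp
  have span_sub: "VS.subsp (carrier K) (VS.span (Us i))" for i
    by (rule VS.subsp_span[OF VS.subspD(1)[OF Us]])
  have Us_sums: "(\<lambda>x. \<Oplus>\<^bsub>VS\<^esub>i\<in>{..<t}. x i) ` (\<Pi>\<^sub>E i\<in>{..<t}. Us i) = proj ` W" (is "?S = _")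
  proof
    show "?S \<subseteq> proj ` W"
    proof (rule image_subsetI, rule VS.finsum_mem[OF U_sub])
      fix x i assume "x \<in> (\<Pi>\<^sub>E i\<in>{..<t}. Us i)" "i \<in> {..<t}"
      hence "x i \<in> Us i" by auto
      thus "x i \<in> proj ` W" using dW_subset by (auto simp: Us_def)
    qed simp
    show "proj ` W \<subseteq> ?S"
    proof
      fix z assume "z \<in> proj ` W"
      then obtain x where x: "x \<in> (\<Pi>\<^sub>E i\<in>{..<t}. dW {i})" "z = proj (\<Oplus>\<^bsub>V\<^esub>i\<in>{..<t}. x i)"
        using dW_sums by (metis (no_types, lifting) imageE)
      have xd: "x i \<in> dW {i}" if "i < t" for i using PiE_mem[OF x(1)] that by simp
      have xV: "x i \<in> carrier V" if "i < t" for i using subsp_mem[OF subsp_dW xd[OF that]] .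
      have "z = (\<Oplus>\<^bsub>VS\<^esub>i\<in>{..<t}. proj (x i))" unfolding x(2) by (rule proj_finsum) (use xV in auto)
      also have "\<dots> = (\<Oplus>\<^bsub>VS\<^esub>i\<in>{..<t}. restrict (\<lambda>i. proj (x i)) {..<t} i)"
        by (rule VS.M.finsum_cong') (use xV in auto)
      finally have "z = (\<Oplus>\<^bsub>VS\<^esub>i\<in>{..<t}. restrict (\<lambda>i. proj (x i)) {..<t} i)" .
      moreover have "restrict (\<lambda>i. proj (x i)) {..<t} \<in> (\<Pi>\<^sub>E i\<in>{..<t}. Us i)"
        by (rule restrict_PiE_iff[THEN iffD2]) (use xd in \<open>auto simp: Us_def\<close>)
      ultimately show "z \<in> ?S" by (rule image_eqI)
    qed
  qed
  have direct_U: "internal_direct_sum VS t Us (proj ` W)"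
  proof (rule VS.internal_direct_sumI[OF _ Us_sums])
    show "finite (Us i)" for i by (rule VS.subspD(5)[OF Us])
    show "card (\<Pi>\<^sub>E i\<in>{..<t}. Us i) = card (proj ` W)"
      unfolding card_U n_sum by (rule card_PiE_power[where N = Us, OF card_Us])
  qed
  have span_sums: "(\<lambda>x. \<Oplus>\<^bsub>VS\<^esub>i\<in>{..<t}. x i) ` (\<Pi>\<^sub>E i\<in>{..<t}. VS.span (Us i)) = carrier VS" (is "?S = _")
  proof
    have S: "VS.subsp (carrier K) ?S"
      by (rule VS.subsp_sums[where N = "\<lambda>i. VS.span (Us i)", OF subset_refl span_sub])
    show "?S \<subseteq> carrier VS" by (rule VS.subspD(1)[OF S])
    have "(\<Pi>\<^sub>E i\<in>{..<t}. Us i) \<subseteq> (\<Pi>\<^sub>E i\<in>{..<t}. VS.span (Us i))"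
      by (rule PiE_mono) (use VS.in_own_span[OF VS.subspD(1)[OF Us]] in auto)
    hence "proj ` W \<subseteq> ?S" unfolding Us_sums[symmetric] by (rule image_mono)
    hence "VS.span (proj ` W) \<subseteq> ?S" by (rule VS.span_minimal[OF _ S])
    thus "carrier VS \<subseteq> ?S" unfolding span_proj[OF WV] span_W carrier_VS .
  qed
  \<comment> \<open>The projection of \<open>dV {i}\<close> has kernel \<open>d\<Gamma> {i}\<close>,
    of dimension at least k_i, which leaves at most n_i - k_i dimensions for the image.\<close>
  have le: "card (VS.span (Us i)) \<le> Q ^ (nv i - kv i)" if i: "i < t" for i
  proof -
    have I: "{i} \<subseteq> {..<t}" using i by simp
    have "card (VS.span (Us i)) * Q ^ kv i \<le> card (VS.span (Us i)) * card (d\<Gamma> {i})"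
      using card_d\<Gamma>[OF I] by simp
    also have "\<dots> = card (dV {i})"
      using card_proj[OF subfield_carrier subsp_dV, of "{i}"] span_Us[OF i] by (simp add: d\<Gamma>_def Int_commute)
    also have "\<dots> = Q ^ (nv i - kv i) * Q ^ kv i"
      unfolding card_dV[OF I] using kv_less[OF i] by (simp add: power_add[symmetric])
    finally show ?thesis using Q_gt_1 by simp
  qed
  \<comment> \<open>The spans generate the quotient, whose dimension is the sum of the upper bounds
    in \<open>le\<close>, so each of these is attained.\<close>
  have card_span_Us: "card (VS.span (Us i)) = Q ^ (nv i - kv i)" if i: "i < t" for i
  proof (rule prod_le_imp_eq[where A = "{..<t}" and b = "\<lambda>i. Q ^ (nv i - kv i)"])
    show "0 < card (VS.span (Us i))" for i by (rule VS.card_subsp_pos[OF span_sub])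
    have "finite (\<Pi>\<^sub>E i\<in>{..<t}. VS.span (Us i))"
      by (rule finite_PiE) (auto intro: VS.subspD(5)[OF span_sub])
    from card_image_le[OF this, of "\<lambda>x. \<Oplus>\<^bsub>VS\<^esub>i\<in>{..<t}. x i"]
    show "(\<Prod>i<t. Q ^ (nv i - kv i)) \<le> (\<Prod>i<t. card (VS.span (Us i)))"
      unfolding span_sums card_VS' by (simp add: card_PiE power_sum)
  qed (use le i in auto)
  have direct_VS: "internal_direct_sum VS t (\<lambda>i. VS.span (Us i)) (carrier VS)"
  proof (rule VS.internal_direct_sumI[OF _ span_sums])
    show "finite (VS.span (Us i))" for i by (rule VS.subspD(5)[OF span_sub])
    show "card (\<Pi>\<^sub>E i\<in>{..<t}. VS.span (Us i)) = card (carrier VS)"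
      unfolding card_VS' by (rule card_PiE_power[where N = "\<lambda>i. VS.span (Us i)", OF card_span_Us])
  qed
  have dec: "decomposition K F VS t (\<lambda>i. nv i - kv i) nv (proj ` W) Us"
    unfolding decomposition_def
  proof (intro conjI allI impI)
    show "vectorspace K VS" by (rule VS.vectorspace_axioms)
    show "vectorspace.fin_dim K VS" by (rule VS.finite_carrier_fin_dim)
    show "vectorspace.dim K VS = (\<Sum>i<t. nv i - kv i)"
      using card_VS' VS.card_carrier_eq_power_dim card_subfield_power_inject[OF subfield_carrier] by simp
    show "VectorSpace.subspace (sub_scalars K F) (proj ` W) VS" using VS.subspace_iff_subsp[OF F] U_sub by simp
    show "sub_dim (sub_scalars K F) VS (proj ` W) = (\<Sum>i<t. nv i)"
      by (rule VS.sub_dim_eqI[OF F U_sub]) (use card_U n_sum in simp)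
    show "VectorSpace.subspace (sub_scalars K F) (Us i) VS" for i using VS.subspace_iff_subsp[OF F] Us by simp
    show "sub_dim (sub_scalars K F) VS (Us i) = nv i" if "i < t" for i
      by (rule VS.sub_dim_eqI[OF F Us card_Us[OF that]])
    show "sub_dim K VS (VS.span (Us i)) = nv i - kv i" if "i < t" for i
      using VS.sub_dim_eqI[OF subfield_carrier span_sub] card_span_Us[OF that] by simp
  qed (fact direct_U direct_VS)+

  \<comment> \<open>The preimage of \<open>H\<close> contains
    \<open>\<Gamma>\<^sup>\<bottom>\<close>, so its right annihilator lies in the double
    annihilator, which is \<Gamma>. In this way hyperplanes on the dual side lead to vectors of
    \<Gamma>.\<close>
  have preim_form: "rperp \<subseteq> \<Gamma>" if "VS.subsp (carrier K) H" "rperp = perp (flip \<sigma>) (carrier V) (preim H)" for H rperp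
  proof -
    have "rperp \<subseteq> perp (flip \<sigma>) (carrier V) ?D"
      unfolding that(2) using S_subset_preim[OF that(1)] by (auto simp: perp_def)
    thus ?thesis unfolding rperp_perp_\<Gamma> .
  qed
  \<comment> \<open>Rank-nullity on \<open>Y\<close>, of dimension c + k: a rank of at least k + 1
    leaves nullity at most c - 1. The conditions on hyperplanes use it with \<open>dW {i}\<close>
    and with \<open>W\<close> as \<open>Y\<close>.\<close>
  have card_bound: "d + 1 \<le> c"
    if X: "X \<subseteq> W" and d: "card (proj ` X) = q ^ d" and v: "v \<in> carrier V"
      and Y: "subsp F Y" "Y \<subseteq> W" "X \<subseteq> {x \<in> Y. \<sigma> x v = \<zero>\<^bsub>K\<^esub>}" and cY: "card Y = q ^ (c + k)"
      and r: "q ^ Suc k \<le> card ((\<lambda>x. \<sigma> x v) ` Y)" for X Y v c d k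
  proof -
    have "q ^ d \<le> card {x \<in> Y. \<sigma> x v = \<zero>\<^bsub>K\<^esub>}"
      unfolding d[symmetric] card_image[OF inj_on_subset[OF inj X]]
      by (rule card_mono[OF _ Y(3)]) (use subspD(5)[OF Y(1)] in simp)
    hence "q ^ Suc k * q ^ d \<le> card ((\<lambda>x. \<sigma> x v) ` Y) * card {x \<in> Y. \<sigma> x v = \<zero>\<^bsub>K\<^esub>}"
      by (rule mult_le_mono[OF r])
    also have "\<dots> = q ^ (c + k)"
      using fl.lrank_mult_kernel[OF v Y(1)] subspD(1)[OF Y(1)] cY by simp
    finally have "q ^ (Suc k + d) \<le> q ^ (c + k)" unfolding power_add .
    thus ?thesis unfolding power_increasing_iff[OF q_gt_1] by simp
  qed
  have hyp1: "sub_dim (sub_scalars K F) VS (Us i \<inter> H) + 1 \<le> nv i - kv i"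
    if i: "i < t" and hp: "hyperplane K (VS\<lparr>carrier := VS.span (Us i)\<rparr>) H" for i H
  proof -
    let ?N = "VS.span (Us i)"
    have "VectorSpace.subspace K ?N VS" using span_sub VS.subspace_iff_subsp_carrier by simp
    then interpret N: vectorspace K "VS\<lparr>carrier := ?N\<rparr>" by (rule VS.subspace_is_vs)
    interpret N: finite_space K "VS\<lparr>carrier := ?N\<rparr>"
      by unfold_locales (use finite_K VS.subspD(5)[OF span_sub] in auto)
    have "N.subsp (carrier K) H" and cH: "card H * Q = Q ^ (nv i - kv i)"
      using hp card_span_Us[OF i] unfolding N.hyperplane_iff by auto
    hence HN: "H \<subseteq> ?N" and H: "VS.subsp (carrier K) H"
      using VS.subspD(1)[OF span_sub] unfolding N.subsp_def VS.subsp_def by auto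
    let ?X = "preim H"
    have X: "subsp (carrier K) ?X" by (rule subsp_preim[OF H subset_refl])
    \<comment> \<open>\<open>?R\<close> has codimension n_i - k_i - 1 in \<Gamma>, so it meets the
      ith part of \<Gamma>, of dimension n_i - k_i, in a nonzero vector \<open>v\<close> supported
      on i alone.\<close>
    let ?R = "perp (flip \<sigma>) (carrier V) ?X"
    have R: "subsp (carrier K) ?R" by (rule subsp_rperp_V[OF subspD(1)[OF X]])
    have R\<Gamma>: "?R \<subseteq> \<Gamma>" by (rule preim_form[OF H refl])
    have "card ?R * (card H * Q ^ (\<Sum>i<t. kv i)) = Q ^ n"
      using fl.card_perp_V[OF X] card_preim[OF H] card_perp_\<Gamma> by simp
    also have "\<dots> = card \<Gamma> * Q ^ (\<Sum>i<t. kv i)"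
      by (subst n_split) (simp add: power_add card_\<Gamma>)
    finally have e: "card ?R * card H = card \<Gamma>" using Q_gt_1 by simp
    have "card \<Gamma> * 1 < card \<Gamma> * Q" using card_subsp_pos[OF \<Gamma>] Q_gt_1 by simp
    also have "\<dots> = card ?R * card (P {i} ` \<Gamma>)"
      unfolding e[symmetric] card_P_\<Gamma>1[OF i] cH[symmetric] by (simp add: mult_ac)
    finally have "card \<Gamma> < card ?R * card (P {i} ` \<Gamma>)" by simp
    then obtain v where v: "v \<in> ?R" "v \<in> P {i} ` \<Gamma>" "v \<noteq> \<zero>\<^bsub>V\<^esub>"
      using exists_common_nonzero[OF subfield_carrier R subsp_P_\<Gamma> \<Gamma> R\<Gamma>, of "{i}"] P_\<Gamma> by blast
    obtain g where g: "g \<in> \<Gamma>" "v = P {i} g" using v(2) by auto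
    have vV: "v \<in> carrier V" "v \<in> \<Gamma>" using v(1) R\<Gamma> by (auto simp: perp_def)
    have Pv: "P {i} v = v" using P_Int[of "{i}" "{i}" g] i g \<Gamma>_mem by simp
    have "rsupp v \<subseteq> {i}" using rsupp_P[of g "{i}"] g \<Gamma>_mem i by auto
    hence rs: "rsupp v = {i}" using rsupp_empty[OF vV(1)] v(3) by blast
    \<comment> \<open>As \<open>v\<close> is supported on i, pairing with it sees only the ith dual
      component of a vector of \<open>W\<close>; the rank bound for \<open>v\<close> is therefore
      available already on \<open>dW {i}\<close>.\<close>
    have im: "(\<lambda>x. \<sigma> x v) ` W \<subseteq> (\<lambda>x. \<sigma> x v) ` dW {i}"
    proof
      fix z assume "z \<in> (\<lambda>x. \<sigma> x v) ` W"
      then obtain x where x: "x \<in> (\<Pi>\<^sub>E i\<in>{..<t}. dW {i})" "z = \<sigma> (\<Oplus>\<^bsub>V\<^esub>i\<in>{..<t}. x i) v"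
        using dW_sums by (metis (no_types, lifting) imageE)
      have xd: "x j \<in> dW {j}" if "j < t" for j using PiE_mem[OF x(1)] that by simp
      have "z = \<sigma> (x i) v" using form_dW_component[OF xd i vV(1)] Pv x(2) by simp
      thus "z \<in> (\<lambda>x. \<sigma> x v) ` dW {i}" using xd[OF i] by auto
    qed
    have "q ^ Suc (kv i) \<le> rrank v" using rrank_lower_bound[OF vV(2) v(3)] rs by simp
    also have "\<dots> \<le> card ((\<lambda>x. \<sigma> x v) ` dW {i})"
      by (rule card_mono[OF _ im]) (use subspD(5)[OF subsp_dW] in simp)
    finally have r: "q ^ Suc (kv i) \<le> card ((\<lambda>x. \<sigma> x v) ` dW {i})" .
    have eq: "Us i \<inter> H = proj ` (dW {i} \<inter> ?X)"
      unfolding Us_def preim_def using subspD(1)[OF subsp_dW] by blast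
    have "VS.subsp F (Us i \<inter> H)" by (rule VS.subsp_Int[OF Us VS.subsp_antimono[OF H FK]])
    hence c: "card (Us i \<inter> H) = q ^ sub_dim (sub_scalars K F) VS (Us i \<inter> H)"
      by (rule VS.card_eq_power_sub_dim[OF F])
    show ?thesis
    proof (rule card_bound[OF _ _ vV(1) subsp_dW dW_subset _ _ r])
      show "card (proj ` (dW {i} \<inter> ?X)) = q ^ sub_dim (sub_scalars K F) VS (Us i \<inter> H)" using c eq by simp
      show "dW {i} \<inter> ?X \<subseteq> W" using dW_subset by auto
      show "dW {i} \<inter> ?X \<subseteq> {x \<in> dW {i}. \<sigma> x v = \<zero>\<^bsub>K\<^esub>}" using v(1) by (auto simp: perp_def)
      show "card (dW {i}) = q ^ (nv i - kv i + kv i)" using card_dW[of "{i}"] i kv_less[OF i] by simp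
    qed
  qed
  have hyp2: "sub_dim (sub_scalars K F) VS (proj ` W \<inter> H) + 1 \<le> (\<Sum>i<t. nv i - kv i)"
    if hp: "hyperplane K VS H" and nH: "\<And>i. i < t \<Longrightarrow> \<not> VS.span (Us i) \<subseteq> H" for H
  proof -
    have H: "VS.subsp (carrier K) H" and cH: "card H * Q = card (carrier VS)"
      using hp unfolding VS.hyperplane_iff by auto
    let ?X = "preim H"
    have X: "subsp (carrier K) ?X" by (rule subsp_preim[OF H subset_refl])
    let ?R = "perp (flip \<sigma>) (carrier V) ?X"
    have R: "subsp (carrier K) ?R" by (rule subsp_rperp_V[OF subspD(1)[OF X]])
    have R\<Gamma>: "?R \<subseteq> \<Gamma>" by (rule preim_form[OF H refl])
    have cX: "card ?X * Q = Q ^ n" using card_preim[OF H] cH card_VS card_V by (simp add: mult_ac)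
    have "card ?R * card ?X = Q * card ?X" using fl.card_perp_V[OF X] cX by (simp add: mult.commute)
    hence "card ?R = Q" using card_subsp_pos[OF X] by simp
    hence "?R \<noteq> {\<zero>\<^bsub>V\<^esub>}" using Q_gt_1 by auto
    then obtain v where v: "v \<in> ?R" "v \<noteq> \<zero>\<^bsub>V\<^esub>" using subspD(2)[OF R] by blast
    have vV: "v \<in> carrier V" "v \<in> \<Gamma>" using v(1) R\<Gamma> by (auto simp: perp_def)
    \<comment> \<open>The preimage has codimension one, as has the left annihilator of the line
      through \<open>v\<close>, which contains it.\<close>
    have X_eq: "?X = perp \<sigma> (carrier V) (line (carrier K) v)"
    proof (rule card_subset_eq)
      have L: "subsp (carrier K) (line (carrier K) v)" by (rule subsp_line[OF subfield_carrier vV(1)])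
      show "finite (perp \<sigma> (carrier V) (line (carrier K) v))"
        using subspD(5)[OF subsp_perp_V[OF subspD(1)[OF L]]] .
      show "?X \<subseteq> perp \<sigma> (carrier V) (line (carrier K) v)"
        using v(1) vV subspD(1)[OF X] by (auto simp: perp_def line_def)
      have "card (perp \<sigma> (carrier V) (line (carrier K) v)) * Q = card ?X * Q"
        using card_perp_V[OF L] card_line[OF subfield_carrier vV(1) v(2)] cX by simp
      thus "card ?X = card (perp \<sigma> (carrier V) (line (carrier K) v))" using Q_gt_1 by simp
    qed
    \<comment> \<open>Without an ith component, \<open>v\<close> would be orthogonal to all of
      \<open>dV {i}\<close>, and \<open>H\<close> would contain the span of
      \<open>Us i\<close>.\<close>
    have "P {i} v \<noteq> \<zero>\<^bsub>V\<^esub>" if i: "i < t" for i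
    proof
      assume Pv: "P {i} v = \<zero>\<^bsub>V\<^esub>"
      have "dV {i} \<subseteq> ?X"
      proof
        fix x assume x: "x \<in> dV {i}"
        have xV: "x \<in> carrier V" using subsp_mem[OF subsp_dV x] .
        have "\<sigma> x v = \<zero>\<^bsub>K\<^esub>" using form_dV[OF x i vV(1)] Pv xV by simp
        thus "x \<in> ?X" unfolding X_eq using xV vV by (auto simp: perp_def line_def)
      qed
      hence "VS.span (Us i) \<subseteq> H" unfolding span_Us[OF i] by (auto simp: preim_def)
      thus False using nH[OF i] by blast
    qed
    hence rs: "rsupp v = {..<t}" by (auto simp: rsupp_def)
    have r: "q ^ Suc (\<Sum>i<t. kv i) \<le> card ((\<lambda>x. \<sigma> x v) ` W)"
      using rrank_lower_bound[OF vV(2) v(2)] rs by simp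
    have eq: "proj ` W \<inter> H = proj ` (W \<inter> ?X)" unfolding preim_def using WV by blast
    have "VS.subsp F (proj ` W \<inter> H)" by (rule VS.subsp_Int[OF U_sub VS.subsp_antimono[OF H FK]])
    hence c: "card (proj ` W \<inter> H) = q ^ sub_dim (sub_scalars K F) VS (proj ` W \<inter> H)"
      by (rule VS.card_eq_power_sub_dim[OF F])
    show ?thesis
    proof (rule card_bound[OF _ _ vV(1) W subset_refl _ _ r])
      show "card (proj ` (W \<inter> ?X)) = q ^ sub_dim (sub_scalars K F) VS (proj ` W \<inter> H)" using c eq by simp
      show "W \<inter> ?X \<subseteq> W" by auto
      show "W \<inter> ?X \<subseteq> {x \<in> W. \<sigma> x v = \<zero>\<^bsub>K\<^esub>}" using v(1) by (auto simp: perp_def)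
      show "card W = q ^ ((\<Sum>i<t. nv i - kv i) + (\<Sum>i<t. kv i))" using card_W n_split by (simp add: add.commute)
    qed
  qed
  show ?thesis unfolding scattered_def U
  proof (intro exI[of _ Us] conjI allI impI)
    show "nv i - kv i < nv i" if "i < t" for i using kv_pos[OF that] kv_less[OF that] by simp
  qed (use dec hyp1 hyp2 in blast)+
qed

end

theorem theorem1p37:
  fixes K :: "'a ring" and Fq :: "'a set" and V :: "('a, 'c) module"
    and W \<Gamma> :: "'c set" and \<sigma>' \<sigma> :: "'c \<Rightarrow> 'c \<Rightarrow> 'a"
    and q m n k t :: nat and nvec kvec :: "nat \<Rightarrow> nat"
  assumes prime_power: "\<exists>p r. prime (p::nat) \<and> 0 < r \<and> q = p ^ r"
    and m_pos: "0 < m"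
    and k_n: "1 \<le> k" "k < n"
    and field_K: "field K" and card_K: "card (carrier K) = q ^ m"
    and subfield_Fq: "subfield Fq K" and card_Fq: "card Fq = q"
    and V: "vectorspace K V" "vectorspace.fin_dim K V" "vectorspace.dim K V = n"
    and W: "VectorSpace.subspace (sub_scalars K Fq) W V" "sub_dim (sub_scalars K Fq) V W = n"
    and span_W: "lin_span K V W = carrier V"
    and \<sigma>': "bilinear_form (sub_scalars K Fq) (V\<lparr>carrier := W\<rparr>) \<sigma>'"
      "reflexive_form (sub_scalars K Fq) (V\<lparr>carrier := W\<rparr>) \<sigma>'"
      "nondegenerate_form (sub_scalars K Fq) (V\<lparr>carrier := W\<rparr>) \<sigma>'"
    and \<sigma>: "bilinear_form K V \<sigma>" "\<forall>x\<in>W. \<forall>y\<in>W. \<sigma> x y = \<sigma>' x y"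
    and \<Gamma>: "VectorSpace.subspace K \<Gamma> V" "sub_dim K V \<Gamma> = n - k" "\<Gamma> \<inter> W = {\<zero>\<^bsub>V\<^esub>}"
    and sum_k: "k = (\<Sum>i<t. kvec i)" and sum_n: "n = (\<Sum>i<t. nvec i)"
    and scattered_U: "scattered K Fq (quot_space V \<Gamma>) t kvec nvec (quot_image V \<Gamma> W)"
  shows "scattered K Fq (quot_space V (orth_compl K V \<sigma> \<Gamma>)) t (\<lambda>i. nvec i - kvec i) nvec
           (quot_image V (orth_compl K V \<sigma> \<Gamma>) W)"
proof -
  interpret vectorspace K V by fact
  have "0 < q" using prime_power prime_gt_0_nat by auto
  \<comment> \<open>\<open>card\<close> is 0 on infinite sets, whereas q ^ m is positive.\<close>
  hence fK: "finite (carrier K)" using card_K by (metis card.infinite power_eq_0_iff neq0_conv)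
  obtain B where B: "finite B" "basis B" using finite_basis_exists[OF V(2)] by auto
  hence BV: "B \<subseteq> carrier V" by (simp add: basis_def)
  have "carrier V \<subseteq> (\<lambda>a. lincomb a B) ` (B \<rightarrow>\<^sub>E carrier K)"
    using basis_criterion[OF B(1) BV] B(2) by blast
  moreover have "finite (B \<rightarrow>\<^sub>E carrier K)" by (rule finite_PiE) (use B fK in auto)
  ultimately have fV: "finite (carrier V)" using finite_surj by blast
  interpret finite_space K V by unfold_locales (use fK fV in auto)
  have FK: "Fq \<subseteq> carrier K" by (rule subfieldD(1)[OF subfield_Fq])
  have WF: "subsp Fq W" using W(1) subspace_iff_subsp[OF subfield_Fq] by simp
  have WV: "W \<subseteq> carrier V" by (rule subspD(1)[OF WF])
  have "rank_setup K V Fq W \<sigma> n"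
  proof (rule rank_setup.intro[OF finite_space_axioms], rule rank_setup_axioms.intro)
    show "subfield Fq K" "subsp Fq W" "span W = carrier V" by fact+
    show "card W = card Fq ^ n" using card_eq_power_sub_dim[OF subfield_Fq WF] W(2) by simp
    show "card (carrier V) = card (carrier K) ^ n" using card_carrier_eq_power_dim V(3) by simp
    show pV: "pairing (carrier K) (carrier V) (carrier V) \<sigma>"
      using \<sigma>(1) subsp_carrier unfolding bilinear_form_def pairing_def by blast
    show "pairing Fq W W \<sigma>"
      unfolding pairing_def
    proof (intro conjI ballI)
      show "\<sigma> x y \<in> Fq" if "x \<in> W" "y \<in> W" for x y
        using \<sigma>'(1) \<sigma>(2) that by (simp add: bilinear_form_def)
    qed (use WF \<sigma>(1) WV FK in \<open>auto simp: bilinear_form_def subset_iff\<close>)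
    have "perp \<sigma> W W \<subseteq> {\<zero>\<^bsub>V\<^esub>}"
    proof
      fix x assume x: "x \<in> perp \<sigma> W W"
      hence "x \<in> W" "\<forall>y\<in>W. \<sigma>' x y = \<zero>\<^bsub>K\<^esub>" using \<sigma>(2) by (auto simp: perp_def)
      thus "x \<in> {\<zero>\<^bsub>V\<^esub>}" using \<sigma>'(3) by (simp add: nondegenerate_form_def)
    qed
    moreover have "\<zero>\<^bsub>V\<^esub> \<in> perp \<sigma> W W"
      using pairing_zero[OF subfield_carrier pV] subspD(2)[OF WF] WV by (auto simp: perp_def)
    ultimately show "perp \<sigma> W W = {\<zero>\<^bsub>V\<^esub>}" by blast
  qed
  then interpret rank_setup K V Fq W \<sigma> n .
  have \<Gamma>s: "subsp (carrier K) \<Gamma>" using \<Gamma>(1) subspace_iff_subsp_carrier by simp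
  have "\<exists>P. scattered_decomposition K V Fq W \<sigma> n t P \<Gamma> nvec kvec"
  proof (rule scattered_decomposition_exists[OF \<Gamma>s _ _ sum_n _ scattered_U])
    show "W \<inter> \<Gamma> = {\<zero>\<^bsub>V\<^esub>}" using \<Gamma>(3) by auto
    show "0 < t" using k_n sum_k by (cases t) auto
    show "card \<Gamma> = card (carrier K) ^ (n - (\<Sum>i<t. kvec i))"
      using card_eq_power_sub_dim_carrier[OF \<Gamma>s] \<Gamma>(2) sum_k by simp
  qed
  then obtain P where "scattered_decomposition K V Fq W \<sigma> n t P \<Gamma> nvec kvec" by blast
  then interpret scattered_decomposition K V Fq W \<sigma> n t P \<Gamma> nvec kvec .
  have "orth_compl K V \<sigma> \<Gamma> = perp \<sigma> (carrier V) \<Gamma>" by (simp add: orth_compl_def perp_def)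
  thus ?thesis using dual_scattered by simp
qed

end
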